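(* (1) Let $k\in(-\infty,2)$. The connected sum of two compact connected locally conformally flat Riemannian manifolds of the same dimension $n\geq 3$, each with positive modified Einstein tensor $\mathrm{Ein}_k$, admits a locally conformally flat metric with positive $\mathrm{Ein}_k$ tensor. (2) Let $k\geq 2$. The connected sum of two compact connected locally conformally flat Riemannian manifolds of the same dimension $n>k+1$, each with positive $\mathrm{Ein}_k$ tensor, admits a locally conformally flat metric with positive $\mathrm{Ein}_k$ tensor.
   Context: For a Riemannian metric $g$ and $k\in\mathbb{R}$, the $k$-th modified Einstein tensor is $\mathrm{Ein}_k(g):=\mathrm{Scal}\,g-k\,\mathrm{Ric}$, where $\mathrm{Ric}$ and $\mathrm{Scal}$ are the Ricci and scalar curvatures of $g$; it is called positive if this symmetric 2-tensor is positive definite at every point. Manifolds are without boundary. *)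

theory Defs
  imports "HOL-Analysis.Analysis"
begin

section \<open>Smooth maps between normed spaces\<close>

text \<open>Both notions are meant for open sets \<open>S\<close>.\<close>

primrec Ck_on :: "nat \<Rightarrow> 'a::real_normed_vector set \<Rightarrow> ('a \<Rightarrow> 'b::real_normed_vector) \<Rightarrow> bool" where
  "Ck_on 0 S f \<longleftrightarrow> continuous_on S f"
| "Ck_on (Suc k) S f \<longleftrightarrow> (\<forall>x\<in>S. f differentiable (at x)) \<and>
     (\<forall>v. Ck_on k S (\<lambda>x. frechet_derivative f (at x) v))"

definition smooth_on :: "'a::real_normed_vector set \<Rightarrow> ('a \<Rightarrow> 'b::real_normed_vector) \<Rightarrow> bool" where
  "smooth_on S f \<longleftrightarrow> (\<forall>k. Ck_on k S f)"


section \<open>Smooth manifolds without boundary\<close>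

text \<open>A chart is a pair of a domain and a coordinate map; the values of the coordinate map outside
  the domain are irrelevant. The dimension is \<open>CARD('n)\<close>.\<close>

type_synonym ('a, 'n) chart = "'a set \<times> ('a \<Rightarrow> real ^ 'n)"

abbreviation chart_image :: "('a, 'n::finite) chart \<Rightarrow> (real ^ 'n) set" where
  "chart_image c \<equiv> snd c ` fst c"

record ('a, 'n::finite) manifold =
  mtop :: "'a topology"
  atlas :: "('a, 'n) chart set"

definition chart_on :: "'a topology \<Rightarrow> ('a, 'n::finite) chart \<Rightarrow> bool" where
  "chart_on X c \<longleftrightarrow> openin X (fst c) \<and> open (chart_image c) \<and>
     homeomorphic_map (subtopology X (fst c)) (top_of_set (chart_image c)) (snd c)"

definition transition :: "('a, 'n::finite) chart \<Rightarrow> ('a, 'n) chart \<Rightarrow> real ^ 'n \<Rightarrow> real ^ 'n" where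
  "transition c d = snd d \<circ> inv_into (fst c) (snd c)"

definition compatible :: "('a, 'n::finite) chart \<Rightarrow> ('a, 'n) chart \<Rightarrow> bool" where
  "compatible c d \<longleftrightarrow> smooth_on (snd c ` (fst c \<inter> fst d)) (transition c d) \<and>
     smooth_on (snd d ` (fst c \<inter> fst d)) (transition d c)"

definition smooth_manifold :: "('a, 'n::finite) manifold \<Rightarrow> bool" where
  "smooth_manifold M \<longleftrightarrow> Hausdorff_space (mtop M) \<and> second_countable (mtop M) \<and>
     (\<forall>c\<in>atlas M. chart_on (mtop M) c) \<and> (\<Union>c\<in>atlas M. fst c) = topspace (mtop M) \<and>
     (\<forall>c\<in>atlas M. \<forall>d\<in>atlas M. compatible c d)"

text \<open>The maximal atlas generated by the given one.\<close>

definition charts :: "('a, 'n::finite) manifold \<Rightarrow> ('a, 'n) chart set" where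
  "charts M = {c. chart_on (mtop M) c \<and> (\<forall>d\<in>atlas M. compatible c d)}"


section \<open>Tensor fields of type (0,2) and Riemannian metrics\<close>

text \<open>A (0,2)-tensor field is the family of its component matrices, one matrix-valued function
  on the image of each chart of the maximal atlas, subject to the usual transformation law.
  Values at pairs outside these sets are irrelevant.\<close>

type_synonym ('a, 'n) tensor2 = "('a, 'n) chart \<Rightarrow> real ^ 'n \<Rightarrow> real ^ 'n ^ 'n"

definition smooth_tensor2 :: "('a, 'n::finite) manifold \<Rightarrow> ('a, 'n) tensor2 \<Rightarrow> bool" where
  "smooth_tensor2 M T \<longleftrightarrow> (\<forall>c\<in>charts M. smooth_on (chart_image c) (T c)) \<and>
     (\<forall>c\<in>charts M. \<forall>d\<in>charts M. \<forall>x\<in>snd c ` (fst c \<inter> fst d).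
        let J = matrix (frechet_derivative (transition c d) (at x))
        in T c x = transpose J ** T d (transition c d x) ** J)"

definition symmetric_tensor2 :: "('a, 'n::finite) manifold \<Rightarrow> ('a, 'n) tensor2 \<Rightarrow> bool" where
  "symmetric_tensor2 M T \<longleftrightarrow> (\<forall>c\<in>charts M. \<forall>x\<in>chart_image c. transpose (T c x) = T c x)"

definition positive_tensor2 :: "('a, 'n::finite) manifold \<Rightarrow> ('a, 'n) tensor2 \<Rightarrow> bool" where
  "positive_tensor2 M T \<longleftrightarrow>
     (\<forall>c\<in>charts M. \<forall>x\<in>chart_image c. \<forall>v. v \<noteq> 0 \<longrightarrow> v \<bullet> (T c x *v v) > 0)"

definition riemannian_manifold :: "('a, 'n::finite) manifold \<Rightarrow> ('a, 'n) tensor2 \<Rightarrow> bool" where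
  "riemannian_manifold M g \<longleftrightarrow> smooth_manifold M \<and>
     smooth_tensor2 M g \<and> symmetric_tensor2 M g \<and> positive_tensor2 M g"


section \<open>Curvature\<close>

text \<open>In the following \<open>G\<close> is the component matrix of a metric on an open subset of \<open>\<real>\<^sup>n\<close>.\<close>

definition partial_deriv :: "'n::finite \<Rightarrow> (real ^ 'n \<Rightarrow> real) \<Rightarrow> real ^ 'n \<Rightarrow> real" where
  "partial_deriv i f x = frechet_derivative f (at x) (axis i 1)"

text \<open>\<open>christoffel G l i j\<close> has upper index \<open>l\<close>.\<close>

definition christoffel ::
  "(real ^ 'n \<Rightarrow> real ^ 'n ^ 'n) \<Rightarrow> 'n::finite \<Rightarrow> 'n \<Rightarrow> 'n \<Rightarrow> real ^ 'n \<Rightarrow> real" where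
  "christoffel G l i j x = (1/2) * (\<Sum>m\<in>UNIV. matrix_inv (G x) $ l $ m *
     (partial_deriv i (\<lambda>y. G y $ j $ m) x + partial_deriv j (\<lambda>y. G y $ i $ m) x
        - partial_deriv m (\<lambda>y. G y $ i $ j) x))"

text \<open>\<open>riemann G l i j k\<close> is the coefficient of the \<open>l\<close>-th coordinate field in
  \<open>R(\<partial>\<^sub>j, \<partial>\<^sub>k) \<partial>\<^sub>i\<close>, where \<open>R(X,Y) = [\<nabla>\<^sub>X, \<nabla>\<^sub>Y] - \<nabla>\<^bsub>[X,Y]\<^esub>\<close>. The Ricci tensor contracts \<open>l\<close> with \<open>j\<close>,
  so that it is positive on round spheres.\<close>

definition riemann ::
  "(real ^ 'n \<Rightarrow> real ^ 'n ^ 'n) \<Rightarrow> 'n::finite \<Rightarrow> 'n \<Rightarrow> 'n \<Rightarrow> 'n \<Rightarrow> real ^ 'n \<Rightarrow> real" where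
  "riemann G l i j k x =
     partial_deriv j (christoffel G l k i) x - partial_deriv k (christoffel G l j i) x
     + (\<Sum>m\<in>UNIV. christoffel G l j m x * christoffel G m k i x
                 - christoffel G l k m x * christoffel G m j i x)"

definition ricci :: "(real ^ 'n \<Rightarrow> real ^ 'n ^ 'n) \<Rightarrow> real ^ 'n \<Rightarrow> real ^ 'n::finite ^ 'n" where
  "ricci G x = (\<chi> i k. \<Sum>l\<in>UNIV. riemann G l i l k x)"

definition scalar_curvature :: "(real ^ 'n \<Rightarrow> real ^ 'n ^ 'n) \<Rightarrow> real ^ 'n::finite \<Rightarrow> real" where
  "scalar_curvature G x = (\<Sum>i\<in>UNIV. \<Sum>j\<in>UNIV. matrix_inv (G x) $ i $ j * ricci G x $ i $ j)"

definition Ein :: "real \<Rightarrow> ('a, 'n::finite) tensor2 \<Rightarrow> ('a, 'n) tensor2" where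
  "Ein k g = (\<lambda>c x. scalar_curvature (g c) x *\<^sub>R g c x - k *\<^sub>R ricci (g c) x)"

text \<open>Every point has a neighbourhood that is conformally diffeomorphic to an open subset of
  Euclidean space; such a diffeomorphism is a chart.\<close>

definition locally_conformally_flat :: "('a, 'n::finite) manifold \<Rightarrow> ('a, 'n) tensor2 \<Rightarrow> bool" where
  "locally_conformally_flat M g \<longleftrightarrow> (\<forall>p\<in>topspace (mtop M). \<exists>c\<in>charts M. p \<in> fst c \<and>
     (\<exists>f :: real ^ 'n \<Rightarrow> real. smooth_on (chart_image c) f \<and>
        (\<forall>x\<in>chart_image c. g c x = exp (2 * f x) *\<^sub>R mat 1)))"


section \<open>Connected sums\<close>

text \<open>A smooth embedding of the closed unit disc of full dimension is one that extends to a
  diffeomorphism from an open neighbourhood \<open>V\<close> of the disc onto an open set, that is, to the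
  inverse of a chart. No condition relative to an orientation is imposed.\<close>

definition disc_embedding :: "('a, 'n::finite) manifold \<Rightarrow> (real ^ 'n \<Rightarrow> 'a) \<Rightarrow> bool" where
  "disc_embedding M h \<longleftrightarrow>
     (\<exists>V. open V \<and> cball 0 1 \<subseteq> V \<and> inj_on h V \<and> (h ` V, inv_into V h) \<in> charts M)"

text \<open>The connected sum along disc embeddings \<open>h\<close>, \<open>k\<close> is obtained from the disjoint sum of
  the two manifolds, punctured at \<open>h 0\<close> and \<open>k 0\<close>, by identifying \<open>h (t u)\<close> with
  \<open>k ((1 - t) u)\<close> for all unit vectors \<open>u\<close> and \<open>0 < t < 1\<close> (Kervaire and Milnor). Its points are
  the equivalence classes.\<close>

definition punctured_sum :: "('a, 'n::finite) manifold \<Rightarrow> ('b, 'n) manifold \<Rightarrow>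
    (real ^ 'n \<Rightarrow> 'a) \<Rightarrow> (real ^ 'n \<Rightarrow> 'b) \<Rightarrow> ('a + 'b) set" where
  "punctured_sum M N h k = (topspace (mtop M) - {h 0}) <+> (topspace (mtop N) - {k 0})"

definition glue_pairs ::
  "(real ^ 'n::finite \<Rightarrow> 'a) \<Rightarrow> (real ^ 'n \<Rightarrow> 'b) \<Rightarrow> (('a + 'b) \<times> ('a + 'b)) set" where
  "glue_pairs h k = {(Inl (h (t *\<^sub>R u)), Inr (k ((1 - t) *\<^sub>R u))) | t u. 0 < t \<and> t < 1 \<and> norm u = 1}"

definition glue_rel :: "('a, 'n::finite) manifold \<Rightarrow> ('b, 'n) manifold \<Rightarrow>
    (real ^ 'n \<Rightarrow> 'a) \<Rightarrow> (real ^ 'n \<Rightarrow> 'b) \<Rightarrow> (('a + 'b) \<times> ('a + 'b)) set" where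
  "glue_rel M N h k = Id_on (punctured_sum M N h k) \<union> glue_pairs h k \<union> (glue_pairs h k)\<inverse>"

definition glue_inl :: "('a, 'n::finite) manifold \<Rightarrow> ('b, 'n) manifold \<Rightarrow>
    (real ^ 'n \<Rightarrow> 'a) \<Rightarrow> (real ^ 'n \<Rightarrow> 'b) \<Rightarrow> 'a \<Rightarrow> ('a + 'b) set" where
  "glue_inl M N h k x = glue_rel M N h k `` {Inl x}"

definition glue_inr :: "('a, 'n::finite) manifold \<Rightarrow> ('b, 'n) manifold \<Rightarrow>
    (real ^ 'n \<Rightarrow> 'a) \<Rightarrow> (real ^ 'n \<Rightarrow> 'b) \<Rightarrow> 'b \<Rightarrow> ('a + 'b) set" where
  "glue_inr M N h k y = glue_rel M N h k `` {Inr y}"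

definition csum_open :: "('a, 'n::finite) manifold \<Rightarrow> ('b, 'n) manifold \<Rightarrow>
    (real ^ 'n \<Rightarrow> 'a) \<Rightarrow> (real ^ 'n \<Rightarrow> 'b) \<Rightarrow> ('a + 'b) set set \<Rightarrow> bool" where
  "csum_open M N h k W \<longleftrightarrow> W \<subseteq> punctured_sum M N h k // glue_rel M N h k \<and>
     openin (subtopology (mtop M) (- {h 0})) {x \<in> topspace (mtop M) - {h 0}. glue_inl M N h k x \<in> W} \<and>
     openin (subtopology (mtop N) (- {k 0})) {y \<in> topspace (mtop N) - {k 0}. glue_inr M N h k y \<in> W}"

text \<open>The topology is the quotient topology, the atlas consists of the (punctured) charts of the two
  summands. A class lying in the image of \<open>glue_inl\<close> contains exactly one element of the form
  \<open>Inl x\<close>, and similarly for \<open>glue_inr\<close>.\<close>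

definition connected_sum :: "('a, 'n::finite) manifold \<Rightarrow> ('b, 'n) manifold \<Rightarrow>
    (real ^ 'n \<Rightarrow> 'a) \<Rightarrow> (real ^ 'n \<Rightarrow> 'b) \<Rightarrow> (('a + 'b) set, 'n) manifold" where
  "connected_sum M N h k =
     \<lparr> mtop = topology (csum_open M N h k),
       atlas = {(glue_inl M N h k ` (U - {h 0}), \<lambda>q. \<phi> (THE x. Inl x \<in> q)) | U \<phi>. (U, \<phi>) \<in> atlas M} \<union>
               {(glue_inr M N h k ` (U - {k 0}), \<lambda>q. \<phi> (THE y. Inr y \<in> q)) | U \<phi>. (U, \<phi>) \<in> atlas N} \<rparr>"

lemma istopology_csum_open:
  fixes M :: "('a, 'n::finite) manifold" and N :: "('b, 'n) manifold"
  shows "istopology (csum_open M N h k)"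
  unfolding istopology_def
proof (intro conjI allI impI)
  fix S T assume ST: "csum_open M N h k S" "csum_open M N h k T"
  let ?A = "topspace (mtop M) - {h 0}" and ?B = "topspace (mtop N) - {k 0}"
  have "{x \<in> ?A. glue_inl M N h k x \<in> S \<inter> T} =
      {x \<in> ?A. glue_inl M N h k x \<in> S} \<inter> {x \<in> ?A. glue_inl M N h k x \<in> T}"
    "{y \<in> ?B. glue_inr M N h k y \<in> S \<inter> T} =
      {y \<in> ?B. glue_inr M N h k y \<in> S} \<inter> {y \<in> ?B. glue_inr M N h k y \<in> T}"
    by auto
  with ST show "csum_open M N h k (S \<inter> T)"
    unfolding csum_open_def by (simp only: openin_Int le_infI1 simp_thms)
next
  fix K assume K: "\<forall>W\<in>K. csum_open M N h k W"
  let ?A = "topspace (mtop M) - {h 0}" and ?B = "topspace (mtop N) - {k 0}"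
  have eq: "{x \<in> ?A. glue_inl M N h k x \<in> \<Union>K} = (\<Union>W\<in>K. {x \<in> ?A. glue_inl M N h k x \<in> W})"
    "{y \<in> ?B. glue_inr M N h k y \<in> \<Union>K} = (\<Union>W\<in>K. {y \<in> ?B. glue_inr M N h k y \<in> W})"
    by auto
  show "csum_open M N h k (\<Union>K)"
    unfolding csum_open_def eq
  proof (intro conjI Union_least openin_Union)
  qed (use K in \<open>auto simp only: csum_open_def\<close>)
qed

lemma equiv_glue_rel:
  fixes M :: "('a, 'n::finite) manifold" and N :: "('b, 'n) manifold"
  assumes "disc_embedding M h" "disc_embedding N k"
  shows "equiv (punctured_sum M N h k) (glue_rel M N h k)"
proof -
  have disc: "inj_on f (cball 0 1)" "f ` cball 0 1 \<subseteq> topspace (mtop L)"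
    if L: "disc_embedding L f" for L :: "('c, 'n) manifold" and f
  proof -
    obtain V where V: "cball 0 1 \<subseteq> V" "inj_on f V" "(f ` V, inv_into V f) \<in> charts L"
      using L unfolding disc_embedding_def by blast
    from V(3) have "openin (mtop L) (f ` V)"
      by (simp add: charts_def chart_on_def)
    then show "f ` cball 0 1 \<subseteq> topspace (mtop L)"
      by (rule order_trans[OF image_mono[OF V(1)] openin_subset])
    show "inj_on f (cball 0 1)"
      by (rule inj_on_subset[OF V(2,1)])
  qed
  have ne: "f (t *\<^sub>R u) \<noteq> f 0" "f (t *\<^sub>R u) \<in> topspace (mtop L)"
    if "disc_embedding L f" "0 < t" "t < 1" "norm u = 1" for L :: "('c, 'n) manifold" and f t u
  proof -
    have "t *\<^sub>R u \<noteq> 0"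
      using that by (metis norm_zero scaleR_eq_0_iff less_irrefl zero_neq_one)
    moreover have in_ball: "t *\<^sub>R u \<in> cball 0 1" "(0 :: real ^ 'n) \<in> cball 0 1"
      using that by simp_all
    ultimately show "f (t *\<^sub>R u) \<noteq> f 0"
      using inj_on_eq_iff[OF disc(1)[OF that(1)]] by metis
    show "f (t *\<^sub>R u) \<in> topspace (mtop L)"
      using disc(2)[OF that(1)] in_ball(1) by (rule subsetD[OF _ imageI])
  qed
  have polar: "t = t' \<and> u = u'"
    if "disc_embedding L f" "f (t *\<^sub>R u) = f (t' *\<^sub>R u')"
      "0 < t" "t < 1" "norm u = 1" "0 < t'" "t' < 1" "norm u' = 1"
    for L :: "('c, 'n) manifold" and f t u t' u'
  proof -
    have eq: "t *\<^sub>R u = t' *\<^sub>R u'"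
      by (rule inj_onD[OF disc(1)[OF that(1)] that(2)]) (use that(3-8) in simp_all)
    then have "norm (t *\<^sub>R u) = norm (t' *\<^sub>R u')"
      by simp
    then have "t = t'"
      using that(3-8) by simp
    with eq that(3) show ?thesis
      by simp
  qed
  let ?P = "glue_pairs h k" and ?S = "punctured_sum M N h k"
  have P: "\<exists>t u. p = (Inl (h (t *\<^sub>R u)), Inr (k ((1 - t) *\<^sub>R u))) \<and> 0 < t \<and> t < 1 \<and> norm u = 1"
    if "p \<in> ?P" for p
    using that unfolding glue_pairs_def by blast
  have sub: "?P \<subseteq> ?S \<times> ?S"
  proof
    fix p assume "p \<in> ?P"
    then obtain t u where *: "p = (Inl (h (t *\<^sub>R u)), Inr (k ((1 - t) *\<^sub>R u)))"
      "0 < t" "t < 1" "norm u = 1"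
      using P by blast
    then show "p \<in> ?S \<times> ?S"
      using ne[OF assms(1), of t u] ne[OF assms(2), of "1 - t" u]
      unfolding punctured_sum_def *(1) by (simp add: InlI InrI)
  qed
  have un1: "y = z" if P12: "(x, y) \<in> ?P" "(x, z) \<in> ?P" for x y z
  proof -
    obtain t u where 1: "x = Inl (h (t *\<^sub>R u))" "y = Inr (k ((1 - t) *\<^sub>R u))"
      "0 < t" "t < 1" "norm u = 1"
      using P[OF P12(1)] by blast
    obtain t' u' where 2: "x = Inl (h (t' *\<^sub>R u'))" "z = Inr (k ((1 - t') *\<^sub>R u'))"
      "0 < t'" "t' < 1" "norm u' = 1"
      using P[OF P12(2)] by blast
    have "h (t *\<^sub>R u) = h (t' *\<^sub>R u')"
      using 1(1) 2(1) by simp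
    then have "t = t' \<and> u = u'"
      using 1(3-5) 2(3-5) by (intro polar[OF assms(1)]) simp_all
    then show ?thesis
      using 1(2) 2(2) by simp
  qed
  have un2: "x = z" if P12: "(x, y) \<in> ?P" "(z, y) \<in> ?P" for x y z
  proof -
    obtain t u where 1: "x = Inl (h (t *\<^sub>R u))" "y = Inr (k ((1 - t) *\<^sub>R u))"
      "0 < t" "t < 1" "norm u = 1"
      using P[OF P12(1)] by blast
    obtain t' u' where 2: "z = Inl (h (t' *\<^sub>R u'))" "y = Inr (k ((1 - t') *\<^sub>R u'))"
      "0 < t'" "t' < 1" "norm u' = 1"
      using P[OF P12(2)] by blast
    have "k ((1 - t) *\<^sub>R u) = k ((1 - t') *\<^sub>R u')"
      using 1(2) 2(2) by simp
    then have "1 - t = 1 - t' \<and> u = u'"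
      using 1(3-5) 2(3-5) by (intro polar[OF assms(2)]) simp_all
    then show ?thesis
      using 1(1) 2(1) by simp
  qed
  have no: False if "(x, y) \<in> ?P" "(y, z) \<in> ?P" for x y z
    using P[OF that(1)] P[OF that(2)] by (metis Inl_Inr_False prod.inject)
  show ?thesis
  proof (rule equivI)
    show "refl_on ?S (glue_rel M N h k)"
      by (simp add: refl_on_def glue_rel_def Id_on_iff)
    show "sym (glue_rel M N h k)"
      unfolding glue_rel_def by (rule symI) blast
    show "trans (glue_rel M N h k)"
    proof (rule transI)
      fix x y z assume "(x, y) \<in> glue_rel M N h k" "(y, z) \<in> glue_rel M N h k"
      then consider "x = y" | "y = z" | "(x, y) \<in> ?P" "(y, z) \<in> ?P" | "(x, y) \<in> ?P" "(z, y) \<in> ?P"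
        | "(y, x) \<in> ?P" "(y, z) \<in> ?P" | "(y, x) \<in> ?P" "(z, y) \<in> ?P"
        unfolding glue_rel_def by blast
      then show "(x, z) \<in> glue_rel M N h k"
      proof cases
        case 3
        then show ?thesis using no by iprover
      next
        case 4
        then have "x = z" by (rule un2)
        with 4(1) sub show ?thesis unfolding glue_rel_def by blast
      next
        case 5
        then have "x = z" by (rule un1)
        with 5(1) sub show ?thesis unfolding glue_rel_def by blast
      next
        case 6
        then show ?thesis using no by iprover
      qed (use \<open>(x, y) \<in> glue_rel M N h k\<close> \<open>(y, z) \<in> glue_rel M N h k\<close> in simp_all)
    qed
    show "glue_rel M N h k \<subseteq> ?S \<times> ?S"
      using sub by (auto simp: glue_rel_def)
  qed
qed

end

(* On a conformally flat chart write the metric as u^(2q) times the Euclidean one.  If k < n - 1 and q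
   is large, then Ein_k > 0 means that certain expressions in the 2-jet of u, concave and homogeneous
   of degree one, are positive; hence two admissible factors on the same chart may be added.  Choose
   conformal charts centred at the two disc centres, transport the second factor to the first chart
   by an inversion in a small sphere, and add the two factors on the overlapping annulus, cutting
   each of them off where it is C^2-small.  The result is a conformally flat neck joining the two
   metrics.

   The disc embeddings need not be conformal, but near its centre a disc differs from a conformal
   chart by a local diffeomorphism.  After composing the chart with an orthogonal matrix its
   derivative at the centre is positive definite, so a logarithmically slow cutoff interpolates it
   with the identity through strictly monotone, hence injective, maps.  The neck is inserted by a
   radial diffeomorphism carrying the gluing t -> 1 - t to the inversion near both ends. *)

theory Submission
  imports Defs
begin

section \<open>Calculus of smooth maps\<close>

text \<open>Writing the exponent as q ln u turns Ein_k(v,v) into q/u times a linear second order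
  expression in u plus Q(grad u)/u. The quadratic form Q(a) contains -q(n-2)(n-1-k)|v|^2|a|^2 -
  qk(n-2)(a.v)^2; for k < n - 1 this makes Q nonpositive once q is large, and then Q(a)/u is concave
  in (a,u). Both ranges of k in the theorem lie in n >= 3, k < n - 1.

  The cutoff annulus must stay fixed while the inverting sphere shrinks. Under z -> s z/|z|^2 the
  transported factor is s^(1/q) times a function smooth in (s,z) across s = 0, so its 2-jet on a
  fixed annulus tends to 0.

  The gluing is prescribed, so the metrics have to adapt to the discs. An orthogonal change of a
  conformal chart keeps it conformal and removes the rotation or reflection in the derivative that
  could make the interpolation with the identity degenerate.

  Curvature is treated on coordinate domains only; a compatible family of local metrics then gives
  the tensor on the maximal atlas.\<close>

abbreviation dderiv :: "('a::real_normed_vector \<Rightarrow> 'b::real_normed_vector) \<Rightarrow> 'a \<Rightarrow> 'a \<Rightarrow> 'b" where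
  "dderiv f v x \<equiv> frechet_derivative f (at x) v"

lemma dderiv_eq: "(f has_derivative f') (at x) \<Longrightarrow> dderiv f v x = f' v"
  using frechet_derivative_at by metis

lemma has_derivative_dderiv: "f differentiable (at x) \<Longrightarrow> (f has_derivative (\<lambda>v. dderiv f v x)) (at x)"
  using frechet_derivative_works by blast

lemma dderiv_cong:
  assumes "open S" "x \<in> S" "\<And>y. y \<in> S \<Longrightarrow> f y = g y"
  shows "dderiv f v x = dderiv g v x"
proof -
  have "(f has_derivative F) (at x) = (g has_derivative F) (at x)" for F
    using has_derivative_transform_within_open[OF _ assms(1,2)] assms(3) by metis
  then show ?thesis unfolding frechet_derivative_def by simp
qed

lemma differentiable_cong_open:
  assumes "open S" "x \<in> S" "\<And>y. y \<in> S \<Longrightarrow> f y = g y" "f differentiable (at x)"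
  shows "g differentiable (at x)"
  using assms has_derivative_transform_within_open[OF _ assms(1,2)] unfolding differentiable_def by metis

lemma Ck_on_cong:
  assumes "open S" "\<And>x. x \<in> S \<Longrightarrow> f x = g x" "Ck_on k S f"
  shows "Ck_on k S g"
  using assms(2,3)
proof (induction k arbitrary: f g)
  case 0
  then show ?case using continuous_on_cong by (metis Ck_on.simps(1))
next
  case (Suc k)
  show ?case unfolding Ck_on.simps
  proof (intro conjI ballI allI)
    fix x assume "x \<in> S" then show "g differentiable (at x)"
      using Suc.prems differentiable_cong_open[OF assms(1), of x f g] by simp
  next
    fix v show "Ck_on k S (dderiv g v)"
      by (rule Suc.IH[of "dderiv f v"]) (use Suc.prems dderiv_cong[OF assms(1), of _ f g] in auto)
  qed
qed

lemma Ck_on_continuous: "Ck_on k S f \<Longrightarrow> continuous_on S f"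
  by (cases k) (auto simp: differentiable_imp_continuous_on differentiable_on_def 
      intro!: differentiable_imp_continuous_on differentiable_at_imp_differentiable_on)

lemma Ck_on_Suc_imp: "Ck_on (Suc k) S f \<Longrightarrow> Ck_on k S f"
proof (induction k arbitrary: f)
  case 0
  then show ?case using Ck_on_continuous by (metis Ck_on.simps(1))
next
  case (Suc k)
  then show ?case by (metis Ck_on.simps(2))
qed

lemma Ck_on_subset: "Ck_on k S f \<Longrightarrow> T \<subseteq> S \<Longrightarrow> Ck_on k T f"
  by (induction k arbitrary: f) (auto intro: continuous_on_subset)

text \<open>The condition is pointwise, and an open T around x decides the derivatives at x. This is
  what makes functions given by different formulas on overlapping open sets smooth.\<close>

lemma Ck_on_local:
  assumes "\<And>x. x \<in> S \<Longrightarrow> \<exists>T. open T \<and> x \<in> T \<and> Ck_on k T f"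
  shows "Ck_on k S f"
  using assms
proof (induction k arbitrary: f)
  case 0
  have "isCont f x" if "x \<in> S" for x
    using 0[OF that] continuous_on_eq_continuous_at by auto
  then show ?case by (simp add: continuous_at_imp_continuous_on)
next
  case (Suc k)
  show ?case unfolding Ck_on.simps
  proof (intro conjI ballI allI)
    fix v show "Ck_on k S (dderiv f v)" using Suc.prems by (intro Suc.IH) fastforce
  qed (use Suc.prems in fastforce)
qed

lemma smooth_on_cong: "open S \<Longrightarrow> (\<And>x. x \<in> S \<Longrightarrow> f x = g x) \<Longrightarrow> smooth_on S f \<Longrightarrow> smooth_on S g"
  unfolding smooth_on_def using Ck_on_cong by blast

lemma smooth_on_subset: "smooth_on S f \<Longrightarrow> T \<subseteq> S \<Longrightarrow> smooth_on T f"
  unfolding smooth_on_def using Ck_on_subset by blast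

lemma smooth_on_local:
  assumes "\<And>x. x \<in> S \<Longrightarrow> \<exists>T. open T \<and> x \<in> T \<and> smooth_on T f"
  shows "smooth_on S f"
  using assms Ck_on_local[of S _ f] unfolding smooth_on_def by meson

lemma smooth_on_Un_open: "open S \<Longrightarrow> open T \<Longrightarrow> smooth_on S f \<Longrightarrow> smooth_on T f \<Longrightarrow> smooth_on (S \<union> T) f"
  by (rule smooth_on_local) blast

lemma smooth_on_continuous: "smooth_on S f \<Longrightarrow> continuous_on S f"
  unfolding smooth_on_def using Ck_on_continuous by blast

lemma smooth_on_differentiable: "smooth_on S f \<Longrightarrow> x \<in> S \<Longrightarrow> f differentiable (at x)"
  unfolding smooth_on_def by (metis Ck_on.simps(2))

lemma smooth_on_dderiv: "smooth_on S f \<Longrightarrow> smooth_on S (dderiv f v)"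
  unfolding smooth_on_def by (metis Ck_on.simps(2))

lemma smooth_on_has_derivative:
  "smooth_on S f \<Longrightarrow> x \<in> S \<Longrightarrow> (f has_derivative (\<lambda>v. dderiv f v x)) (at x)"
  by (simp add: has_derivative_dderiv smooth_on_differentiable)

lemma Ck_on_const [simp]: "Ck_on k S (\<lambda>x. c)"
  by (induction k arbitrary: c) auto

lemma smooth_on_const [simp]: "smooth_on S (\<lambda>x. c)"
  by (simp add: smooth_on_def)

text \<open>Lets an induction on k work with any explicit formula for the derivative in place of
  \<open>frechet_derivative\<close>; openness of S permits the exchange.\<close>

lemma Ck_on_Suc_intro:
  assumes "open S" "\<And>x. x \<in> S \<Longrightarrow> (f has_derivative (\<lambda>v. f' v x)) (at x)" "\<And>v. Ck_on k S (f' v)"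
  shows "Ck_on (Suc k) S f"
  unfolding Ck_on.simps
proof (intro conjI ballI allI)
  fix v show "Ck_on k S (dderiv f v)"
    by (rule Ck_on_cong[OF assms(1) _ assms(3)[of v]]) (simp add: dderiv_eq[OF assms(2)])
qed (use assms(2) differentiableI in blast)

lemma Ck_on_linear_comp:
  assumes "open S" "bounded_linear A" "Ck_on k S f"
  shows "Ck_on k S (\<lambda>x. A (f x))"
  using assms(3)
proof (induction k arbitrary: f)
  case 0
  then show ?case using assms(2) by (auto simp: bounded_linear.continuous_on)
next
  case (Suc k)
  show ?case
    by (rule Ck_on_Suc_intro[OF assms(1), of _ "\<lambda>v x. A (dderiv f v x)"])
      (use Suc in \<open>auto intro!: bounded_linear.has_derivative[OF assms(2)] has_derivative_dderiv\<close>)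
qed

lemma smooth_on_linear_comp: "open S \<Longrightarrow> bounded_linear A \<Longrightarrow> smooth_on S f \<Longrightarrow> smooth_on S (\<lambda>x. A (f x))"
  by (simp add: smooth_on_def Ck_on_linear_comp)

lemma Ck_on_id: "Ck_on k S (\<lambda>x. x)"
  by (cases k) (auto)

lemma smooth_on_id [simp]: "smooth_on S (\<lambda>x. x)"
  by (simp add: smooth_on_def Ck_on_id)

lemma smooth_on_linear: "open S \<Longrightarrow> bounded_linear A \<Longrightarrow> smooth_on S A"
  using smooth_on_linear_comp[of S A "\<lambda>x. x"] by simp

lemma Ck_on_add:
  assumes "open S" "Ck_on k S f" "Ck_on k S g"
  shows "Ck_on k S (\<lambda>x. f x + g x)"
  using assms(2,3)
proof (induction k arbitrary: f g)
  case 0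
  then show ?case by (auto intro: continuous_intros)
next
  case (Suc k)
  show ?case
    by (rule Ck_on_Suc_intro[OF assms(1), of _ "\<lambda>v x. dderiv f v x + dderiv g v x"])
      (use Suc in \<open>auto intro!: has_derivative_add has_derivative_dderiv\<close>)
qed

lemma smooth_on_add: "open S \<Longrightarrow> smooth_on S f \<Longrightarrow> smooth_on S g \<Longrightarrow> smooth_on S (\<lambda>x. f x + g x)"
  by (simp add: smooth_on_def Ck_on_add)

lemma smooth_on_minus: "open S \<Longrightarrow> smooth_on S f \<Longrightarrow> smooth_on S (\<lambda>x. - f x)"
  by (rule smooth_on_linear_comp) (auto intro: bounded_linear_minus bounded_linear_ident)

lemma smooth_on_diff: "open S \<Longrightarrow> smooth_on S f \<Longrightarrow> smooth_on S g \<Longrightarrow> smooth_on S (\<lambda>x. f x - g x)"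
  using smooth_on_add[OF _ _ smooth_on_minus] by fastforce

lemma Ck_on_sum: "open S \<Longrightarrow> (\<And>i. i \<in> I \<Longrightarrow> Ck_on k S (f i)) \<Longrightarrow> Ck_on k S (\<lambda>x. \<Sum>i\<in>I. f i x)"
  by (induction I rule: infinite_finite_induct) (auto intro: Ck_on_add)

lemma smooth_on_sum: "open S \<Longrightarrow> (\<And>i. i \<in> I \<Longrightarrow> smooth_on S (f i)) \<Longrightarrow> smooth_on S (\<lambda>x. \<Sum>i\<in>I. f i x)"
  by (simp add: smooth_on_def Ck_on_sum)

text \<open>The product rule expresses the derivative through the same bilinear map with one factor
  differentiated, so the induction runs over all f and g. Scalar multiplication, product and inner
  product are instances.\<close>

lemma Ck_on_bilinear:
  assumes "open S" "bounded_bilinear P" "Ck_on k S f" "Ck_on k S g"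
  shows "Ck_on k S (\<lambda>x. P (f x) (g x))"
  using assms(3,4)
proof (induction k arbitrary: f g)
  case 0
  then show ?case using assms(2) by (auto simp: bounded_bilinear.continuous_on)
next
  case (Suc k)
  show ?case
    by (rule Ck_on_Suc_intro[OF assms(1), of _ "\<lambda>v x. P (f x) (dderiv g v x) + P (dderiv f v x) (g x)"])
      (use Suc in \<open>auto intro!: Ck_on_add[OF assms(1)] Suc.IH bounded_bilinear.FDERIV[OF assms(2)]
          has_derivative_dderiv
          intro: Ck_on_Suc_imp\<close>)
qed

lemma smooth_on_bilinear: "open S \<Longrightarrow> bounded_bilinear P \<Longrightarrow> smooth_on S f \<Longrightarrow> smooth_on S g
    \<Longrightarrow> smooth_on S (\<lambda>x. P (f x) (g x))"
  by (simp add: smooth_on_def Ck_on_bilinear)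

lemma smooth_on_scaleR: "open S \<Longrightarrow> smooth_on S f \<Longrightarrow> smooth_on S g \<Longrightarrow> smooth_on S (\<lambda>x. f x *\<^sub>R g x)"
  by (rule smooth_on_bilinear[OF _ bounded_bilinear_scaleR])

lemma smooth_on_mult: "open S \<Longrightarrow> smooth_on S f \<Longrightarrow> smooth_on S g
    \<Longrightarrow> smooth_on S (\<lambda>x. f x * g x :: 'a::real_normed_algebra)"
  by (rule smooth_on_bilinear[OF _ bounded_bilinear_mult])

lemma smooth_on_inner: "open S \<Longrightarrow> smooth_on S f \<Longrightarrow> smooth_on S g \<Longrightarrow> smooth_on S (\<lambda>x. inner (f x) (g x))"
  by (rule smooth_on_bilinear[OF _ bounded_bilinear_inner])

lemma smooth_on_prod:
  fixes f :: "'i \<Rightarrow> 'a::real_normed_vector \<Rightarrow> 'b::real_normed_field"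
  shows "open S \<Longrightarrow> (\<And>i. i \<in> I \<Longrightarrow> smooth_on S (f i)) \<Longrightarrow> smooth_on S (\<lambda>x. \<Prod>i\<in>I. f i x)"
  by (induction I rule: infinite_finite_induct) (auto intro: smooth_on_mult)

text \<open>By the chain rule the derivative is that of g in the direction
  \<open>dderiv f v x\<close>, which moves with x. Expanding this direction in a basis leaves
  products of scalar functions with \<open>dderiv g b\<close> after f, b fixed, to which the
  induction hypothesis applies; hence the finite-dimensional middle space.\<close>

lemma Ck_on_compose:
  fixes f :: "'a::real_normed_vector \<Rightarrow> 'b::euclidean_space" and g :: "'b \<Rightarrow> 'c::real_normed_vector"
  assumes "open S" "open T" "f ` S \<subseteq> T" "Ck_on k S f" "Ck_on k T g"
  shows "Ck_on k S (\<lambda>x. g (f x))"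
  using assms(4,5)
proof (induction k arbitrary: g)
  case 0
  then show ?case using assms(3) continuous_on_compose2 by (metis Ck_on.simps(1))
next
  case (Suc k)
  have eq: "dderiv g w (f x) = (\<Sum>b\<in>Basis. (w \<bullet> b) *\<^sub>R dderiv g b (f x))" if "x \<in> S" for w x
  proof -
    interpret linear "\<lambda>w. dderiv g w (f x)"
      using Suc.prems(2) that assms(3) by (intro linear_frechet_derivative) auto
    have "dderiv g w (f x) = dderiv g (\<Sum>b\<in>Basis. (w \<bullet> b) *\<^sub>R b) (f x)" by (simp add: euclidean_representation)
    also have "\<dots> = (\<Sum>b\<in>Basis. (w \<bullet> b) *\<^sub>R dderiv g b (f x))" by (simp add: sum scale)
    finally show ?thesis .
  qed
  show ?case
  proof (rule Ck_on_Suc_intro[OF assms(1), of _ "\<lambda>v x. \<Sum>b\<in>Basis. (dderiv f v x \<bullet> b) *\<^sub>R dderiv g b (f x)"])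
    fix x assume x: "x \<in> S"
    have "((\<lambda>x. g (f x)) has_derivative (\<lambda>v. dderiv g (dderiv f v x) (f x))) (at x)"
      by (rule has_derivative_compose[of f "\<lambda>v. dderiv f v x" x UNIV g "\<lambda>v. dderiv g v (f x)"])
        (use x Suc.prems assms(3) in \<open>auto intro!: has_derivative_dderiv\<close>)
    then show "((\<lambda>x. g (f x)) has_derivative (\<lambda>v. \<Sum>b\<in>Basis. (dderiv f v x \<bullet> b) *\<^sub>R dderiv g b (f x))) (at x)"
      by (rule has_derivative_eq_rhs) (rule ext, rule eq[OF x])
  next
    fix v
    have "Ck_on k S (\<lambda>x. dderiv g b (f x))" for b
      using Suc by (intro Suc.IH) (auto intro: Ck_on_Suc_imp)
    moreover have "Ck_on k S (\<lambda>x. dderiv f v x \<bullet> b)" for b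
      using Suc.prems by (intro Ck_on_linear_comp[OF assms(1) bounded_linear_inner_left]) auto
    ultimately show "Ck_on k S (\<lambda>x. \<Sum>b\<in>Basis. (dderiv f v x \<bullet> b) *\<^sub>R dderiv g b (f x))"
      by (intro Ck_on_sum assms(1) Ck_on_bilinear[OF _ bounded_bilinear_scaleR])
  qed
qed

lemma smooth_on_compose:
  fixes f :: "'a::real_normed_vector \<Rightarrow> 'b::euclidean_space" and g :: "'b \<Rightarrow> 'c::real_normed_vector"
  shows "open S \<Longrightarrow> open T \<Longrightarrow> f ` S \<subseteq> T \<Longrightarrow> smooth_on S f \<Longrightarrow> smooth_on T g \<Longrightarrow> smooth_on S (\<lambda>x. g (f x))"
  unfolding smooth_on_def using Ck_on_compose by blast

lemma dderiv_compose:
  assumes "f differentiable (at x)" "g differentiable (at (f x))"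
  shows "dderiv (\<lambda>x. g (f x)) v x = dderiv g (dderiv f v x) (f x)"
  by (rule dderiv_eq, rule has_derivative_compose[of f "\<lambda>v. dderiv f v x" x UNIV g "\<lambda>v. dderiv g v (f x)"])
    (use assms has_derivative_dderiv in auto)

section \<open>Exponential, inverse, logarithm and norm\<close>

lemma smooth_on_real_exp [simp]: "smooth_on S (exp :: real \<Rightarrow> real)"
proof -
  \<comment> \<open>The constant makes the family closed under directional derivatives: direction v
    replaces c by c v.\<close>
  have "Ck_on k UNIV (\<lambda>x::real. c * exp x)" for k c
  proof (induction k arbitrary: c)
    case (Suc k)
    show ?case by (rule Ck_on_Suc_intro[of _ _ "\<lambda>v x. (c * v) * exp x"])
        (use Suc in \<open>auto intro!: derivative_eq_intros\<close>)
  qed (auto intro!: continuous_intros)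
  from this[of _ 1] show ?thesis unfolding smooth_on_def by (auto intro: Ck_on_subset)
qed

lemma smooth_on_real_inverse: "smooth_on (- {0::real}) inverse"
proof -
  have "Ck_on k (- {0::real}) inverse" for k
  proof (induction k)
    case (Suc k)
    have "Ck_on k (- {0::real}) (\<lambda>x. (- v) * (inverse x * inverse x))" for v
      by (intro Ck_on_bilinear[OF _ bounded_bilinear_mult] Suc) auto
    then show ?case by (intro Ck_on_Suc_intro[of _ _ "\<lambda>v x. (- v) * (inverse x * inverse x)"])
        (auto intro!: derivative_eq_intros)
  qed (auto intro!: continuous_intros)
  then show ?thesis unfolding smooth_on_def by auto
qed

lemma smooth_on_real_ln: "smooth_on {0::real<..} ln"
proof -
  have inv: "Ck_on k {0::real<..} inverse" for k
    using smooth_on_subset[OF smooth_on_real_inverse] by (auto simp: smooth_on_def)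
  have "Ck_on k {0::real<..} ln" for k
  proof (cases k)
    case (Suc k)
    have "Ck_on k {0::real<..} (\<lambda>x. v * inverse x)" for v k
      by (intro Ck_on_bilinear[OF _ bounded_bilinear_mult] inv) auto
    then show ?thesis unfolding Suc by (intro Ck_on_Suc_intro[of _ _ "\<lambda>v x. v * inverse x"])
        (auto intro!: derivative_eq_intros simp: field_simps)
  qed (auto intro!: continuous_intros)
  then show ?thesis unfolding smooth_on_def by auto
qed

lemma smooth_on_exp: "open S \<Longrightarrow> smooth_on S f \<Longrightarrow> smooth_on S (\<lambda>x. exp (f x :: real))"
  by (rule smooth_on_compose[of _ UNIV]) auto

lemma smooth_on_inverse: "open S \<Longrightarrow> smooth_on S f \<Longrightarrow> (\<And>x. x \<in> S \<Longrightarrow> f x \<noteq> 0)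
    \<Longrightarrow> smooth_on S (\<lambda>x. inverse (f x :: real))"
  by (rule smooth_on_compose[OF _ _ _ _ smooth_on_real_inverse]) auto

lemma smooth_on_divide: "open S \<Longrightarrow> smooth_on S f \<Longrightarrow> smooth_on S g \<Longrightarrow> (\<And>x. x \<in> S \<Longrightarrow> g x \<noteq> 0)
    \<Longrightarrow> smooth_on S (\<lambda>x. f x / g x :: real)"
  unfolding divide_inverse by (intro smooth_on_mult smooth_on_inverse)

lemma smooth_on_ln: "open S \<Longrightarrow> smooth_on S f \<Longrightarrow> (\<And>x. x \<in> S \<Longrightarrow> f x > 0) \<Longrightarrow> smooth_on S (\<lambda>x. ln (f x :: real))"
  by (rule smooth_on_compose[OF _ _ _ _ smooth_on_real_ln]) auto

text \<open>Away from 0 the norm is exp(ln(f . f)/2), so smoothness is inherited from exponential,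
  logarithm and inner product.\<close>

lemma smooth_on_norm:
  fixes f :: "'a::real_normed_vector \<Rightarrow> 'b::euclidean_space"
  assumes "open S" "smooth_on S f" "\<And>x. x \<in> S \<Longrightarrow> f x \<noteq> 0"
  shows "smooth_on S (\<lambda>x. norm (f x))"
proof (rule smooth_on_cong[OF assms(1)])
  show "smooth_on S (\<lambda>x. exp (ln (f x \<bullet> f x) / 2))"
    using assms by (intro smooth_on_exp smooth_on_divide smooth_on_ln smooth_on_inner) auto
  fix x assume "x \<in> S"
  then have "norm (f x) > 0" using assms by simp
  then show "exp (ln (f x \<bullet> f x) / 2) = norm (f x)"
    by (simp add: dot_square_norm ln_realpow)
qed

section \<open>Vector- and matrix-valued smooth maps\<close>

lemma smooth_on_vec_nth: "open S \<Longrightarrow> smooth_on S f \<Longrightarrow> smooth_on S (\<lambda>x. f x $ i)"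
  by (rule smooth_on_linear_comp[OF _ bounded_linear_vec_nth])

lemma smooth_on_vec:
  fixes f :: "'a::real_normed_vector \<Rightarrow> ('b::real_normed_vector) ^ 'n::finite"
  assumes "open S" "\<And>i. smooth_on S (\<lambda>x. f x $ i)"
  shows "smooth_on S f"
proof -
  have bl: "bounded_linear (axis i :: 'b \<Rightarrow> 'b ^ 'n)" for i
  proof (intro bounded_linear_intro[where K=1])
    fix x y r show "axis i (x + y) = axis i x + (axis i y :: 'b^'n)" "axis i (r *\<^sub>R x)
        = r *\<^sub>R (axis i x :: 'b ^ 'n)"
      by (auto simp: vec_eq_iff axis_def)
    show "norm (axis i x :: 'b ^ 'n) \<le> norm x * 1" 
      by (simp add: norm_vec_def L2_set_def axis_def if_distrib[of norm] if_distrib[of "\<lambda>x. x^2"] cong: if_cong)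
  qed
  have "f = (\<lambda>x. \<Sum>i\<in>UNIV. axis i (f x $ i))"
    by (auto simp: fun_eq_iff vec_eq_iff axis_def)
  moreover have "smooth_on S (\<lambda>x. \<Sum>i\<in>UNIV. axis i (f x $ i))"
    by (intro smooth_on_sum assms smooth_on_linear_comp[OF _ bl])
  ultimately show ?thesis by simp
qed

lemma smooth_on_vec_lambda:
  assumes "open S" "\<And>i. smooth_on S (f i)"
  shows "smooth_on S (\<lambda>x. \<chi> i. f i x)"
  using assms by (intro smooth_on_vec) auto

lemma smooth_on_matrix_mult:
  fixes A :: "'a::real_normed_vector \<Rightarrow> real ^ 'n::finite ^ 'm::finite" and B :: "'a \<Rightarrow> real ^ 'p::finite ^ 'n"
  assumes "open S" "smooth_on S A" "smooth_on S B"
  shows "smooth_on S (\<lambda>x. A x ** B x)"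
  unfolding matrix_matrix_mult_def
  by (intro smooth_on_vec_lambda smooth_on_sum smooth_on_mult smooth_on_vec_nth assms)

lemma smooth_on_transpose:
  fixes A :: "'a::real_normed_vector \<Rightarrow> real ^ 'n::finite ^ 'm::finite"
  assumes "open S" "smooth_on S A"
  shows "smooth_on S (\<lambda>x. transpose (A x))"
  unfolding transpose_def
  by (intro smooth_on_vec_lambda smooth_on_vec_nth assms)

lemma smooth_on_matrix_vector_mult:
  fixes A :: "'a::real_normed_vector \<Rightarrow> real ^ 'n::finite ^ 'm::finite"
  assumes "open S" "smooth_on S A" "smooth_on S f"
  shows "smooth_on S (\<lambda>x. A x *v f x)"
  unfolding matrix_vector_mult_def
  by (intro smooth_on_vec_lambda smooth_on_sum smooth_on_mult smooth_on_vec_nth assms)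

lemma smooth_on_det:
  fixes A :: "'a::real_normed_vector \<Rightarrow> real ^ 'n::finite ^ 'n"
  assumes "open S" "smooth_on S A"
  shows "smooth_on S (\<lambda>x. det (A x))"
  unfolding det_def
  by (intro smooth_on_sum smooth_on_mult smooth_on_prod smooth_on_vec_nth assms smooth_on_const)

lemma matrix_inv_invertible:
  fixes A :: "real ^ 'n::finite ^ 'n"
  assumes "invertible A"
  shows "A ** matrix_inv A = mat 1" "matrix_inv A ** A = mat 1"
  using someI_ex[OF assms[unfolded invertible_def]] unfolding matrix_inv_def by auto

text \<open>Cramer's rule applied to the columns of the inverse: its entries become quotients of
  determinants, hence smooth in the entries of A.\<close>

lemma matrix_inv_cramer:
  fixes A :: "real ^ 'n::finite ^ 'n"
  assumes "det A \<noteq> 0"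
  shows "matrix_inv A = (\<chi> k j. det (\<chi> a b. if b = k then axis j 1 $ a else A $ a $ b) / det A)"
proof -
  have inv: "invertible A" using assms invertible_det_nz by blast
  have "matrix_inv A *v axis j 1 = (\<chi> k. det (\<chi> a b. if b = k then axis j 1 $ a else A $ a $ b) / det A)" for j
    using cramer[OF assms, of "matrix_inv A *v axis j 1" "axis j 1"] 
    by (simp add: matrix_vector_mul_assoc matrix_inv_invertible(1)[OF inv])
  then show ?thesis
    by (simp add: matrix_vector_mult_basis column_def vec_eq_iff)
qed

lemma smooth_on_matrix_inv:
  fixes A :: "'a::real_normed_vector \<Rightarrow> real ^ 'n::finite ^ 'n"
  assumes "open S" "smooth_on S A" "\<And>x. x \<in> S \<Longrightarrow> invertible (A x)"
  shows "smooth_on S (\<lambda>x. matrix_inv (A x))"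
proof (rule smooth_on_cong[OF assms(1)])
  have nz: "det (A x) \<noteq> 0" if "x \<in> S" for x using assms(3)[OF that] invertible_det_nz by blast
  have "smooth_on S (\<lambda>x. (if b = k then axis j 1 $ a else A x $ a $ b))" for a b j k
    by (cases "b = k") (auto intro!: smooth_on_vec_nth assms)
  then show "smooth_on S (\<lambda>x. (\<chi> k j. det (\<chi> a b. if b = k then axis j 1 $ a else A x $ a $ b) / det (A x)))"
    using nz by (intro smooth_on_vec_lambda smooth_on_divide smooth_on_det assms) auto
  show "(\<chi> k j. det (\<chi> a b. if b = k then axis j 1 $ a else A x $ a $ b) / det (A x))
      = matrix_inv (A x)" if "x \<in> S" for x
    using matrix_inv_cramer[OF nz[OF that]] by simp
qed

section \<open>Jacobian matrices and inverse maps\<close>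

definition jac :: "(real ^ 'n::finite \<Rightarrow> real ^ 'm::finite) \<Rightarrow> real ^ 'n \<Rightarrow> real ^ 'n ^ 'm" where
  "jac f x = matrix (frechet_derivative f (at x))"

lemma jac_works: "f differentiable (at x) \<Longrightarrow> jac f x *v v = dderiv f v x"
  unfolding jac_def by (metis matrix_vector_mul(2) linear_frechet_derivative)

lemma jac_nth: "jac f x $ i $ j = dderiv f (axis j 1) x $ i"
  unfolding jac_def matrix_def by simp

lemma smooth_on_jac:
  assumes "open S" "smooth_on S f"
  shows "smooth_on S (jac f)"
proof (rule smooth_on_vec[OF assms(1)], rule smooth_on_vec[OF assms(1)])
  show "smooth_on S (\<lambda>x. jac f x $ i $ j)" for i j unfolding jac_nth
    by (intro smooth_on_vec_nth smooth_on_dderiv assms)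
qed

lemma jac_cong:
  assumes "open S" "x \<in> S" "\<And>y. y \<in> S \<Longrightarrow> f y = g y"
  shows "jac f x = jac g x"
  unfolding vec_eq_iff jac_nth using dderiv_cong[OF assms] by simp

lemma jac_compose:
  assumes "f differentiable (at x)" "g differentiable (at (f x))"
  shows "jac (\<lambda>x. g (f x)) x = jac g (f x) ** jac f x"
proof -
  have "jac (\<lambda>x. g (f x)) x *v v = (jac g (f x) ** jac f x) *v v" for v
  proof -
    have "(\<lambda>x. g (f x)) differentiable (at x)" 
      using assms differentiable_chain_at[of f x g] by (simp add: o_def)
    then show ?thesis
      by (simp add: jac_works assms dderiv_compose flip: matrix_vector_mul_assoc)
  qed
  then show ?thesis using matrix_eq by blast
qed

lemma jac_eq: "(f has_derivative f') (at x) \<Longrightarrow> jac f x = matrix f'"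
  unfolding jac_def by (metis frechet_derivative_at)

text \<open>Injectivity is assumed on all of S, so openness of the image comes from invariance of
  domain. The derivative of the inverse g at y is \<open>matrix_inv (jac f (g y))\<close>; if g is
  C^k then so is this expression, and g is C^(k+1).\<close>

lemma smooth_on_inv_into:
  fixes f :: "real ^ 'n::finite \<Rightarrow> real ^ 'n"
  assumes S: "open S" and f: "smooth_on S f" and inj: "inj_on f S"
    and inv: "\<And>x. x \<in> S \<Longrightarrow> invertible (jac f x)"
  shows "open (f ` S)" and "smooth_on (f ` S) (inv_into S f)"
    and "\<And>x. x \<in> S \<Longrightarrow> jac (inv_into S f) (f x) = matrix_inv (jac f x)"
proof -
  let ?g = "inv_into S f"
  have cont: "continuous_on S f" using f by (rule smooth_on_continuous)
  show o: "open (f ` S)" using invariance_of_domain[OF cont S inj] .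
  have gS: "?g y \<in> S" "f (?g y) = y" if "y \<in> f ` S" for y
    using that by (auto simp: inv_into_into f_inv_into_f)
  have der: "(?g has_derivative (\<lambda>v. matrix_inv (jac f x) *v v)) (at (f x))" if x: "x \<in> S" for x
  proof (rule has_derivative_inverse_strong[OF S x cont])
    show "\<And>x. x \<in> S \<Longrightarrow> ?g (f x) = x" using inj by simp
    show "(f has_derivative (\<lambda>v. dderiv f v x)) (at x)" by (rule smooth_on_has_derivative[OF f x])
    have "(jac f x ** matrix_inv (jac f x)) *v v = v" for v
      using matrix_inv_invertible(1)[OF inv[OF x]] by simp
    then show "(\<lambda>v. dderiv f v x) \<circ> (*v) (matrix_inv (jac f x)) = id"
      by (auto simp: fun_eq_iff jac_works[OF smooth_on_differentiable[OF f x], symmetric]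
          matrix_vector_mul_assoc)
  qed
  show "jac ?g (f x) = matrix_inv (jac f x)" if "x \<in> S" for x
    using jac_eq[OF der[OF that]] by simp
  have sinv: "smooth_on S (\<lambda>x. matrix_inv (jac f x))"
    by (intro smooth_on_matrix_inv smooth_on_jac S f inv)
  have "Ck_on k (f ` S) ?g" for k
  proof (induction k)
    case 0
    have "isCont ?g y" if "y \<in> f ` S" for y
      using der[THEN has_derivative_continuous] that by blast
    then show ?case by (simp add: continuous_at_imp_continuous_on)
  next
    case (Suc k)
    show ?case
    proof (rule Ck_on_Suc_intro[OF o, of _ "\<lambda>v y. matrix_inv (jac f (?g y)) *v v"])
      fix y assume "y \<in> f ` S"
      then show "(?g has_derivative (\<lambda>v. matrix_inv (jac f (?g y)) *v v)) (at y)"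
        using der[OF gS(1)] gS(2) by metis
    next
      fix v
      have "smooth_on S (\<lambda>x. matrix_inv (jac f x) *v v)"
        by (intro smooth_on_matrix_vector_mult S sinv smooth_on_const)
      then show "Ck_on k (f ` S) (\<lambda>y. matrix_inv (jac f (?g y)) *v v)"
        by (intro Ck_on_compose[OF o S _ Suc]) (auto simp: gS smooth_on_def)
    qed
  qed
  then show "smooth_on (f ` S) ?g" by (simp add: smooth_on_def)
qed

text \<open>The second difference over the parallelogram spanned by h u and h v is symmetric in u
  and v. Two applications of the mean value theorem turn it into a mixed derivative at an
  intermediate point, in either order of differentiation.\<close>

lemma mixed_difference_mvt:
  fixes f :: "'a::real_normed_vector \<Rightarrow> real"
  assumes f: "\<And>s t. s \<in> {0..h} \<Longrightarrow> t \<in> {0..h} \<Longrightarrow> x + s *\<^sub>R u + t *\<^sub>R v \<in> S" and S: "open S"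
    and C: "Ck_on (Suc (Suc 0)) S f" and h: "0 < h"
  shows "\<exists>s t. s \<in> {0..h} \<and> t \<in> {0..h} \<and>
    f (x + h *\<^sub>R u + h *\<^sub>R v) - f (x + h *\<^sub>R u) - f (x + h *\<^sub>R v) + f x
      = h * h * dderiv (dderiv f u) v (x + s *\<^sub>R u + t *\<^sub>R v)"
proof -
  have d1: "(f has_derivative (\<lambda>w. dderiv f w y)) (at y)" if "y \<in> S" for y
    using C that has_derivative_dderiv by auto
  have d2: "(dderiv f u has_derivative (\<lambda>w. dderiv (dderiv f u) w y)) (at y)" if "y \<in> S" for y
    by (rule has_derivative_dderiv) (use C that in auto)
  have line: "((\<lambda>r. F (a + r *\<^sub>R w)) has_real_derivative F' w) (at r)"
    if "(F has_derivative F') (at (a + r *\<^sub>R w))" for F :: "'a \<Rightarrow> real" and F' a w r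
  proof -
    have "((\<lambda>r. a + r *\<^sub>R w) has_derivative (\<lambda>e. e *\<^sub>R w)) (at r)"
      by (auto intro!: derivative_eq_intros)
    from has_derivative_compose[OF this that]
    have "((\<lambda>r. F (a + r *\<^sub>R w)) has_derivative (\<lambda>e. F' (e *\<^sub>R w))) (at r)" .
    moreover have "linear F'" using that has_derivative_linear by blast
    ultimately show ?thesis 
      unfolding has_field_derivative_def by (simp add: linear_cmul mult.commute[of _ "F' w"])
  qed
  \<comment> \<open>The increment in direction v as a function of the step in direction u; the mixed
    difference is \<open>g h - g 0\<close>.\<close>
  define g where "g = (\<lambda>s. f (x + h *\<^sub>R v + s *\<^sub>R u) - f (x + s *\<^sub>R u))"
  have "\<exists>s. 0 < s \<and> s < h \<and> g h - g 0 = (h - 0) * (dderiv f u (x + h *\<^sub>R v + s *\<^sub>R u) - dderiv f u (x +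
      s *\<^sub>R u))"
    unfolding g_def
    using f[of _ h] f[of _ 0] h
    by (intro MVT2 DERIV_diff line[OF d1]) (auto simp: algebra_simps)
  then obtain s where s: "0 < s" "s < h" "g h - g 0 = h * (dderiv f u (x + h *\<^sub>R v + s *\<^sub>R u) - dderiv f
      u (x + s *\<^sub>R u))" by auto
  have "\<exists>t. 0 < t \<and> t < h \<and> dderiv f u ((x + s *\<^sub>R u) + h *\<^sub>R v) - dderiv f u ((x + s *\<^sub>R u) + 0 *\<^sub>R v)
     = (h - 0) * dderiv (dderiv f u) v ((x + s *\<^sub>R u) + t *\<^sub>R v)"
    using f[of s] s(1,2) h by (intro MVT2 line[OF d2]) auto
  then obtain t where t: "0 < t" "t < h" "dderiv f u ((x + s *\<^sub>R u) + h *\<^sub>R v) - dderiv f u (x + s *\<^sub>R u)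
     = h * dderiv (dderiv f u) v ((x + s *\<^sub>R u) + t *\<^sub>R v)" by auto
  have "f (x + h *\<^sub>R u + h *\<^sub>R v) - f (x + h *\<^sub>R u) - f (x + h *\<^sub>R v) + f x = g h - g 0"
    unfolding g_def by (simp add: algebra_simps)
  also have "\<dots> = h * (h * dderiv (dderiv f u) v ((x + s *\<^sub>R u) + t *\<^sub>R v))"
    using s(3) t(3) by (simp add: add.assoc add.commute add.left_commute)
  finally show ?thesis using s t by (intro exI[of _ s] exI[of _ t]) auto
qed

text \<open>Both mixed derivatives, taken at points close to x, equal the same second difference
  divided by h^2; continuity at x closes the gap.\<close>

lemma dderiv_commute_real:
  fixes f :: "'a::real_normed_vector \<Rightarrow> real"
  assumes S: "open S" and C: "Ck_on (Suc (Suc 0)) S f" and x: "x \<in> S"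
  shows "dderiv (dderiv f u) v x = dderiv (dderiv f v) u x"
proof (rule ccontr)
  define F where "F = dderiv (dderiv f u) v"
  define G where "G = dderiv (dderiv f v) u"
  assume "\<not> ?thesis"
  then have ne: "F x \<noteq> G x" by (simp add: F_def G_def)
  define e where "e = \<bar>F x - G x\<bar> / 2"
  have e: "e > 0" using ne by (simp add: e_def)
  have "continuous_on S F" "continuous_on S G" using C by (auto simp: F_def G_def)
  then have "isCont F x" "isCont G x" using S x continuous_on_eq_continuous_at by auto
  then obtain d1 d2 where d: "d1 > 0" "\<And>y. dist y x < d1 \<Longrightarrow> dist (F y) (F x) < e"
     "d2 > 0" "\<And>y. dist y x < d2 \<Longrightarrow> dist (G y) (G x) < e"
    using e unfolding continuous_at_eps_delta by metis
  obtain d3 where d3: "d3 > 0" "ball x d3 \<subseteq> S" using S x open_contains_ball by metis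
  define d where "d = min d1 (min d2 d3)"
  \<comment> \<open>The parallelogram with sides h u and h v then lies within d/2 of x; the summand
    1 keeps the denominator positive when u = v = 0.\<close>
  define h where "h = d / (2 * (norm u + norm v + 1))"
  have dp: "d > 0" using d d3 by (simp add: d_def)
  have np: "norm u + norm v + 1 > 0" by (smt (verit) norm_ge_zero)
  have h: "h > 0" using dp np by (simp add: h_def)
  have near: "dist (x + s *\<^sub>R a + t *\<^sub>R b) x < d" if "s \<in> {0..h}" "t \<in> {0..h}" "{a, b} = {u, v}" for s t a b
  proof -
    have "norm (s *\<^sub>R a + t *\<^sub>R b) \<le> s * norm a + t * norm b"
      using norm_triangle_ineq[of "s *\<^sub>R a" "t *\<^sub>R b"] that by simp
    also have "\<dots> \<le> h * norm a + h * norm b"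
      using that by (intro add_mono mult_right_mono) auto
    also have "\<dots> \<le> h * (norm u + norm v + 1)"
      using that(3) h by (auto simp: doubleton_eq_iff algebra_simps)
    also have "\<dots> = d / 2" using np unfolding h_def by (simp add: divide_simps)
    also have "\<dots> < d" using dp by simp
    finally show ?thesis by (simp add: dist_norm add.assoc)
  qed
  have inS: "x + s *\<^sub>R a + t *\<^sub>R b \<in> S" if "s \<in> {0..h}" "t \<in> {0..h}" "{a, b} = {u, v}" for s t a b
    using near[OF that] d3(2) by (auto simp: d_def dist_commute)
  obtain s t where st: "s \<in> {0..h}" "t \<in> {0..h}"
    "f (x + h *\<^sub>R u + h *\<^sub>R v) - f (x + h *\<^sub>R u) - f (x + h *\<^sub>R v) + f x = h * h * F (x + s *\<^sub>R u + t *\<^sub>R v)"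
    using mixed_difference_mvt[OF _ S C h, of x u v] inS unfolding F_def by blast
  obtain s' t' where st': "s' \<in> {0..h}" "t' \<in> {0..h}"
    "f (x + h *\<^sub>R v + h *\<^sub>R u) - f (x + h *\<^sub>R v) - f (x + h *\<^sub>R u) + f x = h * h * G (x + s' *\<^sub>R v + t' *\<^sub>R u)"
    using mixed_difference_mvt[OF _ S C h, of x v u] inS[of _ _ v u] unfolding G_def
        by (auto simp: insert_commute)
  have "h * h * F (x + s *\<^sub>R u + t *\<^sub>R v) = h * h * G (x + s' *\<^sub>R v + t' *\<^sub>R u)"
    using st(3) st'(3) by (simp add: algebra_simps)
  then have "F (x + s *\<^sub>R u + t *\<^sub>R v) = G (x + s' *\<^sub>R v + t' *\<^sub>R u)" using h by simp
  moreover have "dist (F (x + s *\<^sub>R u + t *\<^sub>R v)) (F x) < e"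
    using near[OF st(1,2), of u v] by (intro d) (auto simp: d_def)
  moreover have "dist (G (x + s' *\<^sub>R v + t' *\<^sub>R u)) (G x) < e"
    using near[OF st'(1,2), of v u] by (intro d) (auto simp: d_def)
  ultimately show False unfolding e_def dist_real_def by (simp add: abs_if split: if_splits)
qed

lemma dderiv_linear_comp:
  assumes "bounded_linear A" "f differentiable (at x)"
  shows "dderiv (\<lambda>x. A (f x)) v x = A (dderiv f v x)"
  by (rule dderiv_eq, rule bounded_linear.has_derivative[OF assms(1) has_derivative_dderiv[OF assms(2)]])

lemma dderiv_commute:
  fixes f :: "'a::real_normed_vector \<Rightarrow> 'b::euclidean_space"
  assumes S: "open S" and C: "smooth_on S f" and x: "x \<in> S"
  shows "dderiv (dderiv f u) v x = dderiv (dderiv f v) u x"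
proof (rule euclidean_eqI)
  fix b :: 'b assume "b \<in> Basis"
  have bl: "bounded_linear (\<lambda>y. y \<bullet> b)" by (rule bounded_linear_inner_left)
  have *: "dderiv (\<lambda>x. dderiv f u x \<bullet> b) v x = dderiv (dderiv (\<lambda>x. f x \<bullet> b) u) v x" for u v
    using dderiv_linear_comp[OF bl smooth_on_differentiable[OF C]]
    by (intro dderiv_cong[OF S x]) metis
  have "dderiv (dderiv f u) v x \<bullet> b = dderiv (dderiv (\<lambda>x. f x \<bullet> b) u) v x" for u v
    using dderiv_linear_comp[OF bl smooth_on_differentiable[OF smooth_on_dderiv[OF C] x]] * by metis
  then show "dderiv (dderiv f u) v x \<bullet> b = dderiv (dderiv f v) u x \<bullet> b"
    using dderiv_commute_real[OF S _ x, of "\<lambda>x. f x \<bullet> b"] smooth_on_linear_comp[OF S bl C]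
    unfolding smooth_on_def by metis
qed

lemma dderiv_add_dir: "f differentiable (at x) \<Longrightarrow> dderiv f (u + v) x = dderiv f u x + dderiv f v x"
  using linear_frechet_derivative linear_add by blast

lemma dderiv_scale_dir: "f differentiable (at x) \<Longrightarrow> dderiv f (r *\<^sub>R u) x = r *\<^sub>R dderiv f u x"
  using linear_frechet_derivative linear_cmul by blast

lemma matrix_eqI_dot:
  fixes A B :: "real ^ 'n::finite ^ 'm::finite"
  assumes "\<And>u v. u \<bullet> (A *v v) = u \<bullet> (B *v v)"
  shows "A = B"
proof -
  have "A *v v = B *v v" for v using assms vector_eq_ldot[of "A *v v" "B *v v"] by auto
  then show ?thesis using matrix_eq by blast
qed

lemma invertible_mult_cancel:
  fixes A :: "real ^ 'n::finite ^ 'n"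
  assumes "invertible A" "A *v x = A *v y" shows "x = y"
  by (metis assms matrix_inv_invertible(2) matrix_vector_mul_assoc matrix_vector_mul_lid)

section \<open>Tensoriality of the curvature\<close>

text \<open>Christoffel symbols of the first kind, with the two differentiated indices contracted
  with u and v. Vectors in place of indices turn a change of coordinates into a chain rule.\<close>

definition christoffel_low :: "(real ^ 'n::finite \<Rightarrow> real ^ 'n ^ 'n) \<Rightarrow> real ^ 'n \<Rightarrow> real ^ 'n \<Rightarrow> real ^ 'n
    \<Rightarrow> real ^ 'n" where
  "christoffel_low G x u v = (\<chi> m. (1/2) * (v \<bullet> (dderiv G u x *v axis m 1) + u \<bullet> (dderiv G v x *v axis m 1)
      - u \<bullet> (dderiv G (axis m 1) x *v v)))"

definition Gam :: "(real ^ 'n::finite \<Rightarrow> real ^ 'n ^ 'n) \<Rightarrow> real ^ 'n \<Rightarrow> real ^ 'n \<Rightarrow> real ^ 'n \<Rightarrow> real ^ 'n" where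
  "Gam G x u v = matrix_inv (G x) *v christoffel_low G x u v"

text \<open>The curvature operator R(u,v)w for u, v, w extended as constant vector fields, whose
  brackets vanish.\<close>

definition Riem :: "(real ^ 'n::finite \<Rightarrow> real ^ 'n ^ 'n) \<Rightarrow> real ^ 'n \<Rightarrow> real ^ 'n \<Rightarrow> real ^ 'n \<Rightarrow> real ^ 'n
    \<Rightarrow> real ^ 'n" where
  "Riem G x u v w = dderiv (\<lambda>y. Gam G y v w) u x - dderiv (\<lambda>y. Gam G y u w) v x
     + Gam G x u (Gam G x v w) - Gam G x v (Gam G x u w)"

lemma bounded_linear_mult_vec: "bounded_linear (\<lambda>A :: real ^ 'n::finite ^ 'm::finite. A *v v)"
  unfolding linear_conv_bounded_linear[symmetric] by (rule linearI)
    (simp_all add: matrix_vector_mult_add_rdistrib scaleR_matrix_vector_assoc)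

text \<open>The definition tests only with the standard basis vectors; linearity in w extends this
  to all vectors.\<close>

lemma christoffel_low_dot:
  assumes "G differentiable (at x)"
  shows "christoffel_low G x u v \<bullet> w = (1/2) * (v \<bullet> (dderiv G u x *v w) + u \<bullet> (dderiv G v x *v w)
      - u \<bullet> (dderiv G w x *v v))"
proof -
  define L where "L = (\<lambda>w. (1/2) * (v \<bullet> (dderiv G u x *v w) + u \<bullet> (dderiv G v x *v w)
      - u \<bullet> (dderiv G w x *v v)))"
  have "linear L" unfolding L_def
    by (rule linearI)
      (simp_all add: matrix_vector_right_distrib dderiv_add_dir[OF assms] dderiv_scale_dir[OF assms]
        matrix_vector_mult_add_rdistrib inner_add_right field_simps scaleR_matrix_vector_assoc[symmetric]
        matrix_vector_mult_scaleR)
  have "L w = L (\<Sum>m\<in>UNIV. (w $ m) *\<^sub>R axis m 1)"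
    using basis_expansion[of w] by (simp add: scalar_mult_eq_scaleR)
  also have "\<dots> = (\<Sum>m\<in>UNIV. w $ m * L (axis m 1))"
    using \<open>linear L\<close> by (simp add: linear_sum linear_cmul)
  also have "\<dots> = christoffel_low G x u v \<bullet> w"
    unfolding inner_vec_def christoffel_low_def L_def by (simp add: mult.commute)
  finally show ?thesis unfolding L_def by simp
qed

lemma Gam_add_left: "G differentiable (at x) \<Longrightarrow> Gam G x (u + u') v = Gam G x u v + Gam G x u' v"
  and Gam_add_right: "G differentiable (at x) \<Longrightarrow> Gam G x v (u + u') = Gam G x v u + Gam G x v u'"
  and Gam_scale_left: "G differentiable (at x) \<Longrightarrow> Gam G x (r *\<^sub>R u) v = r *\<^sub>R Gam G x u v"
  and Gam_scale_right: "G differentiable (at x) \<Longrightarrow> Gam G x v (r *\<^sub>R u) = r *\<^sub>R Gam G x v u"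
proof -
  assume G: "G differentiable (at x)"
  note s = dderiv_add_dir[OF G] dderiv_scale_dir[OF G] inner_add_left inner_add_right
    matrix_vector_right_distrib matrix_vector_mult_add_rdistrib field_simps
        scaleR_matrix_vector_assoc[symmetric]
        matrix_vector_mult_scaleR
  have "christoffel_low G x (u + u') v = christoffel_low G x u v + christoffel_low G x u' v"
    "christoffel_low G x v (u + u') = christoffel_low G x v u + christoffel_low G x v u'"
    "christoffel_low G x (r *\<^sub>R u) v = r *\<^sub>R christoffel_low G x u v"
    "christoffel_low G x v (r *\<^sub>R u) = r *\<^sub>R christoffel_low G x v u"
    by (simp_all add: christoffel_low_def vec_eq_iff s)
  then show "Gam G x (u + u') v = Gam G x u v + Gam G x u' v" 
    "Gam G x v (u + u') = Gam G x v u + Gam G x v u'"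
    "Gam G x (r *\<^sub>R u) v = r *\<^sub>R Gam G x u v"
    "Gam G x v (r *\<^sub>R u) = r *\<^sub>R Gam G x v u"
    unfolding Gam_def by (simp_all add: matrix_vector_right_distrib matrix_vector_mult_scaleR)
qed

lemma smooth_on_Gam:
  assumes "open V" "smooth_on V G" "\<And>x. x \<in> V \<Longrightarrow> invertible (G x)"
  shows "smooth_on V (\<lambda>x. Gam G x u v)"
  unfolding Gam_def christoffel_low_def
  by (intro smooth_on_matrix_vector_mult smooth_on_matrix_inv smooth_on_vec_lambda smooth_on_mult
      smooth_on_add smooth_on_diff smooth_on_inner smooth_on_dderiv smooth_on_const assms)

text \<open>The pull-back of a bilinear form along f. With f a transition map this is the
  transformation law in \<open>smooth_tensor2\<close>.\<close>

definition pull :: "(real ^ 'n::finite \<Rightarrow> real ^ 'n) \<Rightarrow> (real ^ 'n \<Rightarrow> real ^ 'n ^ 'n) \<Rightarrow> real ^ 'n \<Rightarrow> real ^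
    'n ^ 'n" where
  "pull f G x = transpose (jac f x) ** G (f x) ** jac f x"

lemma dot_transpose_mult: "u \<bullet> ((transpose J ** A ** J) *v v) = (J *v u) \<bullet> (A *v (J *v v))"
  for J A :: "real ^ 'n::finite ^ 'n"
  by (metis dot_lmul_matrix matrix_vector_mul_assoc transpose_matrix_vector transpose_transpose)

lemma pull_dot:
  "f differentiable (at x) \<Longrightarrow> u \<bullet> (pull f G x *v v) = dderiv f u x \<bullet> (G (f x) *v dderiv f v x)"
  by (simp add: pull_def dot_transpose_mult jac_works)

lemma invertible_pull: "invertible (jac f x) \<Longrightarrow> invertible (G (f x)) \<Longrightarrow> invertible (pull f G x)"
  unfolding pull_def by (intro invertible_mult transpose_invertible)

lemma smooth_on_pull:
  assumes "open U" "open V" "f ` U \<subseteq> V" "smooth_on U f" "smooth_on V G"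
  shows "smooth_on U (pull f G)"
  unfolding pull_def
  by (intro smooth_on_matrix_mult smooth_on_transpose smooth_on_jac smooth_on_compose[OF _ _ _ _
      assms(5)] assms)

lemma transpose_pull: "transpose (G (f x)) = G (f x) \<Longrightarrow> transpose (pull f G x) = pull f G x"
  for G :: "real ^ 'n::finite \<Rightarrow> real ^ 'n ^ 'n"
  by (simp add: pull_def matrix_transpose_mul matrix_mul_assoc)

locale change_coords =
  fixes U V :: "(real ^ 'n::finite) set" and f :: "real ^ 'n \<Rightarrow> real ^ 'n" and G :: "real ^ 'n \<Rightarrow> real ^ 'n ^ 'n"
  assumes U: "open U" and V: "open V" and f: "smooth_on U f" and fUV: "f ` U \<subseteq> V"
    and inv_jac: "\<And>x. x \<in> U \<Longrightarrow> invertible (jac f x)"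
    and G: "smooth_on V G" and inv_G: "\<And>y. y \<in> V \<Longrightarrow> invertible (G y)"
    and sym_G: "\<And>y. y \<in> V \<Longrightarrow> transpose (G y) = G y"
begin

lemma diff_f: "x \<in> U \<Longrightarrow> f differentiable (at x)"
  using smooth_on_differentiable[OF f] .

lemma diff_df: "x \<in> U \<Longrightarrow> dderiv f u differentiable (at x)"
  using smooth_on_differentiable[OF smooth_on_dderiv[OF f]] .

lemma diff_G: "y \<in> V \<Longrightarrow> G differentiable (at y)"
  using smooth_on_differentiable[OF G] .

lemma pull_smooth: "smooth_on U (pull f G)"
  by (rule smooth_on_pull[OF U V fUV f G])

lemma pull_invertible: "x \<in> U \<Longrightarrow> invertible (pull f G x)"
  using fUV by (intro invertible_pull inv_jac inv_G) auto

lemma G_dot_commute: "y \<in> V \<Longrightarrow> a \<bullet> (G y *v b) = b \<bullet> (G y *v a)"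
  by (metis sym_G dot_lmul_matrix inner_commute transpose_matrix_vector)

lemma dderiv_pull_dot:
  assumes x: "x \<in> U"
  shows "a \<bullet> (dderiv (pull f G) c x *v b) =
    dderiv (dderiv f a) c x \<bullet> (G (f x) *v dderiv f b x)
    + dderiv f a x \<bullet> (dderiv G (dderiv f c x) (f x) *v dderiv f b x)
    + dderiv f a x \<bullet> (G (f x) *v dderiv (dderiv f b) c x)"
proof -
  have bl: "bounded_linear (\<lambda>A :: real ^ 'n ^ 'n. a \<bullet> (A *v b))"
    using bounded_linear_compose[OF bounded_linear_inner_right bounded_linear_mult_vec] .
  have fx: "f x \<in> V" using fUV x by auto
  have "a \<bullet> (dderiv (pull f G) c x *v b) = dderiv (\<lambda>y. a \<bullet> (pull f G y *v b)) c x"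
    using dderiv_linear_comp[OF bl smooth_on_differentiable[OF pull_smooth x]] by simp
  also have "\<dots> = dderiv (\<lambda>y. dderiv f a y \<bullet> (G (f y) *v dderiv f b y)) c x"
    by (rule dderiv_cong[OF U x]) (simp add: pull_dot diff_f)
  also have "\<dots> = dderiv f a x \<bullet> (G (f x) *v dderiv (dderiv f b) c x + dderiv G (dderiv f c x) (f x) *v
      dderiv f b x)
     + dderiv (dderiv f a) c x \<bullet> (G (f x) *v dderiv f b x)"
  proof (rule dderiv_eq)
    have bb: "bounded_bilinear (\<lambda>(A :: real ^ 'n ^ 'n) v. A *v v)"
      unfolding bilinear_conv_bounded_bilinear[symmetric] bilinear_def
      by (auto intro!: linearI simp: matrix_vector_right_distrib matrix_vector_mult_add_rdistrib
          scaleR_matrix_vector_assoc[symmetric] matrix_vector_mult_scaleR)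
    have "((\<lambda>y. G (f y)) has_derivative (\<lambda>c. dderiv G (dderiv f c x) (f x))) (at x)"
      by (rule has_derivative_compose[of f "\<lambda>v. dderiv f v x" x UNIV G "\<lambda>v. dderiv G v (f x)"])
       (use diff_f[OF x] diff_G[OF fx] has_derivative_dderiv in auto)
    from bounded_bilinear.FDERIV[OF bb this has_derivative_dderiv[OF diff_df[OF x]]]
    have "((\<lambda>y. G (f y) *v dderiv f b y) has_derivative
      (\<lambda>c. G (f x) *v dderiv (dderiv f b) c x + dderiv G (dderiv f c x) (f x) *v dderiv f b x)) (at x)" .
    from bounded_bilinear.FDERIV[OF bounded_bilinear_inner has_derivative_dderiv[OF diff_df[OF x]] this]
    show "((\<lambda>y. dderiv f a y \<bullet> (G (f y) *v dderiv f b y)) has_derivative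
      (\<lambda>c. dderiv f a x \<bullet> (G (f x) *v dderiv (dderiv f b) c x + dderiv G (dderiv f c x) (f x) *v dderiv f b x)
         + dderiv (dderiv f a) c x \<bullet> (G (f x) *v dderiv f b x))) (at x)" .
  qed
  finally show ?thesis by (simp add: inner_add_right)
qed

text \<open>The failure of the Christoffel symbols to be a tensor is the second derivative of f.
  Testing the lowered symbols against w postpones inverses; the Jacobian and metric matrices are
  cancelled only at the end.\<close>

lemma Gam_pull:
  assumes x: "x \<in> U"
  shows "dderiv f (Gam (pull f G) x u v) x = Gam G (f x) (dderiv f u x) (dderiv f v x) + dderiv (dderiv
      f v) u x"
proof -
  have fx: "f x \<in> V" using fUV x by auto
  let ?J = "jac f x" and ?T = "dderiv (dderiv f v) u x"
  let ?l = "christoffel_low G (f x) (dderiv f u x) (dderiv f v x)"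
  have sym: "dderiv (dderiv f a) b x = dderiv (dderiv f b) a x" for a b
    by (rule dderiv_commute[OF U f x])
  \<comment> \<open>Of the six terms with a second derivative of f, the two in the directions u, w
    and the two in the directions v, w cancel by symmetry; the remaining two are equal and absorb
    the factor 1/2.\<close>
  have "christoffel_low (pull f G) x u v \<bullet> w = (?l + G (f x) *v ?T) \<bullet> dderiv f w x" for w
    unfolding christoffel_low_dot[OF smooth_on_differentiable[OF pull_smooth x]] dderiv_pull_dot[OF x]
      inner_add_left christoffel_low_dot[OF diff_G[OF fx]]
    using G_dot_commute[OF fx, of ?T "dderiv f w x"] G_dot_commute[OF fx, of "dderiv (dderiv f w) u x"
        "dderiv f v x"]
      G_dot_commute[OF fx, of "dderiv (dderiv f w) v x" "dderiv f u x"]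
    by (simp add: sym[of u w] sym[of v w] sym[of u v] inner_commute[of "G (f x) *v ?T"] algebra_simps)
  then have "christoffel_low (pull f G) x u v \<bullet> w = (transpose ?J *v (?l + G (f x) *v ?T)) \<bullet> w" for w
    by (simp add: jac_works diff_f[OF x] dot_lmul_matrix transpose_matrix_vector)
  then have low: "christoffel_low (pull f G) x u v = transpose ?J *v (?l + G (f x) *v ?T)"
    using vector_eq_rdot by blast
  have "pull f G x *v Gam (pull f G) x u v = christoffel_low (pull f G) x u v"
    unfolding Gam_def by (simp add: matrix_vector_mul_assoc matrix_inv_invertible pull_invertible[OF x])
  then have "transpose ?J *v (G (f x) *v (?J *v Gam (pull f G) x u v)) = transpose ?J *v (?l + G (f x) *v ?T)"
    unfolding low pull_def by (simp only: matrix_vector_mul_assoc matrix_mul_assoc)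
  then have "G (f x) *v (?J *v Gam (pull f G) x u v) = ?l + G (f x) *v ?T"
    using invertible_mult_cancel transpose_invertible[OF inv_jac[OF x]] by blast
  also have "\<dots> = G (f x) *v (Gam G (f x) (dderiv f u x) (dderiv f v x) + ?T)"
    unfolding Gam_def by (simp add: matrix_vector_right_distrib matrix_vector_mul_assoc
        matrix_inv_invertible inv_G[OF fx])
  finally have "?J *v Gam (pull f G) x u v = Gam G (f x) (dderiv f u x) (dderiv f v x) + ?T"
    using invertible_mult_cancel inv_G[OF fx] by blast
  then show ?thesis by (simp add: jac_works diff_f[OF x])
qed

text \<open>Separates the dependence on y from that on a and b, so that arguments moving with the
  point can be differentiated by the product rule.\<close>

lemma Gam_expand:
  assumes "y \<in> V"
  shows "Gam G y a b = (\<Sum>i\<in>UNIV. \<Sum>j\<in>UNIV. (a $ i * b $ j) *\<^sub>R Gam G y (axis i 1) (axis j 1))"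
proof -
  have l: "linear (\<lambda>a. Gam G y a b)" "linear (\<lambda>b. Gam G y a b)" for a b
    by (auto intro!: linearI simp: Gam_add_left Gam_add_right Gam_scale_left Gam_scale_right diff_G assms)
  have e: "v = (\<Sum>i\<in>UNIV. (v $ i) *\<^sub>R axis i 1)" for v :: "real ^ 'n"
    using basis_expansion[of v] by (simp add: scalar_mult_eq_scaleR)
  have "Gam G y a b = (\<Sum>i\<in>UNIV. (a $ i) *\<^sub>R Gam G y (axis i 1) b)"
    by (subst e[of a]) (simp add: linear_sum[OF l(1)] linear_cmul[OF l(1)])
  also have "\<dots> = (\<Sum>i\<in>UNIV. (a $ i) *\<^sub>R (\<Sum>j\<in>UNIV. (b $ j) *\<^sub>R Gam G y (axis i 1) (axis j 1)))"
    by (subst e[of b]) (simp add: linear_sum[OF l(2)] linear_cmul[OF l(2)])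
  finally show ?thesis by (simp add: scaleR_sum_right)
qed

lemma smooth_Gam: "smooth_on V (\<lambda>y. Gam G y u v)"
  by (rule smooth_on_Gam[OF V G inv_G])

lemma dderiv_Gam_expand:
  assumes y: "y \<in> V"
  shows "dderiv (\<lambda>y. Gam G y a b) c y
    = (\<Sum>i\<in>UNIV. \<Sum>j\<in>UNIV. (a $ i * b $ j) *\<^sub>R dderiv (\<lambda>y. Gam G y (axis i 1) (axis j 1)) c y)"
proof -
  have "dderiv (\<lambda>y. Gam G y a b) c y
    = dderiv (\<lambda>y. \<Sum>i\<in>UNIV. \<Sum>j\<in>UNIV. (a $ i * b $ j) *\<^sub>R Gam G y (axis i 1) (axis j 1)) c y"
    by (rule dderiv_cong[OF V y Gam_expand])
  also have "\<dots> = (\<Sum>i\<in>UNIV. \<Sum>j\<in>UNIV. (a $ i * b $ j) *\<^sub>R dderiv (\<lambda>y. Gam G y (axis i 1) (axis j 1)) c y)"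
    by (rule dderiv_eq)
      (intro has_derivative_sum bounded_linear.has_derivative[OF bounded_linear_scaleR_right]
        smooth_on_has_derivative[OF smooth_Gam y])
  finally show ?thesis .
qed

lemma dderiv_Gam_compose:
  assumes x: "x \<in> U" and a: "a differentiable (at x)" and b: "b differentiable (at x)"
  shows "dderiv (\<lambda>y. Gam G (f y) (a y) (b y)) u x =
    dderiv (\<lambda>z. Gam G z (a x) (b x)) (dderiv f u x) (f x)
    + Gam G (f x) (dderiv a u x) (b x) + Gam G (f x) (a x) (dderiv b u x)"
proof -
  have fx: "f x \<in> V" using fUV x by auto
  let ?\<Gamma> = "\<lambda>i j z. Gam G z (axis i 1) (axis j 1)"
  have "dderiv (\<lambda>y. Gam G (f y) (a y) (b y)) u x =
    dderiv (\<lambda>y. \<Sum>i\<in>UNIV. \<Sum>j\<in>UNIV. (a y $ i * b y $ j) *\<^sub>R ?\<Gamma> i j (f y)) u x"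
    by (rule dderiv_cong[OF U x Gam_expand]) (use fUV in auto)
  also have "\<dots> = (\<Sum>i\<in>UNIV. \<Sum>j\<in>UNIV. (a x $ i * b x $ j) *\<^sub>R dderiv (?\<Gamma> i j) (dderiv f u x) (f x)
     + (a x $ i * dderiv b u x $ j + dderiv a u x $ i * b x $ j) *\<^sub>R ?\<Gamma> i j (f x))"
  proof (rule dderiv_eq, intro has_derivative_sum)
    fix i j
    have c: "((\<lambda>y. ?\<Gamma> i j (f y)) has_derivative (\<lambda>u. dderiv (?\<Gamma> i j) (dderiv f u x) (f x))) (at x)"
      by (rule has_derivative_compose[of f "\<lambda>v. dderiv f v x" x UNIV "?\<Gamma> i j" "\<lambda>v. dderiv (?\<Gamma> i j) v (f x)"])
       (use diff_f[OF x] smooth_on_has_derivative[OF smooth_Gam fx] has_derivative_dderiv in auto)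
    have n: "((\<lambda>y. c y $ i) has_derivative (\<lambda>u. dderiv c u x $ i)) (at x)" if "c differentiable (at x)"
        for i and c :: "real ^ 'n \<Rightarrow> real ^ 'n"
      by (rule bounded_linear.has_derivative[OF bounded_linear_vec_nth has_derivative_dderiv[OF that]])
    show "((\<lambda>y. (a y $ i * b y $ j) *\<^sub>R ?\<Gamma> i j (f y)) has_derivative (\<lambda>u. (a x $ i * b x $ j) *\<^sub>R dderiv
        (?\<Gamma> i j) (dderiv f u x) (f x)
     + (a x $ i * dderiv b u x $ j + dderiv a u x $ i * b x $ j) *\<^sub>R ?\<Gamma> i j (f x))) (at x)"
      by (rule has_derivative_scaleR[OF has_derivative_mult[OF n[OF a] n[OF b]] c])
  qed
  also have "\<dots> = dderiv (\<lambda>z. Gam G z (a x) (b x)) (dderiv f u x) (f x)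
    + Gam G (f x) (dderiv a u x) (b x) + Gam G (f x) (a x) (dderiv b u x)"
    unfolding dderiv_Gam_expand[OF fx, of "a x" "b x"] Gam_expand[OF fx, of
        "dderiv a u x"] Gam_expand[OF fx, of "a x"]
    by (simp add: sum.distrib scaleR_add_left add_ac)
  finally show ?thesis .
qed

text \<open>Differentiating the transformation law of the Christoffel symbols; antisymmetrisation removes the
  third derivatives of \<open>f\<close>.\<close>

lemma Riem_pull:
  assumes x: "x \<in> U"
  shows "dderiv f (Riem (pull f G) x u v w) x = Riem G (f x) (dderiv f u x) (dderiv f v x) (dderiv f w x)"
proof -
  have fx: "f x \<in> V" using fUV x by auto
  let ?G = "\<lambda>y v w. Gam (pull f G) y v w"
  have smG: "smooth_on U (\<lambda>y. ?G y v w)" for v w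
    by (rule smooth_on_Gam[OF U pull_smooth pull_invertible])
  have L: "linear (\<lambda>v. dderiv f v x)" by (rule linear_frechet_derivative[OF diff_f[OF x]])
  \<comment> \<open>Obtained by differentiating \<open>?E\<close> in direction u in two ways: as df
    applied to the moving vector \<open>?G y v w\<close>, and after replacing \<open>?E\<close> by
    its value from \<open>Gam_pull\<close>.\<close>
  have D: "dderiv f (dderiv (\<lambda>y. ?G y v w) u x) x = 
      dderiv (\<lambda>z. Gam G z (dderiv f v x) (dderiv f w x)) (dderiv f u x) (f x)
     + Gam G (f x) (dderiv (dderiv f v) u x) (dderiv f w x) + Gam G (f x) (dderiv f v x) (dderiv (dderiv
         f w) u x)
     + dderiv (dderiv (dderiv f w) v) u x - dderiv (dderiv f (?G x v w)) u x" for u v w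
  proof -
    let ?E = "\<lambda>y. dderiv f (?G y v w) y"
    have exp: "dderiv f a y = (\<Sum>i\<in>UNIV. (a $ i) *\<^sub>R dderiv f (axis i 1) y)" if "y \<in> U" for a y
    proof -
      have l: "linear (\<lambda>v. dderiv f v y)" by (rule linear_frechet_derivative[OF diff_f[OF that]])
      have "a = (\<Sum>i\<in>UNIV. (a $ i) *\<^sub>R axis i 1)"
        using basis_expansion[of a] by (simp add: scalar_mult_eq_scaleR)
      then have "dderiv f a y = dderiv f (\<Sum>i\<in>UNIV. (a $ i) *\<^sub>R axis i 1) y" by simp
      also have "\<dots> = (\<Sum>i\<in>UNIV. (a $ i) *\<^sub>R dderiv f (axis i 1) y)"
        by (simp add: linear_sum[OF l] linear_cmul[OF l])
      finally show ?thesis .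
    qed
    have n: "((\<lambda>y. ?G y v w $ i) has_derivative (\<lambda>u. dderiv (\<lambda>y. ?G y v w) u x $ i)) (at x)" for i
      by (rule bounded_linear.has_derivative[OF bounded_linear_vec_nth smooth_on_has_derivative[OF smG x]])
    have exp2: "dderiv (dderiv f a) u x = (\<Sum>i\<in>UNIV. (a $ i) *\<^sub>R dderiv (dderiv f (axis i 1)) u x)" for a
    proof -
      have "dderiv (dderiv f a) u x = dderiv (\<lambda>y. \<Sum>i\<in>UNIV. (a $ i) *\<^sub>R dderiv f (axis i 1) y) u x"
        by (rule dderiv_cong[OF U x exp])
      also have "\<dots> = (\<Sum>i\<in>UNIV. (a $ i) *\<^sub>R dderiv (dderiv f (axis i 1)) u x)"
        by (rule dderiv_eq)
          (intro has_derivative_sum bounded_linear.has_derivative[OF bounded_linear_scaleR_right]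
              has_derivative_dderiv diff_df x)
      finally show ?thesis .
    qed
    have "dderiv ?E u x = dderiv (\<lambda>y. \<Sum>i\<in>UNIV. (?G y v w $ i) *\<^sub>R dderiv f (axis i 1) y) u x"
      by (rule dderiv_cong[OF U x exp])
    also have "\<dots> = (\<Sum>i\<in>UNIV. (?G x v w $ i) *\<^sub>R dderiv (dderiv f (axis i 1)) u x
        + (dderiv (\<lambda>y. ?G y v w) u x $ i) *\<^sub>R dderiv f (axis i 1) x)"
      by (rule dderiv_eq)
        (intro has_derivative_sum has_derivative_scaleR[OF n] has_derivative_dderiv diff_df x)
    also have "\<dots> = dderiv (dderiv f (?G x v w)) u x + dderiv f (dderiv (\<lambda>y. ?G y v w) u x) x"
      unfolding exp2[of "?G x v w"] exp[OF x, of "dderiv (\<lambda>y. ?G y v w) u x"] by (simp add: sum.distrib)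
    finally have 1: "dderiv ?E u x = dderiv (dderiv f (?G x v w)) u x + dderiv f (dderiv (\<lambda>y. ?G y v w)
        u x) x" .
    have "dderiv ?E u x = dderiv (\<lambda>y. Gam G (f y) (dderiv f v y) (dderiv f w y) + dderiv (dderiv f w) v y) u x"
      by (rule dderiv_cong[OF U x Gam_pull])
    also have "\<dots> = dderiv (\<lambda>y. Gam G (f y) (dderiv f v y) (dderiv f w y)) u x + dderiv (dderiv (dderiv f
        w) v) u x"
    proof (rule dderiv_eq, rule has_derivative_add)
      \<comment> \<open>By \<open>Gam_pull\<close> the composite to be differentiated equals this
        difference, whose smoothness is evident.\<close>
      have "smooth_on U (\<lambda>y. jac f y *v ?G y v w - dderiv (dderiv f w) v y)"
        by (intro smooth_on_diff smooth_on_matrix_vector_mult U smooth_on_jac smG smooth_on_dderiv f)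
      then have "smooth_on U (\<lambda>y. ?E y - dderiv (dderiv f w) v y)"
        by (rule smooth_on_cong[OF U, rotated]) (simp add: jac_works diff_f)
      then have "smooth_on U (\<lambda>y. Gam G (f y) (dderiv f v y) (dderiv f w y))"
        by (rule smooth_on_cong[OF U, rotated]) (simp add: Gam_pull)
      from smooth_on_has_derivative[OF this x]
      show "((\<lambda>y. Gam G (f y) (dderiv f v y) (dderiv f w y)) has_derivative
         (\<lambda>u. dderiv (\<lambda>y. Gam G (f y) (dderiv f v y) (dderiv f w y)) u x)) (at x)" .
      show "(dderiv (dderiv f w) v has_derivative (\<lambda>u. dderiv (dderiv (dderiv f w) v) u x)) (at x)"
        by (intro smooth_on_has_derivative[OF _ x] smooth_on_dderiv f)
    qed
    finally show ?thesis using 1 dderiv_Gam_compose[OF x diff_df[OF x] diff_df[OF x]]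
        by (simp add: algebra_simps)
  qed
  have sym: "dderiv (dderiv f v) u x = dderiv (dderiv f u) v x" for u v
    by (rule dderiv_commute[OF U f x])
  have sym3: "dderiv (dderiv (dderiv f w) v) u x = dderiv (dderiv (dderiv f w) u) v x"
    by (rule dderiv_commute[OF U smooth_on_dderiv[OF f] x])
  show ?thesis
    unfolding Riem_def linear_add[OF L] linear_diff[OF L] D Gam_pull[OF x] Gam_add_right[OF diff_G[OF fx]]
    using sym[of u v] sym3 by (simp add: algebra_simps)
qed

end

section \<open>From vectors back to coordinate components\<close>

lemma vec_expand: "v = (\<Sum>i\<in>UNIV. (v $ i) *\<^sub>R axis i 1)" for v :: "real ^ 'n::finite"
  using basis_expansion[of v] by (simp add: scalar_mult_eq_scaleR)

lemma linear_expand: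
  fixes F :: "real ^ 'n::finite \<Rightarrow> 'b::real_vector"
  assumes "linear F" shows "F v = (\<Sum>i\<in>UNIV. (v $ i) *\<^sub>R F (axis i 1))"
  by (subst vec_expand) (simp add: linear_sum[OF assms] linear_cmul[OF assms])

lemma axis_dot_matrix: "axis i 1 \<bullet> (A *v axis j 1) = A $ i $ j"
  for A :: "real ^ 'n::finite ^ 'm::finite"
  by (simp add: inner_axis' matrix_vector_mult_basis column_def)

lemma partial_deriv_entry:
  fixes G :: "real ^ 'n::finite \<Rightarrow> real ^ 'n ^ 'n"
  assumes "G differentiable (at x)"
  shows "partial_deriv i (\<lambda>y. G y $ j $ m) x = dderiv G (axis i 1) x $ j $ m"
  unfolding partial_deriv_def
  using dderiv_linear_comp[OF bounded_linear_compose[OF bounded_linear_vec_nth bounded_linear_vec_nth]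
      assms, of j m]
  by simp

lemma christoffel_eq_Gam:
  assumes "G differentiable (at x)"
  shows "christoffel G l i j x = Gam G x (axis i 1) (axis j 1) $ l"
  unfolding christoffel_def Gam_def christoffel_low_def
  by (simp add: matrix_vector_mult_def[of "matrix_inv (G x)"] partial_deriv_entry[OF assms]
      axis_dot_matrix sum_distrib_left algebra_simps)

lemma trace_matrix: "trace (matrix L) = (\<Sum>l\<in>UNIV. L (axis l 1) $ l)"
  for L :: "real ^ 'n::finite \<Rightarrow> real ^ 'n"
  by (simp add: trace_def matrix_def)

lemma matrix_inv_unique:
  fixes A B :: "real ^ 'n::finite ^ 'n"
  assumes "A ** B = mat 1" shows "matrix_inv A = B"
proof -
  have "invertible A" using assms invertible_right_inverse by blast
  then show ?thesis using assms by (metis matrix_inv_invertible(2) matrix_mul_assoc matrix_mul_lid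
      matrix_mul_rid)
qed

locale metric_on =
  fixes V :: "(real ^ 'n::finite) set" and G :: "real ^ 'n \<Rightarrow> real ^ 'n ^ 'n"
  assumes V: "open V" and G: "smooth_on V G" and inv_G: "\<And>y. y \<in> V \<Longrightarrow> invertible (G y)"
begin

lemma diff_G: "y \<in> V \<Longrightarrow> G differentiable (at y)"
  using smooth_on_differentiable[OF G] .

lemma linear_Gam: "y \<in> V \<Longrightarrow> linear (\<lambda>a. Gam G y a b)" "y \<in> V \<Longrightarrow> linear (\<lambda>b. Gam G y a b)" for a b
  by (auto intro!: linearI simp: Gam_add_left Gam_add_right Gam_scale_left Gam_scale_right diff_G)

lemma smooth_Gam: "smooth_on V (\<lambda>y. Gam G y u v)"
  by (rule smooth_on_Gam[OF V G inv_G])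

lemma linear_dderiv_Gam: 
  assumes y: "y \<in> V" 
  shows "linear (\<lambda>c. dderiv (\<lambda>y. Gam G y a b) c y)" "linear (\<lambda>a. dderiv (\<lambda>y. Gam G y a b) c y)" 
    "linear (\<lambda>b. dderiv (\<lambda>y. Gam G y a b) c y)"
proof -
  show "linear (\<lambda>c. dderiv (\<lambda>y. Gam G y a b) c y)"
    by (rule linear_frechet_derivative[OF smooth_on_differentiable[OF smooth_Gam y]])
  have d: "((\<lambda>y. Gam G y a b) has_derivative (\<lambda>c. dderiv (\<lambda>y. Gam G y a b) c y)) (at y)" for a b
    by (rule smooth_on_has_derivative[OF smooth_Gam y])
  have "dderiv (\<lambda>y. Gam G y (a + a') b) c y = dderiv (\<lambda>y. Gam G y a b + Gam G y a' b) c y" for a a' b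
    by (rule dderiv_cong[OF V y]) (simp add: Gam_add_left diff_G)
  moreover have "dderiv (\<lambda>y. Gam G y (r *\<^sub>R a) b) c y = dderiv (\<lambda>y. r *\<^sub>R Gam G y a b) c y" for r a b
    by (rule dderiv_cong[OF V y]) (simp add: Gam_scale_left diff_G)
  ultimately show "linear (\<lambda>a. dderiv (\<lambda>y. Gam G y a b) c y)"
    using dderiv_eq[OF has_derivative_add[OF d d]] dderiv_eq[OF bounded_linear.has_derivative[OF
        bounded_linear_scaleR_right d]]
    by (intro linearI) simp_all
  have "dderiv (\<lambda>y. Gam G y a (b + b')) c y = dderiv (\<lambda>y. Gam G y a b + Gam G y a b') c y" for a b b'
    by (rule dderiv_cong[OF V y]) (simp add: Gam_add_right diff_G)
  moreover have "dderiv (\<lambda>y. Gam G y a (r *\<^sub>R b)) c y = dderiv (\<lambda>y. r *\<^sub>R Gam G y a b) c y" for r a b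
    by (rule dderiv_cong[OF V y]) (simp add: Gam_scale_right diff_G)
  ultimately show "linear (\<lambda>b. dderiv (\<lambda>y. Gam G y a b) c y)"
    using dderiv_eq[OF has_derivative_add[OF d d]] dderiv_eq[OF bounded_linear.has_derivative[OF
        bounded_linear_scaleR_right d]]
    by (intro linearI) simp_all
qed

lemma linear_Riem:
  assumes x: "x \<in> V"
  shows "linear (\<lambda>u. Riem G x u v w)" "linear (\<lambda>v. Riem G x u v w)" "linear (\<lambda>w. Riem G x u v w)"
  unfolding Riem_def
  by (rule linearI; simp add: linear_add[OF linear_dderiv_Gam(1)[OF x]] linear_add[OF
      linear_dderiv_Gam(2)[OF x]]
    linear_add[OF linear_dderiv_Gam(3)[OF x]] linear_cmul[OF linear_dderiv_Gam(1)[OF x]]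
    linear_cmul[OF linear_dderiv_Gam(2)[OF x]] linear_cmul[OF linear_dderiv_Gam(3)[OF x]]
    Gam_add_left Gam_add_right Gam_scale_left Gam_scale_right diff_G[OF x] algebra_simps)+

lemma riemann_eq_Riem:
  assumes x: "x \<in> V"
  shows "riemann G l i j k x = Riem G x (axis j 1) (axis k 1) (axis i 1) $ l"
proof -
  have p: "partial_deriv j (christoffel G l k i) x = dderiv (\<lambda>y. Gam G y (axis k 1) (axis i 1)) (axis j
      1) x $ l" for j k
  proof -
    have "dderiv (christoffel G l k i) (axis j 1) x = dderiv (\<lambda>y. Gam G y (axis k 1) (axis i 1) $ l)
        (axis j 1) x"
      by (rule dderiv_cong[OF V x]) (simp add: christoffel_eq_Gam diff_G)
    also have "\<dots> = dderiv (\<lambda>y. Gam G y (axis k 1) (axis i 1)) (axis j 1) x $ l"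
      by (rule dderiv_linear_comp[OF bounded_linear_vec_nth smooth_on_differentiable[OF smooth_Gam x]])
    finally show ?thesis by (simp add: partial_deriv_def)
  qed
  have g: "(\<Sum>m\<in>UNIV. christoffel G l j m x * christoffel G m k i x)
      = Gam G x (axis j 1) (Gam G x (axis k 1) (axis i 1)) $ l" for j k
    unfolding christoffel_eq_Gam[OF diff_G[OF x]]
    by (subst (3) linear_expand[OF linear_Gam(2)[OF x]]) (simp add: mult.commute)
  show ?thesis unfolding riemann_def Riem_def p sum_subtractf g by simp
qed

text \<open>Contracting the upper index with the first direction is taking the trace of u ->
  R(u,v)w. In this form invariance of Ricci reduces to invariance of the trace under
  conjugation.\<close>

lemma ricci_dot:
  assumes x: "x \<in> V"
  shows "w \<bullet> (ricci G x *v v) = trace (matrix (\<lambda>u. Riem G x u v w))"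
proof -
  have "w \<bullet> (ricci G x *v v) = (\<Sum>i\<in>UNIV. \<Sum>k\<in>UNIV. \<Sum>l\<in>UNIV. w $ i * v $ k * Riem G x (axis l 1) (axis k
      1) (axis i 1) $ l)"
    by (simp add: inner_vec_def matrix_vector_mult_def ricci_def riemann_eq_Riem[OF x] sum_distrib_left
        sum_distrib_right mult_ac)
  also have "\<dots> = (\<Sum>i\<in>UNIV. \<Sum>l\<in>UNIV. \<Sum>k\<in>UNIV. w $ i * v $ k * Riem G x (axis l 1) (axis k 1) (axis i 1) $ l)"
    by (rule sum.cong[OF refl], rule sum.swap)
  also have "\<dots> = (\<Sum>l\<in>UNIV. \<Sum>i\<in>UNIV. \<Sum>k\<in>UNIV. w $ i * v $ k * Riem G x (axis l 1) (axis k 1) (axis i 1) $ l)"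
    by (rule sum.swap)
  also have "\<dots> = (\<Sum>l\<in>UNIV. Riem G x (axis l 1) v w $ l)"
  proof (rule sum.cong[OF refl])
    fix l
    have lin: "Riem G x (axis l 1) v a = (\<Sum>k\<in>UNIV. v $ k *\<^sub>R Riem G x (axis l 1) (axis k 1) a)" for a
      by (rule linear_expand[OF linear_Riem(2)[OF x]])
    have "Riem G x (axis l 1) v w = (\<Sum>i\<in>UNIV. w $ i *\<^sub>R Riem G x (axis l 1) v (axis i 1))"
      by (rule linear_expand[OF linear_Riem(3)[OF x]])
    also have "\<dots> = (\<Sum>i\<in>UNIV. w $ i *\<^sub>R (\<Sum>k\<in>UNIV. v $ k *\<^sub>R Riem G x (axis l 1) (axis k 1) (axis i 1)))"
      by (simp only: lin)
    finally show "(\<Sum>i\<in>UNIV. \<Sum>k\<in>UNIV. w $ i * v $ k * Riem G x (axis l 1) (axis k 1) (axis i 1) $ l)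
        = Riem G x (axis l 1) v w $ l"
      by (simp add: sum_distrib_left mult.assoc)
  qed
  finally show ?thesis by (simp add: trace_matrix)
qed

end

lemma scalar_curvature_trace: "scalar_curvature G x = trace (matrix_inv (G x) ** transpose (ricci G x))"
  unfolding scalar_curvature_def trace_def matrix_matrix_mult_def transpose_def by simp

text \<open>\<open>Ein\<close> on a coordinate domain, for a single matrix-valued function; all
  curvature estimates are made at this level.\<close>

definition EinM :: "real \<Rightarrow> (real ^ 'n::finite \<Rightarrow> real ^ 'n ^ 'n) \<Rightarrow> real ^ 'n \<Rightarrow> real ^ 'n ^ 'n" where
  "EinM k G x = scalar_curvature G x *\<^sub>R G x - k *\<^sub>R ricci G x"

lemma Ein_eq_EinM: "Ein k g c = EinM k (g c)"
  by (simp add: Ein_def EinM_def fun_eq_iff)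

context change_coords begin

sublocale source: metric_on U "pull f G"
  by unfold_locales (use U pull_smooth pull_invertible in auto)

sublocale target: metric_on V G
  by unfold_locales (use V G inv_G in auto)

lemma ricci_pull:
  assumes x: "x \<in> U"
  shows "ricci (pull f G) x = transpose (jac f x) ** ricci G (f x) ** jac f x"
proof (rule matrix_eqI_dot)
  fix w v
  have fx: "f x \<in> V" using x fUV by auto
  let ?J = "jac f x"
  let ?A = "matrix (\<lambda>u. Riem (pull f G) x u v w)"
  let ?B = "matrix (\<lambda>u. Riem G (f x) u (?J *v v) (?J *v w))"
  note Jinv = matrix_inv_invertible[OF inv_jac[OF x]]
  have mA: "?A *v u = Riem (pull f G) x u v w" for u
    using matrix_vector_mul(2)[OF source.linear_Riem(1)[OF x]] by metis
  have mB: "?B *v u = Riem G (f x) u (?J *v v) (?J *v w)" for u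
    using matrix_vector_mul(2)[OF target.linear_Riem(1)[OF fx]] by metis
  have "(?J ** ?A) *v u = (?B ** ?J) *v u" for u
  proof -
    have "(?J ** ?A) *v u = dderiv f (Riem (pull f G) x u v w) x"
      by (simp only: matrix_vector_mul_assoc[symmetric] mA jac_works[OF diff_f[OF x]])
    also have "\<dots> = Riem G (f x) (?J *v u) (?J *v v) (?J *v w)"
      by (simp only: Riem_pull[OF x] jac_works[OF diff_f[OF x]])
    also have "\<dots> = (?B ** ?J) *v u"
      by (simp only: matrix_vector_mul_assoc[symmetric] mB)
    finally show ?thesis .
  qed
  \<comment> \<open>The endomorphisms u -> R(u,v)w of the two metrics are conjugate by the Jacobian
    matrix.\<close>
  then have JA: "?J ** ?A = ?B ** ?J" using matrix_eq by blast
  have "?A = matrix_inv ?J ** (?B ** ?J)"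
    unfolding JA[symmetric] by (simp add: matrix_mul_assoc Jinv)
  then have "trace ?A = trace ((?B ** ?J) ** matrix_inv ?J)" by (metis trace_mul_sym)
  also have "\<dots> = trace ?B" by (simp add: Jinv flip: matrix_mul_assoc)
  finally show "w \<bullet> (ricci (pull f G) x *v v) = w \<bullet> ((transpose ?J ** ricci G (f x) ** ?J) *v v)"
    by (simp add: source.ricci_dot[OF x] dot_transpose_mult target.ricci_dot[OF fx])
qed

text \<open>The inverse metric transforms with inverse Jacobians on both sides, so its product with
  the transposed Ricci matrix is merely conjugated by the Jacobian, and the trace is
  unchanged.\<close>

lemma scalar_curvature_pull:
  assumes x: "x \<in> U"
  shows "scalar_curvature (pull f G) x = scalar_curvature G (f x)"
proof -
  have fx: "f x \<in> V" using x fUV by auto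
  let ?J = "jac f x" and ?R = "ricci G (f x)"
  let ?K = "matrix_inv ?J" and ?H = "matrix_inv (G (f x))"
  note Jinv = matrix_inv_invertible[OF inv_jac[OF x]] and Ginv = matrix_inv_invertible[OF inv_G[OF fx]]
  have t: "transpose ?J ** transpose ?K = mat 1" "transpose ?K ** transpose ?J = mat 1"
    unfolding matrix_transpose_mul[symmetric] Jinv by (simp_all add: transpose_mat)
  have c: "A ** (B ** (C :: real ^ 'n ^ 'n)) = C" if "A ** B = mat 1" for A B C :: "real ^ 'n ^ 'n"
    by (simp add: matrix_mul_assoc that)
  have inv: "matrix_inv (pull f G x) = ?K ** ?H ** transpose ?K"
    by (rule matrix_inv_unique)
      (simp add: pull_def t Jinv Ginv c[OF Jinv(1)] c[OF Ginv(1)] flip: matrix_mul_assoc)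
  have "matrix_inv (pull f G x) ** transpose (ricci (pull f G) x) = ?K ** (?H ** transpose ?R ** ?J)"
    unfolding inv ricci_pull[OF x] by (simp add: matrix_transpose_mul t c[OF t(2)] flip: matrix_mul_assoc)
  then have "scalar_curvature (pull f G) x = trace ((?H ** transpose ?R ** ?J) ** ?K)"
    unfolding scalar_curvature_trace by (metis trace_mul_sym)
  also have "\<dots> = trace (?H ** transpose ?R)" by (simp add: Jinv flip: matrix_mul_assoc)
  finally show ?thesis unfolding scalar_curvature_trace .
qed

lemma EinM_pull: "x \<in> U \<Longrightarrow> EinM k (pull f G) x = transpose (jac f x) ** EinM k G (f x) ** jac f x"
  by (rule matrix_eqI_dot)
    (simp add: EinM_def scalar_curvature_pull ricci_pull dot_transpose_mult pull_def
      matrix_vector_mult_diff_rdistrib inner_diff_right scaleR_matrix_vector_assoc[symmetric])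

end

lemma christoffel_cong:
  assumes "open S" "x \<in> S" "\<And>y. y \<in> S \<Longrightarrow> G y = G' y"
  shows "christoffel G l i j x = christoffel G' l i j x"
proof -
  have "partial_deriv i (\<lambda>y. G y $ j $ m) x = partial_deriv i (\<lambda>y. G' y $ j $ m) x" for i j m
    unfolding partial_deriv_def by (rule dderiv_cong[OF assms(1,2)]) (simp add: assms(3))
  then show ?thesis unfolding christoffel_def using assms(2,3) by simp
qed

text \<open>Curvature uses derivatives of G, so equality is required on a neighbourhood of x. This
  permits replacing a metric given by cases by the formula valid near the point.\<close>

lemma EinM_cong:
  assumes "open S" "x \<in> S" "\<And>y. y \<in> S \<Longrightarrow> G y = G' y"
  shows "EinM k G x = EinM k G' x"
proof -
  note c = christoffel_cong[OF assms(1) _ assms(3)]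
  have p: "partial_deriv j (christoffel G l k i) x = partial_deriv j (christoffel G' l k i) x" for j k l i
    unfolding partial_deriv_def by (rule dderiv_cong[OF assms(1,2)]) (rule c)
  have r: "ricci G x = ricci G' x"
    unfolding ricci_def riemann_def using p c[OF assms(2)] by simp
  show ?thesis unfolding EinM_def scalar_curvature_def r using assms(2,3) by simp
qed

section \<open>Conformally flat metrics\<close>

definition conf :: "(real ^ 'n::finite \<Rightarrow> real) \<Rightarrow> real ^ 'n \<Rightarrow> real ^ 'n ^ 'n" where
  "conf f x = exp (2 * f x) *\<^sub>R mat 1"

definition grad :: "(real ^ 'n::finite \<Rightarrow> real) \<Rightarrow> real ^ 'n \<Rightarrow> real ^ 'n" where
  "grad f x = (\<chi> m. dderiv f (axis m 1) x)"

definition lap :: "(real ^ 'n::finite \<Rightarrow> real) \<Rightarrow> real ^ 'n \<Rightarrow> real" where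
  "lap f x = (\<Sum>i\<in>UNIV. dderiv (dderiv f (axis i 1)) (axis i 1) x)"

lemma grad_dot:
  assumes "f differentiable (at x)" shows "grad f x \<bullet> v = dderiv f v x"
  by (subst linear_expand[OF linear_frechet_derivative[OF assms]])
    (simp add: grad_def inner_vec_def mult.commute)

lemma smooth_on_conf: "open V \<Longrightarrow> smooth_on V f \<Longrightarrow> smooth_on V (conf f)"
  unfolding conf_def by (intro smooth_on_scaleR smooth_on_exp smooth_on_mult smooth_on_const)

lemma axis_self: "axis i a $ i = a"
  by (simp add: axis_def)

lemma scaleR_matrix_mult: "(r *\<^sub>R A) ** B = r *\<^sub>R (A ** B)" "A ** (r *\<^sub>R B) = r *\<^sub>R (A ** B)"
  for A :: "real ^ 'n::finite ^ 'm::finite" and B :: "real ^ 'p::finite ^ 'n"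
  by (simp_all add: matrix_matrix_mult_def vec_eq_iff sum_distrib_left mult_ac)

lemma matrix_inv_conf: "matrix_inv (conf f x) = exp (- 2 * f x) *\<^sub>R mat 1"
  by (rule matrix_inv_unique) (simp add: conf_def scaleR_matrix_mult flip: exp_add)

lemma invertible_conf: "invertible (conf f x)"
  unfolding invertible_right_inverse 
  by (rule exI[of _ "exp (- 2 * f x) *\<^sub>R mat 1"]) (simp add: conf_def scaleR_matrix_mult flip: exp_add)

lemma dot_axis: "v \<bullet> axis m 1 = v $ m" "axis m 1 \<bullet> v = v $ m" for v :: "real ^ 'n::finite"
  by (simp_all add: inner_axis inner_axis')

context
  fixes V :: "(real ^ 'n::finite) set" and f :: "real ^ 'n \<Rightarrow> real"
  assumes V: "open V" and f: "smooth_on V f"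
begin

lemma metric_on_conf: "metric_on V (conf f)"
  by unfold_locales (auto intro: V smooth_on_conf f invertible_conf)

text \<open>The derivative of \<open>conf f\<close> in direction u is 2 df(u) times the metric
  itself, so the exponentials in the metric and in its inverse cancel.\<close>

lemma Gam_conf:
  assumes x: "x \<in> V"
  shows "Gam (conf f) x u v = dderiv f u x *\<^sub>R v + dderiv f v x *\<^sub>R u - (u \<bullet> v) *\<^sub>R grad f x"
proof -
  have d: "(f has_derivative (\<lambda>u. dderiv f u x)) (at x)" by (rule smooth_on_has_derivative[OF f x])
  have "(conf f has_derivative (\<lambda>u. (exp (2 * f x) * (2 * dderiv f u x)) *\<^sub>R mat 1)) (at x)"
    unfolding conf_def by (auto intro!: derivative_eq_intros d)
  then have dG: "dderiv (conf f) u x = (2 * exp (2 * f x) * dderiv f u x) *\<^sub>R mat 1" for u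
    by (simp add: dderiv_eq mult_ac)
  have "christoffel_low (conf f) x u v = exp (2 * f x) *\<^sub>R (dderiv f u x *\<^sub>R v + dderiv f v x *\<^sub>R u - (u
      \<bullet> v) *\<^sub>R grad f x)"
    by (simp add: christoffel_low_def dG vec_eq_iff scaleR_matrix_vector_assoc[symmetric] dot_axis
        grad_def algebra_simps)
  then show ?thesis
    by (simp add: Gam_def matrix_inv_conf scaleR_matrix_vector_assoc[symmetric] flip: exp_add)
qed

lemma dderiv_Gam_conf:
  assumes x: "x \<in> V"
  shows "dderiv (\<lambda>y. Gam (conf f) y v w) u x =
    dderiv (dderiv f v) u x *\<^sub>R w + dderiv (dderiv f w) u x *\<^sub>R v - (v \<bullet> w) *\<^sub>R (\<chi> m. dderiv (dderiv f
        (axis m 1)) u x)"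
proof -
  have d: "(dderiv f a has_derivative (\<lambda>u. dderiv (dderiv f a) u x)) (at x)" for a
    by (rule smooth_on_has_derivative[OF smooth_on_dderiv[OF f] x])
  have g: "grad f = (\<lambda>y. \<Sum>m\<in>UNIV. dderiv f (axis m 1) y *\<^sub>R axis m 1)"
    by (rule ext, subst vec_expand) (simp add: grad_def)
  have dg: "(grad f has_derivative (\<lambda>u. \<Sum>m\<in>UNIV. dderiv (dderiv f (axis m 1)) u x *\<^sub>R axis m 1)) (at x)"
    unfolding g by (auto intro!: derivative_eq_intros d)
  have e: "(\<Sum>m\<in>UNIV. dderiv (dderiv f (axis m 1)) u x *\<^sub>R axis m 1)
      = (\<chi> m. dderiv (dderiv f (axis m 1)) u x)" for u
    by (subst (2) vec_expand) simp
  have "dderiv (\<lambda>y. Gam (conf f) y v w) u x = dderiv (\<lambda>y. dderiv f v y *\<^sub>R w + dderiv f w y *\<^sub>R v - (v \<bullet>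
      w) *\<^sub>R grad f y) u x"
    by (rule dderiv_cong[OF V x Gam_conf])
  also have "\<dots> = dderiv (dderiv f v) u x *\<^sub>R w + dderiv (dderiv f w) u x *\<^sub>R v - (v \<bullet> w) *\<^sub>R (\<chi> m.
      dderiv (dderiv f (axis m 1)) u x)"
    unfolding e[symmetric] by (rule dderiv_eq) (auto intro!: derivative_eq_intros d dg)
  finally show ?thesis .
qed

text \<open>The classical formula for a metric conformal to the flat one: the whole curvature
  operator comes from f, and its terms are traced one by one.\<close>

lemma ricci_conf:
  assumes x: "x \<in> V"
  shows "w \<bullet> (ricci (conf f) x *v v) =
    - (real CARD('n) - 2) * (dderiv (dderiv f v) w x - dderiv f v x * dderiv f w x)
    - (v \<bullet> w) * (lap f x + (real CARD('n) - 2) * (norm (grad f x))\<^sup>2)"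
proof -
  interpret metric_on V "conf f" by (rule metric_on_conf)
  let ?n = "real CARD('n)"
  let ?g = "grad f x" and ?h = "\<lambda>u. (\<chi> m. dderiv (dderiv f (axis m 1)) u x)"
  have sym: "dderiv (dderiv f a) b x = dderiv (dderiv f b) a x" for a b
    by (rule dderiv_commute[OF V f x])
  have gd: "dderiv f v x = ?g \<bullet> v" for v using grad_dot smooth_on_differentiable[OF f x] by metis
  have R: "Riem (conf f) x u v w = dderiv (dderiv f w) u x *\<^sub>R v - dderiv (dderiv f w) v x *\<^sub>R u
      - (v \<bullet> w) *\<^sub>R ?h u + (u \<bullet> w) *\<^sub>R ?h v
      + ((?g \<bullet> v) * (?g \<bullet> w)) *\<^sub>R u - ((?g \<bullet> u) * (?g \<bullet> w)) *\<^sub>R v 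
      - ((v \<bullet> w) * (?g \<bullet> ?g)) *\<^sub>R u + ((u \<bullet> w) * (?g \<bullet> ?g)) *\<^sub>R v
      + ((?g \<bullet> u) * (v \<bullet> w) - (?g \<bullet> v) * (u \<bullet> w)) *\<^sub>R ?g" for u
    unfolding Riem_def dderiv_Gam_conf[OF x] Gam_conf[OF x] gd
    using sym[of u v]
    by (simp add: vec_eq_iff inner_add_left inner_add_right inner_diff_left inner_diff_right
        inner_commute[of u ?g] inner_commute[of v ?g] inner_commute[of w ?g] inner_commute[of v u]
        algebra_simps)
  \<comment> \<open>The trace of the rank one map u -> F(u) v is F(v).\<close>
  have s1: "(\<Sum>l\<in>UNIV. F (axis l 1) * v $ l) = F v" if "linear F" for F :: "real ^ 'n \<Rightarrow> real" and v
    using linear_expand[OF that, of v] by (simp add: mult.commute)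
  have l2: "linear (\<lambda>u. dderiv (dderiv f w) u x)"
    by (rule linear_frechet_derivative[OF smooth_on_differentiable[OF smooth_on_dderiv[OF f] x]])
  have s2: "(\<Sum>l\<in>UNIV. w $ l * dderiv (dderiv f (axis l 1)) v x) = dderiv (dderiv f v) w x"
    using s1[OF linear_frechet_derivative[OF smooth_on_differentiable[OF smooth_on_dderiv[OF f] x]], of v w]
    by (simp add: sym[of v] mult.commute)
  have dotsum: "(\<Sum>l\<in>UNIV. a $ l * b $ l) = a \<bullet> b" for a b :: "real ^ 'n" by (simp add: inner_vec_def)
  have "w \<bullet> (ricci (conf f) x *v v) = (\<Sum>l\<in>UNIV. Riem (conf f) x (axis l 1) v w $ l)"
    by (simp add: ricci_dot[OF x] trace_matrix)
  also have "\<dots> = (\<Sum>l\<in>UNIV. dderiv (dderiv f w) (axis l 1) x * v $ l) - ?n * dderiv (dderiv f w) v x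
     - (v \<bullet> w) * lap f x + (\<Sum>l\<in>UNIV. w $ l * dderiv (dderiv f (axis l 1)) v x)
     + ?n * ((?g \<bullet> v) * (?g \<bullet> w)) - (?g \<bullet> w) * (\<Sum>l\<in>UNIV. ?g $ l * v $ l)
     - ?n * ((v \<bullet> w) * (?g \<bullet> ?g)) + (?g \<bullet> ?g) * (\<Sum>l\<in>UNIV. w $ l * v $ l)
     + (v \<bullet> w) * (\<Sum>l\<in>UNIV. ?g $ l * ?g $ l) - (?g \<bullet> v) * (\<Sum>l\<in>UNIV. w $ l * ?g $ l)"
    unfolding R by (simp add: sum.distrib sum_subtractf dot_axis lap_def sum_distrib_left axis_self
        algebra_simps)
  also have "\<dots> = - (?n - 2) * (dderiv (dderiv f w) v x - (?g \<bullet> v) * (?g \<bullet> w)) - (v \<bullet> w) * (lap f x + (?n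
      - 2) * (?g \<bullet> ?g))"
    unfolding s1[OF l2] s2 dotsum sym[of v w] inner_commute[of w] by (simp add: algebra_simps)
  finally show ?thesis by (simp add: gd sym[of v w] power2_norm_eq_inner)
qed

text \<open>The factor exp(-2f) of the scalar curvature meets the factor exp(2f) of the metric, so
  no exponential survives and only first and second derivatives of f enter.\<close>

lemma EinM_conf:
  assumes x: "x \<in> V"
  shows "v \<bullet> (EinM k (conf f) x *v v) =
    (norm v)\<^sup>2 * (- (2 * real CARD('n) - 2) * lap f x - (real CARD('n) - 1) * (real CARD('n) - 2) *
        (norm (grad f x))\<^sup>2)
     + k * ((real CARD('n) - 2) * (dderiv (dderiv f v) v x - (dderiv f v x)\<^sup>2)
     + (norm v)\<^sup>2 * (lap f x + (real CARD('n) - 2) * (norm (grad f x))\<^sup>2))"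
proof -
  let ?n = "real CARD('n)"
  have "scalar_curvature (conf f) x = exp (- 2 * f x) * (\<Sum>i\<in>UNIV. ricci (conf f) x $ i $ i)"
    by (simp add: scalar_curvature_def matrix_inv_conf mat_def mult.assoc if_distrib[of "\<lambda>z. z * _"]
       cong: if_cong flip: sum_distrib_left)
  also have "(\<Sum>i\<in>UNIV. ricci (conf f) x $ i $ i) = (\<Sum>i\<in>UNIV. axis i 1 \<bullet> (ricci (conf f) x *v axis i 1))"
    by (simp add: axis_dot_matrix)
  also have "\<dots> = - (?n - 2) * (lap f x - (norm (grad f x))\<^sup>2) - ?n * (lap f x + (?n - 2) * (norm (grad f x))\<^sup>2)"
  proof -
    have "(norm (grad f x))\<^sup>2 = (\<Sum>i\<in>UNIV. dderiv f (axis i 1) x * dderiv f (axis i 1) x)"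
      by (simp add: power2_norm_eq_inner inner_vec_def grad_def)
    then show ?thesis
      unfolding ricci_conf[OF x] by (simp add: sum_subtractf sum_distrib_left[symmetric] lap_def
          dot_axis axis_self)
  qed
  finally have "scalar_curvature (conf f) x * exp (2 * f x) = 
    (- (2 * ?n - 2) * lap f x - (?n - 1) * (?n - 2) * (norm (grad f x))\<^sup>2)"
    by (simp add: exp_minus field_simps)
  then have "v \<bullet> ((scalar_curvature (conf f) x *\<^sub>R conf f x) *v v) = 
    (norm v)\<^sup>2 * (- (2 * ?n - 2) * lap f x - (?n - 1) * (?n - 2) * (norm (grad f x))\<^sup>2)"
    by (simp add: conf_def scaleR_matrix_vector_assoc[symmetric] power2_norm_eq_inner mult.assoc)
  then show ?thesis
    unfolding EinM_def matrix_vector_mult_diff_rdistrib inner_diff_right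
    by (simp add: scaleR_matrix_vector_assoc[symmetric] ricci_conf[OF x] dot_square_norm
        power2_eq_square[of "dderiv f v x"] algebra_simps)
qed

end

section \<open>Positivity of Ein as a condition on the conformal factor\<close>

definition ein_pos :: "real \<Rightarrow> (real ^ 'n::finite \<Rightarrow> real ^ 'n ^ 'n) \<Rightarrow> real ^ 'n \<Rightarrow> bool" where
  "ein_pos k G x \<longleftrightarrow> (\<forall>v. v \<noteq> 0 \<longrightarrow> v \<bullet> (EinM k G x *v v) > 0)"

text \<open>The gradient part left after inserting f = q ln u in \<open>EinM_conf\<close>, freed of
  the factor q/u^2. The terms without q come from the second derivatives of the logarithm, those
  with q from the squared first derivatives of f.\<close>

definition ein_quad :: "real \<Rightarrow> real \<Rightarrow> real ^ 'n::finite \<Rightarrow> real ^ 'n \<Rightarrow> real" where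
  "ein_quad k q v a = (2 * real CARD('n) - 2 - k - q * (real CARD('n) - 2) * (real CARD('n) - 1 - k)) *
      (norm v)\<^sup>2 * (a \<bullet> a)
     - k * (real CARD('n) - 2) * (1 + q) * (a \<bullet> v)\<^sup>2"

text \<open>This is u/q times Ein, evaluated on v, of the metric with exponent q ln u: linear in the
  second derivatives and homogeneous of degree one in u.\<close>

definition ein_op :: "real \<Rightarrow> real \<Rightarrow> (real ^ 'n::finite \<Rightarrow> real) \<Rightarrow> real ^ 'n \<Rightarrow> real ^ 'n \<Rightarrow> real" where
  "ein_op k q u x v = (k - (2 * real CARD('n) - 2)) * (norm v)\<^sup>2 * lap u x
     + k * (real CARD('n) - 2) * dderiv (dderiv u v) v x + ein_quad k q v (grad u x) / u x"

text \<open>For k >= 0 the term with (a . v)^2 has the good sign and the coefficient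
  \<open>A\<close> decides; it decreases in q because k < n - 1. For k < 0 that term has the wrong
  sign, but by Cauchy-Schwarz it is largest when a is parallel to v, where the total coefficient is
  \<open>B\<close>.\<close>

lemma ein_quad_nonpos:
  assumes "CARD('n) \<ge> 3" "k < real CARD('n) - 1"
  shows "\<exists>q>0. \<forall>v a :: real ^ 'n::finite. ein_quad k q v a \<le> 0"
proof -
  let ?n = "real CARD('n)"
  have n: "?n \<ge> 3" using assms(1) by simp
  \<comment> \<open>The two quotients are thresholds beyond which \<open>A\<close> and
    \<open>B\<close> are nonpositive; the summand 1 gives q > 0.\<close>
  define q where "q = 1 + \<bar>2 * ?n - 2 - k\<bar> / ((?n - 2) * (?n - 1 - k)) + \<bar>2 * ?n - 2 - k - k * (?n - 2)\<bar>
      / ((?n - 2) * (?n - 1))"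
  have p1: "(?n - 2) * (?n - 1 - k) > 0" and p2: "(?n - 2) * (?n - 1) > 0" using n assms(2) by simp_all
  have q: "q \<ge> 1" "q \<ge> \<bar>2 * ?n - 2 - k\<bar> / ((?n - 2) * (?n - 1 - k))"
      "q \<ge> \<bar>2 * ?n - 2 - k - k * (?n - 2)\<bar> / ((?n - 2) * (?n - 1))"
    using p1 p2 unfolding q_def by (smt (verit) divide_nonneg_pos)+
  have A: "2 * ?n - 2 - k - q * (?n - 2) * (?n - 1 - k) \<le> 0"
    using q(2) p1 by (simp add: divide_le_eq mult.assoc)
  have B: "2 * ?n - 2 - k - k * (?n - 2) - q * ((?n - 2) * (?n - 1)) \<le> 0"
    using q(3) p2 by (simp add: divide_le_eq)
  have "ein_quad k q v a \<le> 0" for v a :: "real ^ 'n"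
  proof (cases "k \<ge> 0")
    case True
    have "0 \<le> k * (?n - 2) * (1 + q) * (a \<bullet> v)\<^sup>2" using True n q(1) by simp
    moreover have "(2 * ?n - 2 - k - q * (?n - 2) * (?n - 1 - k)) * ((norm v)\<^sup>2 * (a \<bullet> a)) \<le> 0"
      using A by (intro mult_nonpos_nonneg) auto
    ultimately show ?thesis by (simp add: ein_quad_def mult.assoc)
  next
    case False
    have "(a \<bullet> v)\<^sup>2 \<le> (norm v)\<^sup>2 * (a \<bullet> a)"
      using Cauchy_Schwarz_ineq[of a v] by (simp add: power2_norm_eq_inner mult.commute)
    then have "- k * (?n - 2) * (1 + q) * (a \<bullet> v)\<^sup>2 \<le> - k * (?n - 2) * (1 + q) * ((norm v)\<^sup>2 * (a \<bullet> a))"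
      using False n q(1) by (intro mult_left_mono mult_nonneg_nonneg) auto
    then have "ein_quad k q v a \<le> (2 * ?n - 2 - k - k * (?n - 2) - q * ((?n - 2) * (?n - 1))) * ((norm
        v)\<^sup>2 * (a \<bullet> a))"
      unfolding ein_quad_def by (simp add: algebra_simps)
    also have "\<dots> \<le> 0" using B by (intro mult_nonpos_nonneg) auto
    finally show ?thesis .
  qed
  then show ?thesis using q(1) by (intro exI[of _ q]) auto
qed

text \<open>For a quadratic form Q the difference Q(a)/s + Q(b)/t - Q(a+b)/(s+t) equals Q(t a - s
  b)/(s t (s+t)), so it inherits the sign of Q.\<close>

lemma ein_quad_superadditive:
  fixes v a b :: "real ^ 'n::finite"
  assumes "\<And>a :: real ^ 'n. ein_quad k q v a \<le> 0" "s > 0" "t > 0"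
  shows "ein_quad k q v a / s + ein_quad k q v b / t \<le> ein_quad k q v (a + b) / (s + t)"
proof -
  define c1 where "c1 = (2 * real CARD('n) - 2 - k - q * (real CARD('n) - 2) * (real CARD('n) - 1 - k))
      * (norm v)\<^sup>2"
  define c2 where "c2 = k * (real CARD('n) - 2) * (1 + q)"
  have Q: "ein_quad k q v a = c1 * (a \<bullet> a) - c2 * (a \<bullet> v)\<^sup>2" for a
    by (simp add: ein_quad_def c1_def c2_def)
  define z where "z = c1 * (a \<bullet> b) - c2 * ((a \<bullet> v) * (b \<bullet> v))"
  have e1: "ein_quad k q v (a + b) = ein_quad k q v a + ein_quad k q v b + 2 * z"
    unfolding Q z_def by (simp add: inner_add_left inner_add_right inner_commute[of b a]
        power2_eq_square algebra_simps)
  have e2: "ein_quad k q v (t *\<^sub>R a - s *\<^sub>R b) = t\<^sup>2 * ein_quad k q v a + s\<^sup>2 * ein_quad k q v b - 2 * s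
      * t * z"
    unfolding Q z_def by (simp add: inner_diff_left inner_diff_right inner_commute[of b a]
        power2_eq_square algebra_simps)
  have id: "X / s + Y / t - (X + Y + 2 * z) / (s + t) = (t\<^sup>2 * X + s\<^sup>2 * Y - 2 * s * t * z) / (s * t *
      (s + t))" for X Y
    using assms(2,3) by (simp add: field_simps power2_eq_square)
  have "(t\<^sup>2 * ein_quad k q v a + s\<^sup>2 * ein_quad k q v b - 2 * s * t * z) / (s * t * (s + t)) \<le> 0"
    using assms(1)[of "t *\<^sub>R a - s *\<^sub>R b"] assms(2,3) unfolding e2 by (intro divide_nonpos_pos) auto
  then show ?thesis unfolding e1 using id[of "ein_quad k q v a" "ein_quad k q v b"] by linarith
qed

lemma lap_add:
  fixes u w :: "real ^ 'n::finite \<Rightarrow> real"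
  assumes V: "open V" and x: "x \<in> V" and u: "smooth_on V u" and w: "smooth_on V w"
  shows "dderiv (\<lambda>y. u y + w y) v x = dderiv u v x + dderiv w v x"
    "dderiv (dderiv (\<lambda>y. u y + w y) v) v' x = dderiv (dderiv u v) v' x + dderiv (dderiv w v) v' x"
    "lap (\<lambda>y. u y + w y) x = lap u x + lap w x" "grad (\<lambda>y. u y + w y) x = grad u x + grad w x"
proof -
  have a: "dderiv (\<lambda>y. u y + w y) v y = dderiv u v y + dderiv w v y" if "y \<in> V" for v y
    by (rule dderiv_eq) (intro has_derivative_add smooth_on_has_derivative[OF u that]
        smooth_on_has_derivative[OF w that])
  then show "dderiv (\<lambda>y. u y + w y) v x = dderiv u v x + dderiv w v x" "grad (\<lambda>y. u y + w y) x
      = grad u x + grad w x"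
    using x by (simp_all add: grad_def vec_eq_iff)
  have b: "dderiv (dderiv (\<lambda>y. u y + w y) v) v' x = dderiv (dderiv u v) v' x + dderiv (dderiv w v) v' x"
      for v v'
  proof -
    have "dderiv (dderiv (\<lambda>y. u y + w y) v) v' x = dderiv (\<lambda>y. dderiv u v y + dderiv w v y) v' x"
      by (rule dderiv_cong[OF V x a])
    also have "\<dots> = dderiv (dderiv u v) v' x + dderiv (dderiv w v) v' x"
      by (rule dderiv_eq)
        (intro has_derivative_add smooth_on_has_derivative[OF smooth_on_dderiv[OF u] x]
            smooth_on_has_derivative[OF smooth_on_dderiv[OF w] x])
    finally show ?thesis .
  qed
  then show "dderiv (dderiv (\<lambda>y. u y + w y) v) v' x = dderiv (dderiv u v) v' x + dderiv (dderiv w v) v' x" 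
    "lap (\<lambda>y. u y + w y) x = lap u x + lap w x"
    by (simp_all add: lap_def sum.distrib)
qed

lemma ein_op_superadditive:
  fixes u w :: "real ^ 'n::finite \<Rightarrow> real"
  assumes V: "open V" and x: "x \<in> V" and u: "smooth_on V u" and w: "smooth_on V w"
    and pos: "u x > 0" "w x > 0" and q: "\<And>a :: real ^ 'n. ein_quad k q v a \<le> 0"
  shows "ein_op k q u x v + ein_op k q w x v \<le> ein_op k q (\<lambda>y. u y + w y) x v"
  unfolding ein_op_def lap_add[OF V x u w]
  using ein_quad_superadditive[OF q pos] by (simp add: algebra_simps)

text \<open>Every term of \<open>EinM_conf\<close> carries the factor q/u after the substitution;
  once q > 0 the sign of Ein is therefore that of \<open>ein_op\<close>.\<close>

lemma EinM_conf_ln: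
  fixes u :: "real ^ 'n::finite \<Rightarrow> real"
  assumes V: "open V" and x: "x \<in> V" and u: "smooth_on V u" and pos: "\<And>y. y \<in> V \<Longrightarrow> u y > 0"
  shows "v \<bullet> (EinM k (conf (\<lambda>y. q * ln (u y))) x *v v) = q / u x * ein_op k q u x v"
proof -
  let ?f = "\<lambda>y. q * ln (u y)"
  let ?n = "real CARD('n)"
  have f: "smooth_on V ?f" using pos by (intro smooth_on_mult smooth_on_ln V u smooth_on_const) auto
  have ux: "u x > 0" using pos x by simp
  have d1: "dderiv ?f v y = q * (dderiv u v y / u y)" if "y \<in> V" for v y
    by (rule dderiv_eq) (use pos[OF that] in \<open>auto intro!: derivative_eq_intros
        smooth_on_has_derivative[OF u that] simp: field_simps\<close>)
  have d2: "dderiv (dderiv ?f v) w x = q * (dderiv (dderiv u v) w x / u x - dderiv u v x * dderiv u w x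
      / (u x)\<^sup>2)" for v w
  proof -
    have "dderiv (dderiv ?f v) w x = dderiv (\<lambda>y. q * (dderiv u v y / u y)) w x"
      by (rule dderiv_cong[OF V x d1])
    also have "\<dots> = q * (dderiv (dderiv u v) w x / u x - dderiv u v x * dderiv u w x / (u x)\<^sup>2)"
      by (rule dderiv_eq) (use ux in \<open>auto intro!: derivative_eq_intros smooth_on_has_derivative[OF u x] 
          smooth_on_has_derivative[OF smooth_on_dderiv[OF u] x] simp: field_simps power2_eq_square\<close>)
    finally show ?thesis .
  qed
  have g: "grad ?f x = (q / u x) *\<^sub>R grad u x"
    by (simp add: grad_def vec_eq_iff d1[OF x])
  have ng: "grad u x \<bullet> grad u x = (\<Sum>i\<in>UNIV. dderiv u (axis i 1) x * dderiv u (axis i 1) x)"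
    by (simp add: grad_def inner_vec_def)
  have l: "lap ?f x = q * (lap u x / u x - (grad u x \<bullet> grad u x) / (u x)\<^sup>2)"
    unfolding lap_def d2 ng by (simp add: sum_distrib_left sum_subtractf sum_divide_distrib right_diff_distrib)
  have ngf: "(norm (grad ?f x))\<^sup>2 = q\<^sup>2 * (grad u x \<bullet> grad u x) / (u x)\<^sup>2"
    unfolding g power2_norm_eq_inner by (simp add: power2_eq_square)
  have gv: "grad u x \<bullet> v = dderiv u v x" by (rule grad_dot[OF smooth_on_differentiable[OF u x]])
  \<comment> \<open>With the derivatives replaced by names the goal is a rational identity in real
    variables.\<close>
  define N where "N = (norm v)\<^sup>2"
  define M where "M = grad u x \<bullet> grad u x"
  define d where "d = dderiv u v x"
  define D where "D = dderiv (dderiv u v) v x"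
  define U where "U = u x"
  define L where "L = lap u x"
  show ?thesis
    unfolding EinM_conf[OF V f x] ein_op_def ein_quad_def d2 d1[OF x] l ngf gv
    unfolding N_def[symmetric] M_def[symmetric] d_def[symmetric] D_def[symmetric] U_def[symmetric]
        L_def[symmetric]
    using ux[folded U_def] by (simp add: field_simps power2_eq_square)
qed

lemma ein_pos_conf_ln:
  fixes u :: "real ^ 'n::finite \<Rightarrow> real"
  assumes V: "open V" and x: "x \<in> V" and u: "smooth_on V u" and pos: "\<And>y. y \<in> V \<Longrightarrow> u y > 0" and q: "q > 0"
  shows "ein_pos k (conf (\<lambda>y. q * ln (u y))) x \<longleftrightarrow> (\<forall>v. v \<noteq> 0 \<longrightarrow> ein_op k q u x v > 0)"
proof -
  have c: "0 < q / u x" using q pos[OF x] by simp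
  have "0 < v \<bullet> (EinM k (conf (\<lambda>y. q * ln (u y))) x *v v) \<longleftrightarrow> 0 < ein_op k q u x v" for v
    using EinM_conf_ln[OF V x u pos, where q=q and v=v and k=k] c by (metis mult_pos_pos zero_less_mult_pos)
  then show ?thesis unfolding ein_pos_def by blast
qed

lemma ein_pos_conf_exp:
  fixes f :: "real ^ 'n::finite \<Rightarrow> real"
  assumes V: "open V" and x: "x \<in> V" and f: "smooth_on V f" and q: "q > 0"
  shows "ein_pos k (conf f) x \<longleftrightarrow> (\<forall>v. v \<noteq> 0 \<longrightarrow> ein_op k q (\<lambda>y. exp (f y / q)) x v > 0)"
proof -
  have "(\<lambda>y. q * ln (exp (f y / q))) = f" using q by auto
  moreover have "smooth_on V (\<lambda>y. exp (f y / q))"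
    using q by (intro smooth_on_exp smooth_on_divide V f smooth_on_const) auto
  ultimately show ?thesis using ein_pos_conf_ln[OF V x, of "\<lambda>y. exp (f y / q)" q k] q by simp
qed

text \<open>Positivity of \<open>ein_op\<close> survives adding the functions exp(f/q) and exp(g/q),
  and q times the logarithm turns the sum back into an exponent. Used in the middle of the neck,
  where both ends contribute in full.\<close>

lemma ein_pos_superpose:
  fixes f g :: "real ^ 'n::finite \<Rightarrow> real"
  assumes V: "open V" and x: "x \<in> V" and f: "smooth_on V f" and g: "smooth_on V g"
    and q: "q > 0" "\<And>v a :: real ^ 'n. ein_quad k q v a \<le> 0"
    and pos: "ein_pos k (conf f) x" "ein_pos k (conf g) x"
  shows "ein_pos k (conf (\<lambda>y. q * ln (exp (f y / q) + exp (g y / q)))) x"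
proof -
  have s: "smooth_on V (\<lambda>y. exp (f y / q))" "smooth_on V (\<lambda>y. exp (g y / q))"
    using q by (intro smooth_on_exp smooth_on_divide V f g smooth_on_const; simp)+
  have "ein_op k q (\<lambda>y. exp (f y / q) + exp (g y / q)) x v > 0" if "v \<noteq> 0" for v
    using ein_op_superadditive[OF V x s _ _ q(2), of v] pos that
    unfolding ein_pos_conf_exp[OF V x f q(1)] ein_pos_conf_exp[OF V x g q(1)] by fastforce
  then show ?thesis
    by (subst ein_pos_conf_ln[OF V x]) (auto intro!: smooth_on_add V s q add_pos_pos)
qed

section \<open>Cutoff functions\<close>

text \<open>The power of 1/t makes the span of the family closed under differentiation, which the
  single function exp(-1/t) is not.\<close>

definition flat_exp :: "nat \<Rightarrow> real \<Rightarrow> real" where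
  "flat_exp m t = (if t > 0 then inverse t ^ m * exp (- inverse t) else 0)"

text \<open>A bound quadratic in t forces the derivative 0 at t = 0, for every m at once. With s =
  1/t it is the (m+2)-th power of x <= exp x at x = s/(m+2).\<close>

lemma flat_exp_le: "\<bar>flat_exp m t\<bar> \<le> real (m + 2) ^ (m + 2) * t\<^sup>2"
proof (cases "t > 0")
  case True
  define s where "s = inverse t"
  have s: "s > 0" using True by (simp add: s_def)
  have "s / real (m + 2) \<le> exp (s / real (m + 2))"
    using exp_ge_add_one_self[of "s / real (m + 2)"] by linarith
  then have "(s / real (m + 2)) ^ (m + 2) \<le> exp (s / real (m + 2)) ^ (m + 2)"
    using s by (intro power_mono) auto
  also have "\<dots> = exp s" by (simp only: exp_of_nat_mult[symmetric]) simp
  finally have "s ^ (m + 2) \<le> real (m + 2) ^ (m + 2) * exp s"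
    by (simp add: power_divide divide_le_eq mult.commute)
  then have "s ^ m * s\<^sup>2 * exp (- s) \<le> real (m + 2) ^ (m + 2)"
    by (simp add: exp_minus divide_simps power_add power2_eq_square mult_ac)
  moreover have "s\<^sup>2 * t\<^sup>2 = 1" using True by (simp add: s_def power_mult_distrib[symmetric])
  ultimately have "s ^ m * exp (- s) * (s\<^sup>2 * t\<^sup>2) \<le> real (m + 2) ^ (m + 2) * t\<^sup>2"
    using mult_right_mono[of "s ^ m * s\<^sup>2 * exp (- s)" "real (m + 2) ^ (m + 2)" "t\<^sup>2"] by (simp add: mult_ac)
  then show ?thesis using True \<open>s\<^sup>2 * t\<^sup>2 = 1\<close> s unfolding flat_exp_def s_def by simp
qed (simp add: flat_exp_def)

lemma flat_exp_deriv:
  "(flat_exp m has_real_derivative flat_exp (m + 2) t - real m * flat_exp (m + 1) t) (at t)"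
proof -
  consider "t > 0" | "t < 0" | "t = 0" by linarith
  then show ?thesis
  proof cases
    case 1
    have "((\<lambda>t. inverse t ^ m * exp (- inverse t)) has_real_derivative flat_exp (m + 2) t - real m *
        flat_exp (m + 1) t) (at t)"
    proof -
      have p: "((\<lambda>t. inverse t ^ m) has_real_derivative real m * (- (inverse t * inverse t) * inverse t
          ^ (m - Suc 0))) (at t)"
        using 1 by (intro DERIV_power) (auto intro!: derivative_eq_intros)
      have e: "((\<lambda>t. exp (- inverse t)) has_real_derivative exp (- inverse t) * (inverse t * inverse t)) (at t)"
        using 1 by (auto intro!: derivative_eq_intros)
      show ?thesis
        by (rule DERIV_cong[OF DERIV_mult[OF p e]])
          (use 1 in \<open>cases m; simp add: flat_exp_def algebra_simps\<close>)
    qed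
    then show ?thesis
      by (rule has_field_derivative_transform_within_open[of _ _ _ "{0<..}"])
          (use 1 in \<open>auto simp: flat_exp_def\<close>)
  next
    case 2
    have "((\<lambda>t. 0) has_real_derivative flat_exp (m + 2) t - real m * flat_exp (m + 1) t) (at t)"
      using 2 by (simp add: flat_exp_def)
    then show ?thesis
      by (rule has_field_derivative_transform_within_open[of _ _ _ "{..<0}"])
          (use 2 in \<open>auto simp: flat_exp_def\<close>)
  next
    case 3
    have "(flat_exp m has_real_derivative 0) (at 0)"
      unfolding has_field_derivative_iff
    proof (rule Lim_null_comparison)
      show "\<forall>\<^sub>F h in at 0. norm ((flat_exp m h - flat_exp m 0) / (h - 0)) \<le> real (m + 2) ^ (m + 2) * \<bar>h\<bar>"
      proof (rule eventuallyI)
        fix h :: real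
        show "norm ((flat_exp m h - flat_exp m 0) / (h - 0)) \<le> real (m + 2) ^ (m + 2) * \<bar>h\<bar>"
          using flat_exp_le[of m h] 
          by (cases "h = 0") (auto simp: flat_exp_def[of m 0] divide_le_eq abs_mult power2_eq_square mult_ac)
      qed
      show "((\<lambda>h. real (m + 2) ^ (m + 2) * \<bar>h\<bar>) \<longlongrightarrow> 0) (at 0)"
        by (auto intro!: tendsto_eq_intros)
    qed
    then show ?thesis using 3 by (simp add: flat_exp_def)
  qed
qed

lemma smooth_on_flat_exp: "smooth_on UNIV (flat_exp m)"
proof -
  have "Ck_on k UNIV (flat_exp m)" for k
  proof (induction k arbitrary: m)
    case 0
    show ?case by (simp add: continuous_at_imp_continuous_on DERIV_isCont[OF flat_exp_deriv])
  next
    case (Suc k)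
    have "Ck_on k UNIV (\<lambda>t. v * flat_exp (m + 2) t + (- v * real m) * flat_exp (m + 1) t)" for v
      by (intro Ck_on_add Ck_on_bilinear[OF _ bounded_bilinear_mult] Suc) auto
    then show ?case
      by (intro Ck_on_Suc_intro[of _ _ "\<lambda>v t. v * flat_exp (m + 2) t + (- v * real m) * flat_exp (m + 1) t"])
        (auto intro!: has_derivative_eq_rhs[OF flat_exp_deriv[unfolded has_field_derivative_def]] simp:
            fun_eq_iff algebra_simps)
  qed
  then show ?thesis by (simp add: smooth_on_def)
qed

text \<open>A smooth monotone transition from 0 (for t <= 0) to 1 (for t >= 1); the denominator is
  positive because t or 1 - t is.\<close>

definition step :: "real \<Rightarrow> real" where
  "step t = flat_exp 0 t / (flat_exp 0 t + flat_exp 0 (1 - t))"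

lemma flat_exp_0: "flat_exp 0 t \<ge> 0" "flat_exp 0 t + flat_exp 0 (1 - t) > 0"
  by (auto simp: flat_exp_def add_pos_nonneg)

lemma step_0: "t \<le> 0 \<Longrightarrow> step t = 0" and step_1: "t \<ge> 1 \<Longrightarrow> step t = 1"
  and step_ge: "step t \<ge> 0" and step_le: "step t \<le> 1"
  using flat_exp_0[of t] flat_exp_0[of "1 - t"] by (auto simp: step_def flat_exp_def divide_le_eq)

text \<open>Monotonicity in differential form, for interpolations whose derivative must keep its
  sign.\<close>

lemma step_deriv: "\<exists>d\<ge>0. (step has_real_derivative d) (at t)"
proof -
  have d: "(flat_exp 0 has_real_derivative flat_exp 2 t) (at t)" for t
    using flat_exp_deriv[of 0] by (simp add: numeral_2_eq_2)
  have d': "((\<lambda>t. flat_exp 0 (1 - t)) has_real_derivative - flat_exp 2 (1 - t)) (at t)"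
  proof -
    have "((\<lambda>t. 1 - t) has_real_derivative - 1) (at t)" by (auto intro!: derivative_eq_intros)
    from DERIV_chain2[OF d this] show ?thesis by simp
  qed
  have nn: "flat_exp m t \<ge> 0" for m t by (simp add: flat_exp_def)
  have "(step has_real_derivative (flat_exp 2 t * (flat_exp 0 t + flat_exp 0 (1 - t)) - flat_exp 0 t *
      (flat_exp 2 t + - flat_exp 2 (1 - t)))
      / ((flat_exp 0 t + flat_exp 0 (1 - t)) * (flat_exp 0 t + flat_exp 0 (1 - t)))) (at t)"
    unfolding step_def[abs_def] using flat_exp_0(2)[of t]
    by (intro DERIV_divide DERIV_add d d') auto
  moreover have "flat_exp 2 t * (flat_exp 0 t + flat_exp 0 (1 - t)) - flat_exp 0 t * (flat_exp 2 t + -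
      flat_exp 2 (1 - t)) \<ge> 0"
    using nn by (simp add: algebra_simps)
  ultimately show ?thesis by (intro exI[of _ "_ / _"] conjI) auto
qed

lemma smooth_on_step: "smooth_on UNIV step"
proof -
  have "smooth_on UNIV (\<lambda>t. flat_exp 0 (1 - t))"
    by (rule smooth_on_compose[OF _ _ _ _ smooth_on_flat_exp]) (auto intro!: smooth_on_diff)
  then show ?thesis unfolding step_def[abs_def] using flat_exp_0(2)
    by (intro smooth_on_divide smooth_on_add smooth_on_flat_exp) (auto simp: less_imp_neq[symmetric])
qed

lemma smooth_on_step_compose: "open S \<Longrightarrow> smooth_on S f \<Longrightarrow> smooth_on S (\<lambda>x. step (f x))"
  by (rule smooth_on_compose[OF _ _ _ _ smooth_on_step]) auto

lemma smooth_bump: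
  assumes "0 < a" "a < b"
  shows "\<exists>\<eta>. smooth_on (UNIV :: 'a::euclidean_space set) \<eta> \<and> (\<forall>z. 0 \<le> \<eta> z \<and> \<eta> z \<le> (1::real)) \<and>
     (\<forall>z. norm z \<le> a \<longrightarrow> \<eta> z = 1) \<and> (\<forall>z. norm z \<ge> b \<longrightarrow> \<eta> z = 0)"
proof -
  \<comment> \<open>The squared norm, unlike the norm, is smooth at the origin.\<close>
  define \<eta> :: "'a \<Rightarrow> real" where "\<eta> z = 1 - step ((z \<bullet> z - a\<^sup>2) / (b\<^sup>2 - a\<^sup>2))" for z
  have ab: "b\<^sup>2 - a\<^sup>2 > 0" using assms by (simp add: power_strict_mono)
  have "smooth_on UNIV \<eta>" unfolding \<eta>_def[abs_def] using ab
    by (intro smooth_on_diff smooth_on_step_compose smooth_on_divide smooth_on_inner) auto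
  moreover have "\<eta> z = 1" if "norm z \<le> a" for z
    using that ab power_mono[OF that, of 2] unfolding \<eta>_def by (subst step_0) (auto simp:
        dot_square_norm divide_le_0_iff)
  moreover have "\<eta> z = 0" if "norm z \<ge> b" for z
    using that ab power_mono[OF that, of 2] assms unfolding \<eta>_def by (subst step_1) (auto simp: dot_square_norm)
  moreover have "0 \<le> \<eta> z \<and> \<eta> z \<le> 1" for z using step_ge step_le by (simp add: \<eta>_def)
  ultimately show ?thesis by (intro exI[of _ \<eta>]) auto
qed

text \<open>The derivative is continuous and vanishes outside the compact interval [0,1].\<close>

lemma step_deriv_bounded: "\<exists>B>0. \<forall>t v. \<bar>dderiv step v t\<bar> \<le> B * \<bar>v\<bar>"
proof -
  have diff: "step differentiable (at t)" for t by (rule smooth_on_differentiable[OF smooth_on_step]) simp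
  have lin: "dderiv step v t = v * dderiv step 1 t" for v t
    using dderiv_scale_dir[OF diff, where r=v and u=1] by simp
  have "continuous_on {0..1} (dderiv step 1)"
    using smooth_on_continuous[OF smooth_on_dderiv[OF smooth_on_step]] continuous_on_subset by blast
  then have "bounded (dderiv step 1 ` {0..1})" by (intro compact_imp_bounded compact_continuous_image) auto
  then obtain B where B: "B > 0" "\<And>t. t \<in> {0..1} \<Longrightarrow> \<bar>dderiv step 1 t\<bar> \<le> B"
    unfolding bounded_pos by auto
  have "\<bar>dderiv step 1 t\<bar> \<le> B" for t
  proof -
    have "dderiv step 1 t = dderiv (\<lambda>_. 0) 1 t" if "t < 0"
      by (rule dderiv_cong[of "{..<0}"]) (use that step_0 in auto)
    moreover have "dderiv step 1 t = dderiv (\<lambda>_. 1) 1 t" if "t > 1"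
      by (rule dderiv_cong[of "{1<..}"]) (use that step_1 in auto)
    ultimately show ?thesis using B by (cases "t < 0"; cases "t > 1") auto
  qed
  then have *: "\<bar>dderiv step 1 t\<bar> \<le> B" for t .
  have "\<bar>dderiv step v t\<bar> \<le> B * \<bar>v\<bar>" for t v
  proof -
    have "\<bar>dderiv step v t\<bar> = \<bar>v * dderiv step 1 t\<bar>" by (rule arg_cong[OF lin])
    also have "\<dots> = \<bar>v\<bar> * \<bar>dderiv step 1 t\<bar>" by (rule abs_mult)
    also have "\<dots> \<le> \<bar>v\<bar> * B" by (intro mult_left_mono *) simp
    finally show ?thesis by (simp add: mult.commute)
  qed
  then show ?thesis using B(1) by blast
qed

text \<open>Cutting off on a logarithmic scale makes \<open>\<bar>z\<bar> \<bar>d\<eta>\<bar>\<close> as small as we like.\<close>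

lemma slow_bump:
  assumes \<kappa>: "\<kappa> > 0" and s: "s > 0"
  shows "\<exists>(\<eta> :: 'a::euclidean_space \<Rightarrow> real) r. 0 < r \<and> r < s \<and> smooth_on UNIV \<eta> \<and> (\<forall>z. 0 \<le> \<eta> z \<and> \<eta> z \<le> 1) \<and>
     (\<forall>z. norm z \<le> r \<longrightarrow> \<eta> z = 1) \<and> (\<forall>z. norm z \<ge> s \<longrightarrow> \<eta> z = 0) \<and>
     (\<forall>z v. \<bar>dderiv \<eta> v z\<bar> * norm z \<le> \<kappa> * norm v)"
proof -
  obtain B where B: "B > 0" "\<And>t v. \<bar>dderiv step v t\<bar> \<le> B * \<bar>v\<bar>" using step_deriv_bounded by blast
  \<comment> \<open>The logarithm contributes |df(v)| |z| <= 2 c |v| and \<open>step\<close> a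
    factor B; together they give \<kappa>.\<close>
  define c where "c = \<kappa> / (2 * B)"
  have c: "c > 0" using \<kappa> B by (simp add: c_def)
  \<comment> \<open>The radius at which f = 1 + 2 c ln(|z|/s) vanishes; at |z| = s the value of f is
    1.\<close>
  define r where "r = s * exp (- 1 / (2 * c))"
  have r: "0 < r" "r < s" using s c by (auto simp: r_def)
  define f :: "'a \<Rightarrow> real" where "f z = 1 + c * ln (z \<bullet> z / s\<^sup>2)" for z
  \<comment> \<open>The origin is treated apart because of the logarithm; the result is constantly 1
    near it.\<close>
  define \<eta> :: "'a \<Rightarrow> real" where "\<eta> z = (if z = 0 then 1 else 1 - step (f z))" for z
  have fs: "smooth_on (- {0}) f" unfolding f_def[abs_def] using s
    by (intro smooth_on_add smooth_on_mult smooth_on_ln smooth_on_divide smooth_on_inner smooth_on_const) auto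
  have out: "smooth_on (- {0}) \<eta>"
    by (rule smooth_on_cong[of _ "\<lambda>z. 1 - step (f z)"]) (auto simp: \<eta>_def intro!: smooth_on_diff
        smooth_on_step_compose fs)
  have f0: "f z \<le> 0" if "norm z \<le> r" "z \<noteq> 0" for z
  proof -
    have "(norm z)\<^sup>2 \<le> r\<^sup>2" using that by (intro power_mono) auto
    also have "r\<^sup>2 = s\<^sup>2 * exp (- 1 / c)"
      by (simp add: r_def power_mult_distrib flip: exp_double)
    finally have "z \<bullet> z / s\<^sup>2 \<le> exp (- 1 / c)" using s by (simp add: dot_square_norm divide_le_eq mult.commute)
    then have "ln (z \<bullet> z / s\<^sup>2) \<le> - 1 / c" using that s
      by (metis divide_pos_pos inner_gt_zero_iff ln_exp ln_le_cancel_iff exp_gt_zero zero_less_power)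
    then show ?thesis using c by (simp add: f_def field_simps)
  qed
  have in1: "\<eta> z = 1" if "norm z \<le> r" for z using f0[OF that] step_0 by (simp add: \<eta>_def)
  have "smooth_on (ball 0 r) \<eta>"
    by (rule smooth_on_cong[of _ "\<lambda>z. 1"]) (auto simp: in1)
  then have "smooth_on (ball 0 r \<union> - {0}) \<eta>"
    by (intro smooth_on_Un_open out) auto
  moreover have "ball 0 r \<union> - {0} = (UNIV :: 'a set)" using r by auto
  ultimately have sm: "smooth_on UNIV \<eta>" by simp
  have out0: "\<eta> z = 0" if "norm z \<ge> s" for z
  proof -
    have "z \<noteq> 0" using that s by auto
    have "z \<bullet> z / s\<^sup>2 \<ge> 1" using that s power_mono[OF that, of 2] by (simp add: dot_square_norm)
    then have "f z \<ge> 1" using c by (simp add: f_def)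
    then show ?thesis using step_1 \<open>z \<noteq> 0\<close> by (simp add: \<eta>_def)
  qed
  have "\<bar>dderiv \<eta> v z\<bar> * norm z \<le> \<kappa> * norm v" for z v
  proof (cases "z = 0")
    case False
    have df: "dderiv f v z = c * (2 * (z \<bullet> v) / (z \<bullet> z))"
      unfolding f_def[abs_def]
      by (rule dderiv_eq) (use False s in \<open>auto intro!: derivative_eq_intros simp: field_simps inner_commute\<close>)
    have "dderiv \<eta> v z = dderiv (\<lambda>z. 1 - step (f z)) v z"
      by (rule dderiv_cong[of "- {0}"]) (use False in \<open>auto simp: \<eta>_def\<close>)
    also have "\<dots> = - dderiv (\<lambda>z. step (f z)) v z"
      using smooth_on_differentiable[OF smooth_on_step_compose[OF _ fs], of z] False
      by (intro dderiv_eq) (auto intro!: derivative_eq_intros has_derivative_dderiv)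
    also have "dderiv (\<lambda>z. step (f z)) v z = dderiv step (dderiv f v z) (f z)"
      using smooth_on_differentiable[OF fs, of z] False smooth_on_differentiable[OF smooth_on_step]
      by (intro dderiv_compose) auto
    finally have "\<bar>dderiv \<eta> v z\<bar> \<le> B * \<bar>dderiv f v z\<bar>" using B(2) by simp
    also have "\<dots> \<le> B * (c * (2 * norm v / norm z))"
    proof (intro mult_left_mono)
      have "\<bar>z \<bullet> v\<bar> / (norm z * norm z) \<le> norm z * norm v / (norm z * norm z)"
        by (intro divide_right_mono Cauchy_Schwarz_ineq2) auto
      then have h: "\<bar>z \<bullet> v\<bar> / (z \<bullet> z) \<le> norm v / norm z"
        using False by (simp add: dot_square_norm power2_eq_square)
      have "\<bar>dderiv f v z\<bar> = 2 * c * (\<bar>z \<bullet> v\<bar> / (z \<bullet> z))"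
        unfolding df using c by (simp add: abs_mult)
      also have "\<dots> \<le> 2 * c * (norm v / norm z)" using c by (intro mult_left_mono h) auto
      finally show "\<bar>dderiv f v z\<bar> \<le> c * (2 * norm v / norm z)" by (simp add: mult_ac)
    qed (use B in auto)
    finally have "\<bar>dderiv \<eta> v z\<bar> * norm z \<le> B * (c * (2 * norm v / norm z)) * norm z"
      by (rule mult_right_mono) simp
    also have "\<dots> = \<kappa> * norm v" using False B by (simp add: c_def)
    finally show ?thesis .
  qed (use \<kappa> in simp)
  moreover have "0 \<le> \<eta> z \<and> \<eta> z \<le> 1" for z using step_ge step_le by (simp add: \<eta>_def)
  ultimately show ?thesis using r sm in1 out0
    by (intro exI[of _ \<eta>] exI[of _ r]) auto
qed

section \<open>Straightening a diffeomorphism near a point\<close>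

definition outer :: "real ^ 'n::finite \<Rightarrow> real ^ 'n \<Rightarrow> real ^ 'n ^ 'n" where
  "outer a b = (\<chi> i j. a $ i * b $ j)"

lemma mult_outer: "A ** outer a b = outer (A *v a) b"
  by (simp add: outer_def matrix_matrix_mult_def matrix_vector_mult_def vec_eq_iff sum_distrib_right mult.assoc)

lemma outer_mult_outer: "outer a b ** outer c d = (b \<bullet> c) *\<^sub>R outer a d"
  by (simp add: outer_def matrix_matrix_mult_def inner_vec_def vec_eq_iff sum_distrib_left
      sum_distrib_right mult_ac)

lemma outer_mult_vec: "outer a b *v c = (b \<bullet> c) *\<^sub>R a"
  by (simp add: outer_def matrix_vector_mult_def inner_vec_def vec_eq_iff sum_distrib_left
      sum_distrib_right mult_ac)

lemma trace_outer: "trace (outer a b) = a \<bullet> b"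
  by (simp add: trace_def outer_def inner_vec_def)

lemma trace_scaleR: "trace (r *\<^sub>R A) = r * trace A" for A :: "real ^ 'n::finite ^ 'n"
  by (simp add: trace_def sum_distrib_left)

lemma trace_diff: "trace (A - B) = trace A - trace B" for A B :: "real ^ 'n::finite ^ 'n"
  by (simp add: trace_def sum_subtractf)

lemma matrix_diff_ldistrib: "A ** (B - C) = A ** B - A ** C" and matrix_diff_rdistrib: "(A - B) ** C
    = A ** C - B ** C"
  for A B C :: "real ^ 'n::finite ^ 'n"
  by (simp_all add: matrix_matrix_mult_def vec_eq_iff sum_subtractf algebra_simps)

text \<open>For a unit vector a this is the reflection in the hyperplane perpendicular to a. These
  are the competitors against which the maximal orthogonal matrix is compared.\<close>

definition reflection :: "real ^ 'n::finite \<Rightarrow> real ^ 'n ^ 'n" where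
  "reflection a = mat 1 - 2 *\<^sub>R outer a a"

lemma orthogonal_reflection:
  assumes "norm a = 1" shows "orthogonal_matrix (reflection a)"
proof -
  have t: "transpose (reflection a) = reflection a"
    by (simp add: reflection_def transpose_def outer_def mat_def vec_eq_iff mult.commute)
  have "a \<bullet> a = 1" using assms by (simp add: dot_square_norm)
  then have "reflection a ** reflection a = mat 1"
    by (simp add: reflection_def matrix_diff_ldistrib matrix_diff_rdistrib outer_mult_outer
        scaleR_matrix_mult vec_eq_iff)
  then show ?thesis unfolding orthogonal_matrix by (simp add: t)
qed

text \<open>The \<open>norm\<close> of a matrix is the Frobenius norm here, so Cauchy-Schwarz
  applies row by row.\<close>

lemma norm_matrix_vector_le: "norm (M *v v) \<le> norm M * norm v" for M :: "real ^ 'n::finite ^ 'm::finite"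
proof -
  have "norm (M *v v) = L2_set (\<lambda>i. \<bar>M $ i \<bullet> v\<bar>) UNIV"
    by (simp add: norm_vec_def matrix_vector_mult_def inner_vec_def)
  also have "\<dots> \<le> L2_set (\<lambda>i. norm (M $ i) * norm v) UNIV"
    by (intro L2_set_mono Cauchy_Schwarz_ineq2) auto
  also have "\<dots> = norm M * norm v"
    by (simp add: L2_set_left_distrib norm_vec_def[of M])
  finally show ?thesis .
qed

text \<open>Orthogonality is a closed equation, and unit rows bound the Frobenius norm by the square
  root of n.\<close>

lemma compact_orthogonal: "compact {R :: real ^ 'n::finite ^ 'n. orthogonal_matrix R}"
proof (rule compact_eq_bounded_closed[THEN iffD2], intro conjI)
  have "norm R \<le> sqrt CARD('n)" if "orthogonal_matrix R" for R :: "real ^ 'n ^ 'n"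
  proof -
    have "R ** transpose R = mat 1" using that by (simp add: orthogonal_matrix_def)
    then have "(R ** transpose R) $ i $ i = 1" for i by (simp add: mat_def)
    then have "norm (R $ i) = 1" for i
      by (simp add: norm_eq_sqrt_inner inner_vec_def matrix_matrix_mult_def transpose_def)
    then show ?thesis by (simp add: norm_vec_def[of R] L2_set_def)
  qed
  then show "bounded {R :: real ^ 'n ^ 'n. orthogonal_matrix R}"
    by (intro boundedI) auto
  have m: "continuous_on UNIV (\<lambda>R :: real ^ 'n ^ 'n. transpose R ** R)"
    by (rule smooth_on_continuous) (intro smooth_on_matrix_mult smooth_on_transpose smooth_on_id open_UNIV)
  have "{R :: real ^ 'n ^ 'n. orthogonal_matrix R} = (\<lambda>R. transpose R ** R) -` {mat 1}"
    unfolding orthogonal_matrix by auto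
  then show "closed {R :: real ^ 'n ^ 'n. orthogonal_matrix R}"
    using continuous_closed_vimage[of "{mat 1}" "\<lambda>R :: real ^ 'n ^ 'n. transpose R ** R"] m
    by (simp add: continuous_on_eq_continuous_at)
qed

text \<open>A weak form of the polar decomposition: the orthogonal matrix maximising \<open>tr (L R)\<close> makes
  \<open>L R\<close> positive. Comparing with one reflection gives semidefiniteness, with two reflections
  definiteness.\<close>

lemma orthogonal_positive:
  fixes L :: "real ^ 'n::finite ^ 'n"
  assumes "invertible L"
  shows "\<exists>R. orthogonal_matrix R \<and> (\<forall>v. v \<noteq> 0 \<longrightarrow> v \<bullet> ((L ** R) *v v) > 0)"
proof -
  let ?O = "{R :: real ^ 'n ^ 'n. orthogonal_matrix R}"
  have "orthogonal_matrix (mat 1 :: real ^ 'n ^ 'n)" by (rule orthogonal_matrix_id)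
  moreover have "continuous_on UNIV (\<lambda>R. trace (L ** R))"
    unfolding trace_def
    by (rule smooth_on_continuous, intro smooth_on_sum smooth_on_vec_nth smooth_on_matrix_mult
        smooth_on_id smooth_on_const open_UNIV)
  then have "continuous_on ?O (\<lambda>R. trace (L ** R))" by (rule continuous_on_subset) simp
  ultimately obtain R where R: "orthogonal_matrix R" "\<And>S. orthogonal_matrix S \<Longrightarrow> trace (L ** S) \<le> trace (L ** R)"
    using continuous_attains_sup[OF compact_orthogonal, of "\<lambda>R. trace (L ** R)"] by auto
  define A where "A = L ** R"
  have max: "trace (A ** S) \<le> trace A" if "orthogonal_matrix S" for S
    unfolding A_def matrix_mul_assoc[symmetric] by (rule R(2)[OF orthogonal_matrix_mul[OF R(1) that]])
  have one: "B ** reflection a = B - 2 *\<^sub>R outer (B *v a) a" for a and B :: "real ^ 'n ^ 'n"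
    by (simp add: reflection_def matrix_diff_ldistrib scaleR_matrix_mult mult_outer)
  have tr: "trace (B ** reflection a) = trace B - 2 * (a \<bullet> (B *v a))" for a and B :: "real ^ 'n ^ 'n"
    unfolding one by (simp add: trace_diff trace_scaleR trace_outer inner_commute)
  then have unit: "a \<bullet> (A *v a) \<ge> 0" if "norm a = 1" for a
    using max[OF orthogonal_reflection[OF that]] by simp
  have nn: "a \<bullet> (A *v a) \<ge> 0" for a
  proof (cases "a = 0")
    case False
    have "a \<bullet> (A *v a) = (norm a)\<^sup>2 * (sgn a \<bullet> (A *v sgn a))"
      using False by (simp add: sgn_div_norm matrix_vector_mult_scaleR power2_eq_square) (simp add: field_simps)
    then show ?thesis using unit[of "sgn a"] False by (simp add: norm_sgn)
  qed simp
  \<comment> \<open>Two reflections also see the antisymmetric part of A, through b . A a in the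
    last term; a single one sees only the symmetric part.\<close>
  have "trace (A ** reflection a ** reflection b) = trace A - 2 * (a \<bullet> (A *v a)) - 2 * (b \<bullet> (A *v b)) +
      4 * (a \<bullet> b) * (b \<bullet> (A *v a))" for a b
  proof -
    have "(A ** reflection a) *v b = A *v b - (2 * (a \<bullet> b)) *\<^sub>R (A *v a)"
      unfolding one by (simp add: matrix_vector_mult_diff_rdistrib scaleR_matrix_vector_assoc[symmetric]
          outer_mult_vec)
    then show ?thesis unfolding tr by (simp add: inner_diff_right)
  qed
  then have two_unit: "2 * (a \<bullet> b) * (b \<bullet> (A *v a)) \<le> a \<bullet> (A *v a) + b \<bullet> (A *v b)" if "norm a = 1"
      "norm b = 1" for a b
    using max[OF orthogonal_matrix_mul[OF orthogonal_reflection[OF that(1)] orthogonal_reflection[OF that(2)]]]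
    by (simp add: matrix_mul_assoc)
  \<comment> \<open>Homogeneity in a removes its normalisation; the vector to which this is applied
    later is not a unit vector.\<close>
  have two: "2 * (a \<bullet> b) * (b \<bullet> (A *v a)) \<le> a \<bullet> (A *v a) + (norm a)\<^sup>2 * (b \<bullet> (A *v b))" if "norm b = 1" for a b
  proof (cases "a = 0")
    case False
    have e: "a \<bullet> c = norm a * (sgn a \<bullet> c)" "c \<bullet> (A *v a) = norm a * (c \<bullet> (A *v sgn a))" for c
      using False by (simp_all add: sgn_div_norm matrix_vector_mult_scaleR)
    have "2 * (a \<bullet> b) * (b \<bullet> (A *v a)) = (norm a)\<^sup>2 * (2 * (sgn a \<bullet> b) * (b \<bullet> (A *v sgn a)))"
      unfolding e(1)[of b] e(2)[of b] by (simp add: power2_eq_square)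
    also have "\<dots> \<le> (norm a)\<^sup>2 * (sgn a \<bullet> (A *v sgn a) + b \<bullet> (A *v b))"
      using False by (intro mult_left_mono two_unit that) (auto simp: norm_sgn)
    also have "\<dots> = a \<bullet> (A *v a) + (norm a)\<^sup>2 * (b \<bullet> (A *v b))"
      unfolding e(1)[of "A *v a"] e(2)[of "sgn a"] by (simp add: power2_eq_square algebra_simps)
    finally show ?thesis .
  qed simp
  have invA: "invertible A" unfolding A_def
    using assms R(1) by (intro invertible_mult) (auto simp: orthogonal_matrix_def invertible_def)
  have unit_pos: "v \<bullet> (A *v v) > 0" if v: "norm v = 1" for v
  proof (rule ccontr)
    assume "\<not> ?thesis"
    then have 0: "v \<bullet> (A *v v) = 0" using nn[of v] by simp
    define w where "w = A *v v"
    have w: "w \<noteq> 0" using invertible_mult_cancel[OF invA, of v 0] v by (auto simp: w_def)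
    have vw: "v \<bullet> w = 0" using 0 by (simp add: w_def)
    \<comment> \<open>The form a . A a is nonnegative and vanishes at v, so its derivative v . A w +
      w . A v in direction w vanishes there, and A v = w.\<close>
    have anti: "v \<bullet> (A *v w) = - (w \<bullet> w)"
    proof -
      define p where "p = v \<bullet> (A *v w) + w \<bullet> w"
      have "0 \<le> t * (p + t * (w \<bullet> (A *v w)))" for t
        using nn[of "v + t *\<^sub>R w"] vw
        by (simp add: p_def matrix_vector_right_distrib matrix_vector_mult_scaleR inner_add_left inner_add_right
           flip: w_def) (simp add: algebra_simps)
      then have q: "0 \<le> s * (s * (w \<bullet> (A *v w)) + p)" for s by (simp add: add.commute)
      define c where "c = w \<bullet> (A *v w) + 1"
      have c: "c > 0" using nn[of w] by (simp add: c_def)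
      \<comment> \<open>At s = -p/c with c = w . A w + 1 the polynomial takes the value -p^2/c^2,
        which forces p = 0.\<close>
      have "0 \<le> (- p / c) * ((- p / c) * (w \<bullet> (A *v w)) + p)" by (rule q)
      also have "\<dots> = - (p\<^sup>2 / c\<^sup>2)" using c by (simp add: c_def field_simps power2_eq_square)
      finally have "p = 0" using c by (simp add: divide_le_0_iff)
      then show ?thesis by (simp add: p_def)
    qed
    \<comment> \<open>With a = v - t w and b = v, \<open>two\<close> reads 2 t (w . w) <= t^2 (w . A
      w), while this t makes the right side at most t (w . w). The summand 1 keeps the denominator
      positive.\<close>
    define t where "t = (w \<bullet> w) / (w \<bullet> (A *v w) + 1)"
    have ww: "w \<bullet> w > 0" using w by simp
    have t: "t > 0" "t * (w \<bullet> (A *v w)) \<le> w \<bullet> w"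
      using ww nn[of w] by (auto simp: t_def divide_simps intro!: add_nonneg_pos)
    have "2 * t * (w \<bullet> w) \<le> t * (t * (w \<bullet> (A *v w)))"
      using two[OF v, of "v - t *\<^sub>R w"] anti vw v
      by (simp add: matrix_vector_mult_diff_distrib matrix_vector_mult_scaleR inner_diff_left inner_diff_right
         inner_commute[of w v] dot_square_norm[of v] flip: w_def)
        (simp add: algebra_simps)
    also have "\<dots> \<le> t * (w \<bullet> w)" using t by (intro mult_left_mono) auto
    finally show False using t(1) ww by simp
  qed
  have "v \<bullet> (A *v v) > 0" if "v \<noteq> 0" for v
  proof -
    have "v \<bullet> (A *v v) = (norm v)\<^sup>2 * (sgn v \<bullet> (A *v sgn v))"
      using that by (simp add: sgn_div_norm matrix_vector_mult_scaleR power2_eq_square) (simp add: field_simps)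
    then show ?thesis using unit_pos[of "sgn v"] that by (simp add: norm_sgn)
  qed
  then show ?thesis using R(1) unfolding A_def by blast
qed

lemma invertible_ker:
  fixes M :: "real ^ 'n::finite ^ 'n"
  assumes "\<And>v. M *v v = 0 \<Longrightarrow> v = 0" shows "invertible M"
  using assms matrix_left_invertible_ker[of M] invertible_left_inverse by blast

text \<open>On the segment from x to y the function w . G with w = y - x is strictly increasing, so
  G x and G y differ. A nonzero kernel vector v of the Jacobian would give v . dG(v) = 0.\<close>

lemma monotone_inj:
  fixes G :: "real ^ 'n::finite \<Rightarrow> real ^ 'n"
  assumes G: "smooth_on UNIV G" and mono: "\<And>z v. v \<noteq> 0 \<Longrightarrow> v \<bullet> dderiv G v z > 0"
  shows "inj G" "invertible (jac G z)"
proof -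
  have d: "G differentiable (at z)" for z using smooth_on_differentiable[OF G] by simp
  show "invertible (jac G z)"
    by (rule invertible_ker) (metis d inner_zero_right jac_works less_irrefl mono)
  show "inj G"
  proof (rule injI, rule ccontr)
    fix x y assume e: "G x = G y" and "x \<noteq> y"
    define w where "w = y - x"
    have w: "w \<noteq> 0" using \<open>x \<noteq> y\<close> by (simp add: w_def)
    have "((\<lambda>t. w \<bullet> G (x + t *\<^sub>R w)) has_real_derivative w \<bullet> dderiv G w (x + t *\<^sub>R w)) (at t)" for t
    proof -
      have "((\<lambda>t. x + t *\<^sub>R w) has_derivative (\<lambda>e. e *\<^sub>R w)) (at t)"
        by (auto intro!: derivative_eq_intros)
      from has_derivative_compose[OF this has_derivative_dderiv[OF d]]
      have "((\<lambda>t. G (x + t *\<^sub>R w)) has_derivative (\<lambda>e. dderiv G (e *\<^sub>R w) (x + t *\<^sub>R w))) (at t)" .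
      from bounded_linear.has_derivative[OF bounded_linear_inner_right this, of w]
      show ?thesis unfolding has_field_derivative_def
        by (rule has_derivative_eq_rhs) (auto simp: dderiv_scale_dir[OF d])
    qed
    then have "\<exists>y. ((\<lambda>t. w \<bullet> G (x + t *\<^sub>R w)) has_real_derivative y) (at t) \<and> y > 0" for t
      using mono[OF w] by blast
    then have "w \<bullet> G (x + 0 *\<^sub>R w) < w \<bullet> G (x + 1 *\<^sub>R w)"
      by (intro DERIV_pos_imp_increasing[of 0 1 "\<lambda>t. w \<bullet> G (x + t *\<^sub>R w)"]) simp_all
    then show False using e by (simp add: w_def)
  qed
qed

lemma jac_norm_bound:
  fixes \<phi> :: "real ^ 'n::finite \<Rightarrow> real ^ 'n"
  assumes s: "s > 0" and \<phi>: "smooth_on (ball 0 s) \<phi>" and e: "e > 0"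
  shows "\<exists>d. 0 < d \<and> d \<le> s \<and> (\<forall>z\<in>ball 0 d. norm (jac \<phi> z - jac \<phi> 0) < e)"
proof -
  have "continuous_on (ball 0 s) (jac \<phi>)"
    by (rule smooth_on_continuous[OF smooth_on_jac[OF _ \<phi>]]) simp
  then have "isCont (jac \<phi>) 0" using s continuous_on_eq_continuous_at by (metis centre_in_ball open_ball)
  then obtain d where "d > 0" "\<And>z. dist z 0 < d \<Longrightarrow> dist (jac \<phi> z) (jac \<phi> 0) < e"
    using e unfolding continuous_at_eps_delta by metis
  then show ?thesis using s by (intro exI[of _ "min d s"]) (auto simp: dist_norm)
qed

text \<open>The derivative of G = z + \<eta> (\<phi>(z) - z) is a convex combination of the identity
  and of d\<phi>, both positive, plus d\<eta> times \<phi>(z) - z. Since |\<phi>(z) - z| is at most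
  a constant times |z|, smallness of |z| |d\<eta>| keeps the last term below the others.\<close>

lemma straighten:
  fixes \<phi> :: "real ^ 'n::finite \<Rightarrow> real ^ 'n"
  assumes s: "s > 0" and \<phi>: "smooth_on (ball 0 s) \<phi>" and \<phi>0: "\<phi> 0 = 0"
    and A: "\<And>v. v \<noteq> 0 \<Longrightarrow> v \<bullet> (jac \<phi> 0 *v v) > 0"
  shows "\<exists>G \<sigma>. 0 < \<sigma> \<and> \<sigma> < s \<and> \<sigma> < 1/2 \<and> smooth_on UNIV G \<and> (\<forall>z. norm z < \<sigma> \<longrightarrow> G z = \<phi> z) \<and>
    (\<forall>z. norm z \<ge> 1/2 \<longrightarrow> G z = z) \<and> (\<forall>z. norm z < 1 \<longrightarrow> norm (G z) < 1) \<and> 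
    (\<forall>z v. v \<noteq> 0 \<longrightarrow> v \<bullet> dderiv G v z > 0)"
proof -
  let ?A = "jac \<phi> 0"
  have "continuous_on (sphere 0 1) (\<lambda>v. v \<bullet> (?A *v v))"
    by (intro continuous_intros matrix_vector_mult_linear_continuous_on)
  moreover have "sphere (0 :: real ^ 'n) 1 \<noteq> {}" by simp
  ultimately obtain v0 where v0: "v0 \<in> sphere 0 1" "\<And>v. v \<in> sphere 0 1 \<Longrightarrow> v0 \<bullet> (?A *v v0) \<le> v \<bullet> (?A *v v)"
    using continuous_attains_inf[OF compact_sphere] by blast
  define \<alpha> where "\<alpha> = v0 \<bullet> (?A *v v0)"
  have \<alpha>: "\<alpha> > 0" unfolding \<alpha>_def using v0 by (intro A) auto
  have \<alpha>le: "\<alpha> * (norm v)\<^sup>2 \<le> v \<bullet> (?A *v v)" for v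
  proof (cases "v = 0")
    case False
    have "v \<bullet> (?A *v v) = (norm v)\<^sup>2 * (sgn v \<bullet> (?A *v sgn v))"
      using False by (simp add: sgn_div_norm matrix_vector_mult_scaleR power2_eq_square) (simp add: field_simps)
    moreover have "\<alpha> \<le> sgn v \<bullet> (?A *v sgn v)" unfolding \<alpha>_def using False by (intro v0) (auto simp: norm_sgn)
    ultimately show ?thesis by (metis mult.commute mult_left_mono zero_le_power2)
  qed simp
  obtain d where d: "0 < d" "d \<le> s" "\<And>z. z \<in> ball 0 d \<Longrightarrow> norm (jac \<phi> z - ?A) < \<alpha> / 2"
    using jac_norm_bound[OF s \<phi>, of "\<alpha> / 2"] \<alpha> by auto
  have diff: "\<phi> differentiable (at z)" if "z \<in> ball 0 d" for z
    using smooth_on_differentiable[OF \<phi>] that d by auto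
  have low: "\<alpha> / 2 * (norm v)\<^sup>2 \<le> v \<bullet> dderiv \<phi> v z" if z: "z \<in> ball 0 d" for z v
  proof -
    have "\<bar>v \<bullet> ((jac \<phi> z - ?A) *v v)\<bar> \<le> norm v * norm ((jac \<phi> z - ?A) *v v)" by (rule Cauchy_Schwarz_ineq2)
    also have "\<dots> \<le> norm v * (norm (jac \<phi> z - ?A) * norm v)" by (intro mult_left_mono norm_matrix_vector_le) auto
    also have "\<dots> \<le> norm v * (\<alpha> / 2 * norm v)" using d(3)[OF z] by (intro mult_left_mono mult_right_mono) auto
    finally have "\<bar>v \<bullet> (jac \<phi> z *v v) - v \<bullet> (?A *v v)\<bar> \<le> \<alpha> / 2 * (norm v)\<^sup>2"
      by (simp add: matrix_vector_mult_diff_rdistrib inner_diff_right power2_eq_square mult_ac)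
    then show ?thesis using \<alpha>le[of v] unfolding jac_works[OF diff[OF z]] by linarith
  qed
  \<comment> \<open>A Lipschitz constant of \<phi> on the ball of radius d, where the Jacobian
    differs from its value at 0 by less than \<alpha>/2.\<close>
  define C where "C = norm ?A + \<alpha>"
  have C: "C > 0" using \<alpha> by (simp add: C_def add_nonneg_pos)
  have \<phi>le: "norm (\<phi> z) \<le> C * norm z" if z: "z \<in> ball 0 d" for z
  proof -
    have "norm (\<phi> z - \<phi> 0) \<le> C * norm (z - 0)"
    proof (rule differentiable_bound[of "ball 0 d" \<phi> "\<lambda>z v. dderiv \<phi> v z"])
      fix y :: "real ^ 'n" assume y: "y \<in> ball 0 d"
      show "(\<phi> has_derivative (\<lambda>v. dderiv \<phi> v y)) (at y within ball 0 d)"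
        by (rule has_derivative_at_withinI[OF has_derivative_dderiv[OF diff[OF y]]])
      show "onorm (\<lambda>v. dderiv \<phi> v y) \<le> C"
      proof (rule onorm_le)
        fix v
        have "norm (jac \<phi> y) \<le> norm ?A + norm (jac \<phi> y - ?A)"
            by (metis add.commute diff_add_cancel norm_triangle_ineq)
        then have "norm (jac \<phi> y) \<le> C" using d(3)[OF y] \<alpha> by (simp add: C_def)
        then show "norm (dderiv \<phi> v y) \<le> C * norm v"
          unfolding jac_works[OF diff[OF y], symmetric]
          by (meson norm_matrix_vector_le mult_right_mono norm_ge_zero order_trans)
      qed
    qed (use d z in auto)
    then show ?thesis by (simp add: \<phi>0)
  qed
  \<comment> \<open>The cutoff has to lie inside radius d and inside radius 1/2. The third bound
    gives |G z| <= (C + 1)|z| <= 1/2 where G is not the identity, so that the unit ball is mapped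
    into itself.\<close>
  define s0 where "s0 = min (d / 2) (min (1/2) (1 / (2 * (C + 1))))"
  have s0: "0 < s0" "s0 < d" "s0 \<le> 1/2" proof -
    have "s0 \<le> d / 2" "s0 \<le> 1/2" by (simp_all add: s0_def)
    moreover have "0 < s0" using d C by (simp add: s0_def)
    ultimately show "0 < s0" "s0 < d" "s0 \<le> 1/2" using d by auto
  qed
  have "(C + 1) * s0 \<le> (C + 1) * (1 / (2 * (C + 1)))" using C by (intro mult_left_mono) (auto simp: s0_def)
  also have "\<dots> = 1/2" using C by simp
  finally have s0': "(C + 1) * s0 \<le> 1/2" .
  define m where "m = min 1 (\<alpha> / 2)"
  have m: "m > 0" "m \<le> 1" "m \<le> \<alpha> / 2" using \<alpha> by (auto simp: m_def)
  \<comment> \<open>The error term is then at most \<kappa> (C + 1)|v|^2 = (m/2)|v|^2, half of the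
    lower bound m |v|^2 for the main terms.\<close>
  define \<kappa> where "\<kappa> = m / (2 * (C + 1))"
  have \<kappa>: "\<kappa> > 0" using m C by (simp add: \<kappa>_def)
  obtain \<eta> :: "real ^ 'n \<Rightarrow> real" and r where \<eta>: "0 < r" "r < s0" "smooth_on UNIV \<eta>" "\<And>z. 0 \<le> \<eta> z \<and> \<eta> z \<le> 1"
     "\<And>z. norm z \<le> r \<Longrightarrow> \<eta> z = 1" "\<And>z. norm z \<ge> s0 \<Longrightarrow> \<eta> z = 0" "\<And>z v. \<bar>dderiv \<eta> v z\<bar> * norm z \<le> \<kappa> * norm v"
    using slow_bump[OF \<kappa> s0(1), where 'a = "real ^ 'n"] by blast
  define G where "G z = (if norm z < d then z + \<eta> z *\<^sub>R (\<phi> z - z) else z)" for z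
  have Gin: "G z = z + \<eta> z *\<^sub>R (\<phi> z - z)" if "z \<in> ball 0 d" for z using that by (simp add: G_def)
  have Gout: "G z = z" if "norm z \<ge> s0" for z using \<eta>(6)[OF that] by (simp add: G_def)
  have cov: "z \<in> ball 0 d \<or> z \<in> - cball 0 s0" for z :: "real ^ 'n" using s0 by auto
  have "smooth_on (ball 0 d) \<phi>" "smooth_on (ball 0 d) \<eta>"
    using d(2) by (auto intro!: smooth_on_subset[OF \<phi>] smooth_on_subset[OF \<eta>(3)])
  then have "smooth_on (ball 0 d) (\<lambda>z. z + \<eta> z *\<^sub>R (\<phi> z - z))"
    by (intro smooth_on_add smooth_on_scaleR smooth_on_diff smooth_on_id open_ball)
  then have sin: "smooth_on (ball 0 d) G"
    by (rule smooth_on_cong[OF open_ball, rotated]) (simp add: Gin)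
  have sout: "smooth_on (- cball 0 s0) G"
    by (rule smooth_on_cong[of _ "\<lambda>z. z"]) (auto simp: Gout)
  have "ball 0 d \<union> - cball 0 s0 = (UNIV :: (real ^ 'n) set)" using cov by blast
  then have sm: "smooth_on UNIV G" using smooth_on_Un_open[OF _ _ sin sout] by auto
  have pos: "v \<bullet> dderiv G v z > 0" if v: "v \<noteq> 0" for z v
  proof (cases "z \<in> ball 0 d")
    case False
    then have "z \<in> - cball 0 s0" using cov by blast
    then have "dderiv G v z = dderiv (\<lambda>z. z) v z" by (intro dderiv_cong[of "- cball 0 s0"]) (auto simp: Gout)
    then show ?thesis using v by simp
  next
    case z: True
    have d\<eta>: "(\<eta> has_derivative (\<lambda>v. dderiv \<eta> v z)) (at z)" by (rule smooth_on_has_derivative[OF \<eta>(3)]) simp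
    have "dderiv G v z = dderiv (\<lambda>z. z + \<eta> z *\<^sub>R (\<phi> z - z)) v z"
      by (rule dderiv_cong[OF _ z Gin]) auto
    also have "\<dots> = v + (\<eta> z *\<^sub>R (dderiv \<phi> v z - v) + dderiv \<eta> v z *\<^sub>R (\<phi> z - z))"
      by (rule dderiv_eq) (auto intro!: derivative_eq_intros d\<eta> has_derivative_dderiv[OF diff[OF z]])
    finally have dG: "dderiv G v z = v + (\<eta> z *\<^sub>R (dderiv \<phi> v z - v) + dderiv \<eta> v z *\<^sub>R (\<phi> z - z))" .
    have "v \<bullet> dderiv G v z = (1 - \<eta> z) * (norm v)\<^sup>2 + \<eta> z * (v \<bullet> dderiv \<phi> v z) + dderiv \<eta> v z * (v \<bullet> (\<phi> z - z))"
      unfolding dG by (simp add: inner_add_right inner_diff_right power2_norm_eq_inner algebra_simps)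
    moreover have "\<bar>dderiv \<eta> v z * (v \<bullet> (\<phi> z - z))\<bar> \<le> m / 2 * (norm v)\<^sup>2"
    proof -
      have "norm (\<phi> z - z) \<le> (C + 1) * norm z"
        using \<phi>le[OF z] norm_triangle_ineq4[of "\<phi> z" z] by (simp add: algebra_simps)
      then have "norm v * norm (\<phi> z - z) \<le> norm v * ((C + 1) * norm z)" by (intro mult_left_mono) auto
      then have "\<bar>v \<bullet> (\<phi> z - z)\<bar> \<le> norm v * ((C + 1) * norm z)" using Cauchy_Schwarz_ineq2 order_trans by blast
      then have "\<bar>dderiv \<eta> v z * (v \<bullet> (\<phi> z - z))\<bar> \<le> \<bar>dderiv \<eta> v z\<bar> * (norm v * ((C + 1) * norm z))"
        unfolding abs_mult by (intro mult_left_mono) auto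
      also have "\<dots> = (\<bar>dderiv \<eta> v z\<bar> * norm z) * (norm v * (C + 1))" by simp
      also have "\<dots> \<le> (\<kappa> * norm v) * (norm v * (C + 1))" using C by (intro mult_right_mono \<eta>(7)) auto
      also have "\<dots> = m / 2 * (norm v)\<^sup>2" using C by (simp add: \<kappa>_def power2_eq_square field_simps)
      finally show ?thesis .
    qed
    moreover have "m * (norm v)\<^sup>2 \<le> (1 - \<eta> z) * (norm v)\<^sup>2 + \<eta> z * (v \<bullet> dderiv \<phi> v z)"
    proof -
      have "(1 - \<eta> z) * (m * (norm v)\<^sup>2) \<le> (1 - \<eta> z) * (norm v)\<^sup>2" 
        using \<eta>(4)[of z] m mult_right_mono[of m 1 "(norm v)\<^sup>2"] by (intro mult_left_mono) auto
      moreover have "m * (norm v)\<^sup>2 \<le> \<alpha> / 2 * (norm v)\<^sup>2" using m by (intro mult_right_mono) auto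
      then have "\<eta> z * (m * (norm v)\<^sup>2) \<le> \<eta> z * (v \<bullet> dderiv \<phi> v z)"
        using \<eta>(4)[of z] low[OF z, of v] by (intro mult_left_mono) auto
      ultimately show ?thesis by (simp add: algebra_simps)
    qed
    moreover have "m / 2 * (norm v)\<^sup>2 < m * (norm v)\<^sup>2" using m v by simp
    ultimately show ?thesis by linarith
  qed
  have "norm (G z) < 1" if z: "norm z < 1" for z
  proof (cases "norm z < s0")
    case True
    then have zd: "z \<in> ball 0 d" using s0 by simp
    have "G z = (1 - \<eta> z) *\<^sub>R z + \<eta> z *\<^sub>R \<phi> z" unfolding Gin[OF zd] by (simp add: algebra_simps)
    then have "norm (G z) \<le> (1 - \<eta> z) * norm z + \<eta> z * norm (\<phi> z)"
      using norm_triangle_ineq[of "(1 - \<eta> z) *\<^sub>R z" "\<eta> z *\<^sub>R \<phi> z"] \<eta>(4)[of z] by simp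
    also have "\<dots> \<le> 1 * norm z + 1 * (C * norm z)"
      using \<eta>(4)[of z] \<phi>le[OF zd] by (intro add_mono mult_mono) auto
    also have "\<dots> = (C + 1) * norm z" by (simp add: algebra_simps)
    also have "\<dots> \<le> (C + 1) * s0" using True C by (intro mult_left_mono) auto
    finally show ?thesis using s0' by simp
  qed (use Gout z in auto)
  moreover have "G z = \<phi> z" if "norm z < r" for z using that \<eta>(5)[of z] \<eta>(2) s0(2) by (simp add: G_def)
  ultimately show ?thesis using \<eta>(1,2) s0 d(2) sm pos Gout
    by (intro exI[of _ G] exI[of _ r]) auto
qed

section \<open>Locally conformally flat metrics on open sets\<close>

text \<open>Here \<theta> is a change to conformal coordinates near z. Building it into the notion
  makes the property invariant under pull-back by injective local diffeomorphisms.\<close>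

definition conf_flat_at :: "(real ^ 'n::finite \<Rightarrow> real ^ 'n ^ 'n) \<Rightarrow> real ^ 'n \<Rightarrow> bool" where
  "conf_flat_at K z \<longleftrightarrow> (\<exists>W \<theta> f. open W \<and> z \<in> W \<and> smooth_on W \<theta> \<and> inj_on \<theta> W \<and> (\<forall>x\<in>W. invertible (jac \<theta> x)) \<and>
     smooth_on (\<theta> ` W) f \<and> (\<forall>x\<in>W. K x = pull \<theta> (conf f) x))"

text \<open>All that is asked of the final metric, as a condition local in the points of U. Such
  metrics can be restricted, united over overlapping open sets and pulled back, and the neck is
  assembled by these operations.\<close>

definition good_metric :: "real \<Rightarrow> (real ^ 'n::finite) set \<Rightarrow> (real ^ 'n \<Rightarrow> real ^ 'n ^ 'n) \<Rightarrow> bool" where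
  "good_metric k U K \<longleftrightarrow> open U \<and> smooth_on U K \<and> (\<forall>x\<in>U. transpose (K x) = K x \<and>
     (\<forall>v. v \<noteq> 0 \<longrightarrow> v \<bullet> (K x *v v) > 0) \<and> ein_pos k K x \<and> conf_flat_at K x)"

lemma invertible_posdef:
  fixes A :: "real ^ 'n::finite ^ 'n"
  assumes "\<And>v. v \<noteq> 0 \<Longrightarrow> v \<bullet> (A *v v) > 0" shows "invertible A"
  by (rule invertible_ker) (metis assms inner_zero_right less_irrefl)

lemma conf_flat_at_subset:
  assumes "open U" "x \<in> U" "\<And>y. y \<in> U \<Longrightarrow> K y = K' y" "conf_flat_at K x"
  shows "conf_flat_at K' x"
proof -
  obtain W \<theta> f where W: "open W" "x \<in> W" "smooth_on W \<theta>" "inj_on \<theta> W" "\<And>x. x\<in>W \<Longrightarrow> invertible (jac \<theta> x)"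
     "smooth_on (\<theta> ` W) f" "\<And>x. x\<in>W \<Longrightarrow> K x = pull \<theta> (conf f) x"
    using assms(4) unfolding conf_flat_at_def by blast
  have "\<theta> ` (W \<inter> U) \<subseteq> \<theta> ` W" by auto
  then show ?thesis unfolding conf_flat_at_def
    using W assms(1-3) smooth_on_subset[OF W(3)] inj_on_subset[OF W(4)] smooth_on_subset[OF W(6)]
    by (intro exI[of _ "W \<inter> U"] exI[of _ \<theta>] exI[of _ f]) (metis (no_types, lifting) IntD1 IntD2 IntI
        inf_le1 open_Int)
qed

lemma ein_pos_cong:
  assumes "open U" "x \<in> U" "\<And>y. y \<in> U \<Longrightarrow> K y = K' y"
  shows "ein_pos k K x \<longleftrightarrow> ein_pos k K' x"
  using EinM_cong[OF assms, where k=k] unfolding ein_pos_def by simp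

lemma good_metric_cong:
  assumes K: "good_metric k U K" and eq: "\<And>y. y \<in> U \<Longrightarrow> K y = K' y"
  shows "good_metric k U K'"
proof -
  have U: "open U" using K by (simp add: good_metric_def)
  show ?thesis unfolding good_metric_def
  proof (intro conjI ballI)
    show "smooth_on U K'" using K smooth_on_cong[OF U eq] by (simp add: good_metric_def)
    fix x assume x: "x \<in> U"
    show "transpose (K' x) = K' x" "\<forall>v. v \<noteq> 0 \<longrightarrow> v \<bullet> (K' x *v v) > 0"
      using K x eq[OF x] by (auto simp: good_metric_def)
    show "ein_pos k K' x" using ein_pos_cong[OF U x eq] K x by (auto simp: good_metric_def)
    show "conf_flat_at K' x" using conf_flat_at_subset[OF U x eq] K x by (auto simp: good_metric_def)
  qed (rule U)
qed

lemma good_metric_subset: "good_metric k U K \<Longrightarrow> open V \<Longrightarrow> V \<subseteq> U \<Longrightarrow> good_metric k V K"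
  unfolding good_metric_def by (meson smooth_on_subset subsetD)

lemma good_metric_Un: "good_metric k U K \<Longrightarrow> good_metric k V K \<Longrightarrow> good_metric k (U \<union> V) K"
  unfolding good_metric_def by (meson UnE open_Un smooth_on_Un_open)

text \<open>Precompose the conformal coordinates with \<tau>, after shrinking to the preimage of
  their domain.\<close>

lemma conf_flat_at_pull:
  fixes \<tau> :: "real ^ 'n::finite \<Rightarrow> real ^ 'n"
  assumes U: "open U" "x \<in> U" and \<tau>: "smooth_on U \<tau>" "inj_on \<tau> U" "\<And>y. y \<in> U \<Longrightarrow> invertible (jac \<tau> y)"
    and K: "conf_flat_at K (\<tau> x)"
  shows "conf_flat_at (pull \<tau> K) x"
proof -
  obtain W \<theta> f where W: "open W" "\<tau> x \<in> W" "smooth_on W \<theta>" "inj_on \<theta> W" "\<And>x. x\<in>W \<Longrightarrow> invertible (jac \<theta> x)"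
     "smooth_on (\<theta> ` W) f" "\<And>x. x\<in>W \<Longrightarrow> K x = pull \<theta> (conf f) x"
    using K unfolding conf_flat_at_def by blast
  define W' where "W' = U \<inter> \<tau> -` W"
  have W': "open W'" unfolding W'_def
    using smooth_on_continuous[OF \<tau>(1)] U(1) W(1) by (metis continuous_on_open_vimage inf_commute)
  have sub: "W' \<subseteq> U" "\<tau> ` W' \<subseteq> W" by (auto simp: W'_def)
  have s\<tau>: "smooth_on W' \<tau>" by (rule smooth_on_subset[OF \<tau>(1) sub(1)])
  have d: "\<tau> differentiable (at y)" "\<theta> differentiable (at (\<tau> y))" if "y \<in> W'" for y
    using smooth_on_differentiable[OF s\<tau> that] smooth_on_differentiable[OF W(3)] that sub by auto
  have jc: "jac (\<lambda>y. \<theta> (\<tau> y)) y = jac \<theta> (\<tau> y) ** jac \<tau> y" if "y \<in> W'" for y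
    by (rule jac_compose) (use d[OF that] in auto)
  show ?thesis unfolding conf_flat_at_def
  proof (intro exI conjI ballI)
    show "open W'" "x \<in> W'" using W' U W by (auto simp: W'_def)
    show "smooth_on W' (\<lambda>y. \<theta> (\<tau> y))" by (rule smooth_on_compose[OF W' W(1) sub(2) s\<tau> W(3)])
    show "inj_on (\<lambda>y. \<theta> (\<tau> y)) W'"
    proof (rule inj_onI)
      fix a b assume ab: "a \<in> W'" "b \<in> W'" "\<theta> (\<tau> a) = \<theta> (\<tau> b)"
      then have w: "\<tau> a \<in> W" "\<tau> b \<in> W" "a \<in> U" "b \<in> U" using sub by blast+
      show "a = b"
        by (rule inj_onD[OF \<tau>(2) inj_onD[OF W(4) ab(3) w(1,2)] w(3,4)])
    qed
    show "smooth_on ((\<lambda>y. \<theta> (\<tau> y)) ` W') f" by (rule smooth_on_subset[OF W(6)]) (use sub in auto)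
    fix y assume y: "y \<in> W'"
    have yU: "y \<in> U" and yW: "\<tau> y \<in> W" using y sub by auto
    show "invertible (jac (\<lambda>y. \<theta> (\<tau> y)) y)"
      unfolding jc[OF y] by (intro invertible_mult W(5)[OF yW] \<tau>(3)[OF yU])
    show "pull \<tau> K y = pull (\<lambda>y. \<theta> (\<tau> y)) (conf f) y"
      using W(7)[OF yW] unfolding pull_def jc[OF y] by (simp add: matrix_transpose_mul matrix_mul_assoc)
  qed
qed

lemma good_metric_pull:
  fixes \<tau> :: "real ^ 'n::finite \<Rightarrow> real ^ 'n"
  assumes K: "good_metric k V K" and U: "open U" and \<tau>: "smooth_on U \<tau>" "inj_on \<tau> U" "\<And>y. y \<in> U
      \<Longrightarrow> invertible (jac \<tau> y)"
    and sub: "\<tau> ` U \<subseteq> V"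
  shows "good_metric k U (pull \<tau> K)"
proof -
  have pd: "v \<bullet> (K y *v v) > 0" if "y \<in> V" "v \<noteq> 0" for y v using K that by (simp add: good_metric_def)
  interpret change_coords U V \<tau> K
    by unfold_locales (use K U \<tau> sub in \<open>auto simp: good_metric_def intro!: invertible_posdef\<close>)
  show ?thesis unfolding good_metric_def
  proof (intro conjI ballI allI impI)
    show "open U" "smooth_on U (pull \<tau> K)" by (rule U pull_smooth)+
    fix x assume x: "x \<in> U"
    have \<tau>x: "\<tau> x \<in> V" using x sub by auto
    show "transpose (pull \<tau> K x) = pull \<tau> K x" by (rule transpose_pull[where G=K and f=\<tau> and x=x, OF
        sym_G[OF \<tau>x]])
    have nz: "jac \<tau> x *v v \<noteq> 0" if "v \<noteq> 0" for v
      using invertible_mult_cancel[OF inv_jac[OF x], of v 0] that by auto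
    then show "v \<bullet> (pull \<tau> K x *v v) > 0" if "v \<noteq> 0" for v
      using that unfolding pull_def dot_transpose_mult by (intro pd \<tau>x) auto
    show "ein_pos k (pull \<tau> K) x"
      using K \<tau>x nz unfolding ein_pos_def EinM_pull[OF x] dot_transpose_mult good_metric_def by blast
    show "conf_flat_at (pull \<tau> K) x"
      by (rule conf_flat_at_pull[OF U x \<tau>]) (use K \<tau>x in \<open>auto simp: good_metric_def\<close>)
  qed
qed

lemma jac_ident: "jac (\<lambda>y. y) z = mat 1"
  by (simp add: jac_eq[OF has_derivative_ident] matrix_def mat_def axis_def vec_eq_iff)

lemma good_metric_conf:
  assumes U: "open U" and f: "smooth_on U f" and pos: "\<And>x. x \<in> U \<Longrightarrow> ein_pos k (conf f) x"
  shows "good_metric k U (conf f)"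
  unfolding good_metric_def
proof (intro conjI ballI allI impI)
  show "open U" "smooth_on U (conf f)" by (rule U smooth_on_conf[OF U f])+
  fix x assume x: "x \<in> U"
  show "ein_pos k (conf f) x" by (rule pos[OF x])
  show "transpose (conf f x) = conf f x" by (simp add: conf_def transpose_def mat_def vec_eq_iff)
  show "v \<bullet> (conf f x *v v) > 0" if "v \<noteq> 0" for v
    using that by (simp add: conf_def scaleR_matrix_vector_assoc[symmetric])
  show "conf_flat_at (conf f) x" unfolding conf_flat_at_def
    by (rule exI[of _ U], rule exI[of _ "\<lambda>x. x"], rule exI[of _ f])
      (use U x f invertible_right_inverse[of "mat 1 :: real ^ 'n ^ 'n"] in \<open>auto simp: pull_def
          jac_ident transpose_mat intro: exI[of _ "mat 1"]\<close>)
qed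

section \<open>Inversions\<close>

text \<open>For s > 0 the inversion in the sphere of radius sqrt s, so |z| becomes s/|z|. Division
  by zero gives the value 0 at 0, which makes it an involution of the whole space.\<close>

definition inversion :: "real \<Rightarrow> real ^ 'n::finite \<Rightarrow> real ^ 'n" where
  "inversion s z = (s / (z \<bullet> z)) *\<^sub>R z"

lemma norm_inversion: "s \<ge> 0 \<Longrightarrow> norm (inversion s z) = s / norm z"
  by (cases "z = 0") (auto simp: inversion_def dot_square_norm power2_eq_square)

lemma inversion_inversion: "s \<noteq> 0 \<Longrightarrow> inversion s (inversion s z) = z"
  by (cases "z = 0") (auto simp: inversion_def divide_simps)

lemma smooth_on_inversion: "smooth_on (- {0}) (inversion s :: real ^ 'n::finite \<Rightarrow> _)"
  unfolding inversion_def[abs_def]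
  by (intro smooth_on_scaleR smooth_on_divide smooth_on_inner smooth_on_const smooth_on_id) auto

lemma dderiv_inversion:
  assumes "z \<noteq> 0"
  shows "dderiv (inversion s) v z = (s / (z \<bullet> z)) *\<^sub>R v - (2 * s * (z \<bullet> v) / (z \<bullet> z)\<^sup>2) *\<^sub>R z"
  unfolding inversion_def[abs_def]
  by (rule dderiv_eq) (use assms in \<open>auto intro!: derivative_eq_intros simp: inner_commute
      power2_eq_square algebra_simps divide_simps\<close>)

text \<open>The derivative at z is s/|z|^2 times the reflection in the hyperplane orthogonal to
  z.\<close>

lemma inversion_conformal:
  fixes z :: "real ^ 'n::finite"
  assumes z: "z \<noteq> 0"
  shows "transpose (jac (inversion s) z) ** jac (inversion s) z = ((s / (z \<bullet> z))\<^sup>2) *\<^sub>R mat 1"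
proof (rule matrix_eqI_dot)
  fix u v :: "real ^ 'n"
  have d: "inversion s differentiable (at z)" using smooth_on_differentiable[OF smooth_on_inversion] z by auto
  have "u \<bullet> ((transpose (jac (inversion s) z) ** jac (inversion s) z) *v v)
      = dderiv (inversion s) u z \<bullet> dderiv (inversion s) v z"
    using dot_transpose_mult[of u "jac (inversion s) z" "mat 1" v] by (simp add: jac_works[OF d])
  also have "\<dots> = (s / (z \<bullet> z))\<^sup>2 * (u \<bullet> v)"
    unfolding dderiv_inversion[OF z]
    using z by (simp add: inner_diff_left inner_diff_right inner_commute[of v z] inner_commute[of u z]
        power2_eq_square field_simps)
  finally show "u \<bullet> ((transpose (jac (inversion s) z) ** jac (inversion s) z) *v v)
      = u \<bullet> (((s / (z \<bullet> z))\<^sup>2 *\<^sub>R mat 1) *v v)"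
    by (simp add: scaleR_matrix_vector_assoc[symmetric])
qed

lemma invertible_jac_inversion:
  assumes "z \<noteq> 0" "s \<noteq> 0" shows "invertible (jac (inversion s) z)"
proof -
  have "(((z \<bullet> z) / s)\<^sup>2 *\<^sub>R transpose (jac (inversion s) z)) ** jac (inversion s) z = mat 1"
    unfolding scaleR_matrix_mult inversion_conformal[OF assms(1)] using assms by (simp add: power_divide)
  then show ?thesis using invertible_left_inverse by blast
qed

lemma inj_on_inversion: "s \<noteq> 0 \<Longrightarrow> inj_on (inversion s) U"
  by (rule inj_on_inverseI[of _ "inversion s"]) (simp add: inversion_inversion)

text \<open>The inversion scales lengths by s/|z|^2, whose logarithm is added to the
  exponent.\<close>

lemma pull_inversion_conf:
  assumes "z \<noteq> 0" "s > 0"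
  shows "pull (inversion s) (conf f) z = conf (\<lambda>z. f (inversion s z) + ln (s / (z \<bullet> z))) z"
proof -
  have p: "s / (z \<bullet> z) > 0" using assms by simp
  have "exp (2 * ln (s / (z \<bullet> z))) = (s / (z \<bullet> z))\<^sup>2"
    using p by (simp add: exp_double)
  then have e: "exp (2 * (f (inversion s z) + ln (s / (z \<bullet> z))))
      = exp (2 * f (inversion s z)) * (s / (z \<bullet> z))\<^sup>2"
    by (simp add: distrib_left exp_add)
  show ?thesis unfolding conf_def e
    by (simp add: pull_def scaleR_matrix_mult inversion_conformal[OF assms(1)])
qed

lemma pull_inversion_inversion:
  fixes z :: "real ^ 'n::finite"
  assumes z: "z \<noteq> 0" and s: "s > 0"
  shows "pull (inversion s) (pull (inversion s) G) z = G z"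
proof -
  let ?i = "inversion s"
  have iz: "?i z \<noteq> 0" using z s by (simp add: inversion_def)
  have "jac (\<lambda>y. ?i (?i y)) z = jac ?i (?i z) ** jac ?i z"
    by (rule jac_compose) (use smooth_on_differentiable[OF smooth_on_inversion] z iz in auto)
  moreover have "(\<lambda>y :: real ^ 'n. ?i (?i y)) = (\<lambda>y. y)" using s by (simp add: inversion_inversion)
  ultimately have J: "jac ?i (?i z) ** jac ?i z = mat 1"
    using jac_ident[of z] by (simp only:)
  have "pull ?i (pull ?i G) z = transpose (jac ?i (?i z) ** jac ?i z) ** G z ** (jac ?i (?i z) ** jac ?i z)"
    using s by (simp add: pull_def inversion_inversion matrix_transpose_mul matrix_mul_assoc)
  then show ?thesis unfolding J by (simp add: transpose_mat)
qed

section \<open>The neck\<close>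

definition hess :: "(real ^ 'n::finite \<Rightarrow> real) \<Rightarrow> real ^ 'n \<Rightarrow> real ^ 'n ^ 'n" where
  "hess u x = (\<chi> i j. dderiv (dderiv u (axis i 1)) (axis j 1) x)"

lemma hess_dot:
  assumes V: "open V" "x \<in> V" "smooth_on V u"
  shows "v \<bullet> (hess u x *v w) = dderiv (dderiv u w) v x"
proof -
  have l: "linear (\<lambda>v. dderiv (dderiv u w) v x)" for w
    by (rule linear_frechet_derivative[OF smooth_on_differentiable[OF smooth_on_dderiv[OF V(3)] V(2)]])
  have "dderiv (dderiv u w) v x = (\<Sum>i\<in>UNIV. v $ i * dderiv (dderiv u w) (axis i 1) x)"
    using linear_expand[OF l[of w], of v] by simp
  also have "\<dots> = (\<Sum>i\<in>UNIV. v $ i * dderiv (dderiv u (axis i 1)) w x)"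
    by (simp add: dderiv_commute[OF V(1,3,2), of w])
  also have "\<dots> = (\<Sum>i\<in>UNIV. v $ i * (\<Sum>j\<in>UNIV. w $ j * dderiv (dderiv u (axis i 1)) (axis j 1) x))"
  proof -
    have "dderiv (dderiv u (axis i 1)) w x = (\<Sum>j\<in>UNIV. w $ j * dderiv (dderiv u (axis i 1)) (axis j 1) x)" for i
      using linear_expand[OF l[of "axis i 1"], of w] by simp
    then show ?thesis by (simp only:)
  qed
  also have "\<dots> = v \<bullet> (hess u x *v w)"
    by (simp add: hess_def inner_vec_def matrix_vector_mult_def mult.commute)
  finally show ?thesis by simp
qed

lemma lap_hess: "lap u x = trace (hess u x)"
  by (simp add: lap_def hess_def trace_def)

text \<open>\<open>ein_op\<close> as a function of the 2-jet (U, g, H) of u. Continuity in these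
  finitely many variables yields stability under C^2-small changes of u.\<close>

definition ein_form :: "real \<Rightarrow> real \<Rightarrow> real \<Rightarrow> real ^ 'n::finite \<Rightarrow> real ^ 'n ^ 'n \<Rightarrow> real ^ 'n \<Rightarrow> real" where
  "ein_form k q U g H v = (k - (2 * real CARD('n) - 2)) * (norm v)\<^sup>2 * trace H
     + k * (real CARD('n) - 2) * (v \<bullet> (H *v v)) + ein_quad k q v g / U"

lemma ein_op_form:
  assumes "open V" "x \<in> V" "smooth_on V u"
  shows "ein_op k q u x v = ein_form k q (u x) (grad u x) (hess u x) v"
  by (simp add: ein_op_def ein_form_def lap_hess hess_dot[OF assms])

text \<open>Homogeneity in v reduces positivity to unit vectors, hence to a compact set.\<close>

lemma ein_form_scale: "ein_form k q U g H (r *\<^sub>R v) = r\<^sup>2 * ein_form k q U g H v"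
  unfolding ein_form_def ein_quad_def power2_norm_eq_inner
  by (simp add: matrix_vector_mult_scaleR power2_eq_square add_divide_distrib diff_divide_distrib algebra_simps)

lemma continuous_on_ein_form:
  fixes g :: "'a::topological_space \<Rightarrow> real ^ 'n::finite"
  assumes "continuous_on S U" "continuous_on S g" "continuous_on S H" "continuous_on S v" "\<And>x. x \<in> S \<Longrightarrow> U x \<noteq> 0"
  shows "continuous_on S (\<lambda>x. ein_form k q (U x) (g x) (H x) (v x))"
proof -
  have H: "continuous_on S (\<lambda>x. H x $ i $ j)" for i j
    by (intro continuous_on_component assms)
  have v: "continuous_on S (\<lambda>x. v x $ i)" for i by (intro continuous_on_component assms)
  show ?thesis
    unfolding ein_form_def ein_quad_def trace_def inner_vec_def[of "v _"
        "_ *v _"] matrix_vector_mult_def vec_lambda_beta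
    by (intro continuous_intros H v assms) (simp_all add: assms(5))
qed

text \<open>Uniform continuity on the compact product: moving the parameter by less than e changes
  the value by less than the minimum over Y at p0.\<close>

lemma compact_parameter_pos:
  fixes \<Phi> :: "'a::metric_space \<times> 'b::metric_space \<Rightarrow> real"
  assumes c: "continuous_on (P \<times> Y) \<Phi>" and P: "compact P" and Y: "compact Y" and p0: "p0 \<in> P"
    and pos: "\<And>y. y \<in> Y \<Longrightarrow> \<Phi> (p0, y) > 0"
  shows "\<exists>e>0. \<forall>p\<in>P. dist p p0 < e \<longrightarrow> (\<forall>y\<in>Y. \<Phi> (p, y) > 0)"
proof (cases "Y = {}")
  case False
  have "continuous_on Y (\<lambda>y. \<Phi> (p0, y))"
    by (rule continuous_on_compose2[OF c]) (use p0 in \<open>auto intro!: continuous_intros\<close>)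
  then obtain y0 where y0: "y0 \<in> Y" "\<And>y. y \<in> Y \<Longrightarrow> \<Phi> (p0, y0) \<le> \<Phi> (p0, y)"
    using continuous_attains_inf[OF Y False] by blast
  have "uniformly_continuous_on (P \<times> Y) \<Phi>" by (intro compact_uniformly_continuous c compact_Times P Y)
  then obtain e where e: "e > 0" "\<And>a b. a \<in> P \<times> Y \<Longrightarrow> b \<in> P \<times> Y \<Longrightarrow> dist b a < e \<Longrightarrow> dist (\<Phi> b) (\<Phi> a) < \<Phi> (p0, y0)"
    using pos[OF y0(1)] unfolding uniformly_continuous_on_def by metis
  have "\<Phi> (p, y) > 0" if "p \<in> P" "dist p p0 < e" "y \<in> Y" for p y
    using e(2)[of "(p0, y)" "(p, y)"] that p0 y0(2)[of y] by (simp add: dist_Pair_Pair dist_real_def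
        abs_less_iff)
  then show ?thesis using e(1) by blast
qed (auto intro: exI[of _ 1])

text \<open>Derivatives in z alone are derivatives of the joint function in directions (0, w); in
  this form they can be iterated and depend continuously on s as well when m is smooth.\<close>

lemma dderiv_pair:
  fixes m :: "'a::real_normed_vector \<times> 'b::real_normed_vector \<Rightarrow> 'c::real_normed_vector"
  assumes "m differentiable (at (s, z))"
  shows "((\<lambda>z. m (s, z)) has_derivative (\<lambda>w. dderiv m (0, w) (s, z))) (at z)"
proof -
  have "((\<lambda>z. (s, z)) has_derivative (\<lambda>w. (0, w))) (at z)" by (auto intro!: derivative_eq_intros)
  from has_derivative_compose[OF this has_derivative_dderiv[OF assms]] show ?thesis .
qed

text \<open>One end of the neck in its own disc coordinates: \<open>K1\<close> is the metric of this
  end, with conformal exponent \<open>f1\<close> near the centre, and \<open>f2\<close> is the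
  exponent of the other end near its own centre. Exchanging the data gives the other end.\<close>

locale neck_side =
  fixes k q \<sigma> :: real and K1 :: "real ^ 'n::finite \<Rightarrow> real ^ 'n ^ 'n" and f1 f2 :: "real ^ 'n \<Rightarrow> real"
  assumes K1: "good_metric k (ball 0 1) K1" and \<sigma>: "0 < \<sigma>" "\<sigma> \<le> 1/2"
    and f1: "smooth_on (ball 0 \<sigma>) f1" and K1f: "\<And>z. z \<in> ball 0 \<sigma> \<Longrightarrow> K1 z = conf f1 z"
    and f2: "smooth_on (ball 0 \<sigma>) f2" and f2pos: "\<And>z. z \<in> ball 0 \<sigma> \<Longrightarrow> ein_pos k (conf f2) z"
    and q: "q > 0" and quad: "\<And>v a :: real ^ 'n. ein_quad k q v a \<le> 0"
begin

lemma f1pos: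
  assumes z: "z \<in> ball 0 \<sigma>" shows "ein_pos k (conf f1) z"
proof -
  have "ein_pos k K1 z \<longleftrightarrow> ein_pos k (conf f1) z"
    by (rule ein_pos_cong[OF open_ball z K1f])
  then show ?thesis using K1 z \<sigma> by (auto simp: good_metric_def)
qed

definition v1 :: "real ^ 'n \<Rightarrow> real" where "v1 z = exp (f1 z / q)"

lemma v1: "smooth_on (ball 0 \<sigma>) v1" "v1 z > 0"
  using q unfolding v1_def[abs_def] by (auto intro!: smooth_on_exp smooth_on_divide f1)

text \<open>The open set contains points with s = 0, so smoothness on it controls the limit s -> 0.
  Its bounds give |s|/|z| < \<sigma>, which keeps the inverted point in the domain of
  \<open>f2\<close>.\<close>

definition S :: "(real \<times> (real ^ 'n)) set" where "S = {p. \<bar>fst p\<bar> < \<sigma>\<^sup>2 / 8 \<and> \<sigma> / 8 < norm (snd p)}"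

lemma open_S: "open S" unfolding S_def by (intro open_Collect_conj open_Collect_less continuous_intros)

text \<open>The transported factor is s^(1/q) times a function smooth in (s,z) across s = 0. On the
  fixed annulus its 2-jet, cut off by \<eta>, is small for small s, and the strict positivity
  belonging to \<open>v1\<close> survives; compactness makes the bound on s uniform.\<close>

lemma cutoff_uniform:
  assumes \<eta>: "smooth_on UNIV \<eta>" "\<And>z. 0 \<le> \<eta> z \<and> \<eta> z \<le> 1"
  shows "\<exists>s0>0. \<forall>s z v. 0 < s \<and> s < s0 \<and> \<sigma>/4 \<le> norm z \<and> norm z \<le> \<sigma>/2 \<and> v \<noteq> 0 \<longrightarrow>
    ein_op k q (\<lambda>z. v1 z + \<eta> z * exp ((f2 (inversion s z) + ln (s / (z \<bullet> z))) / q)) z v > 0"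
proof -
  \<comment> \<open>The cut off transported factor with ln s removed from its exponent, at p = (s,
    z). The remaining s^(1/q) becomes the separate parameter \<delta>.\<close>
  define m where "m p = \<eta> (snd p) * exp ((f2 (inversion (fst p) (snd p)) - ln (snd p \<bullet> snd p)) / q)" for p
  have nz: "snd p \<noteq> 0" if "p \<in> S" for p using that \<sigma> by (auto simp: S_def)
  have inS: "inversion (fst p) (snd p) \<in> ball 0 \<sigma>" if "p \<in> S" for p
  proof -
    have "norm (inversion (fst p) (snd p)) = \<bar>fst p\<bar> / norm (snd p)"
      by (simp add: inversion_def dot_square_norm power2_eq_square)
    also have "\<dots> < (\<sigma>\<^sup>2 / 8) / (\<sigma> / 8)" using that \<sigma> by (intro frac_less) (auto simp: S_def)
    finally show ?thesis using \<sigma> by (simp add: power2_eq_square)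
  qed
  have sfst: "smooth_on S fst" "smooth_on S snd"
    by (intro smooth_on_linear open_S bounded_linear_fst bounded_linear_snd)+
  have "smooth_on S (\<lambda>p. inversion (fst p) (snd p))"
    unfolding inversion_def using nz
    by (intro smooth_on_scaleR smooth_on_divide smooth_on_inner sfst open_S) auto
  then have sm: "smooth_on S m"
    unfolding m_def[abs_def] using q inS nz
    by (intro smooth_on_mult smooth_on_exp smooth_on_divide smooth_on_diff smooth_on_ln smooth_on_inner
        sfst open_S smooth_on_const
      smooth_on_compose[OF open_S open_UNIV _ sfst(2) \<eta>(1)] smooth_on_compose[OF open_S open_ball _ _ f2]) auto
  define gm where "gm p = (\<chi> i. dderiv m (0, axis i 1) p)" for p
  define hm where "hm p = (\<chi> i j. dderiv (dderiv m (0, axis i 1)) (0, axis j 1) p)" for p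
  have sgm: "smooth_on S gm" "smooth_on S hm" unfolding gm_def[abs_def] hm_def[abs_def]
    by (intro smooth_on_vec_lambda smooth_on_dderiv sm open_S)+
  define Z where "Z = {z :: real ^ 'n. \<sigma>/8 < norm z \<and> norm z < \<sigma>}"
  have Z: "open Z" unfolding Z_def by (intro open_Collect_conj open_Collect_less continuous_intros)
  have Zb: "Z \<subseteq> ball 0 \<sigma>" by (auto simp: Z_def)
  have op: "ein_op k q (\<lambda>z. v1 z + \<delta> * m (s, z)) z v
     = ein_form k q (v1 z + \<delta> * m (s, z)) (grad v1 z + \<delta> *\<^sub>R gm (s, z)) (hess v1 z + \<delta> *\<^sub>R hm (s, z)) v"
    if s: "\<bar>s\<bar> < \<sigma>\<^sup>2 / 8" and z: "z \<in> Z" for s \<delta> z v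
  proof -
    let ?w = "\<lambda>z. \<delta> * m (s, z)"
    have zS: "(s, y) \<in> S" if "y \<in> Z" for y using that s by (auto simp: S_def Z_def)
    have sp: "smooth_on Z (\<lambda>z. (s, z))"
      unfolding smooth_on_def
    proof
      fix j show "Ck_on j Z (\<lambda>z. (s, z))"
        by (cases j) (auto intro!: continuous_intros Ck_on_Suc_intro[OF Z, of _
            "\<lambda>v x. (0, v)"] derivative_eq_intros simp del: Ck_on.simps(2))
    qed
    have "smooth_on Z (\<lambda>z. m (s, z))"
      by (rule smooth_on_compose[OF Z open_S _ sp sm]) (use zS in auto)
    then have w: "smooth_on Z ?w" by (intro smooth_on_mult Z smooth_on_const)
    have d1: "dderiv ?w a y = \<delta> * dderiv m (0, a) (s, y)" if "y \<in> Z" for a y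
      by (rule dderiv_eq) (auto intro!: derivative_eq_intros dderiv_pair smooth_on_differentiable[OF sm
          zS[OF that]])
    have d2: "dderiv (dderiv ?w a) b z = \<delta> * dderiv (dderiv m (0, a)) (0, b) (s, z)" for a b
    proof -
      have "dderiv (dderiv ?w a) b z = dderiv (\<lambda>y. \<delta> * dderiv m (0, a) (s, y)) b z"
        by (rule dderiv_cong[OF Z z d1])
      also have "\<dots> = \<delta> * dderiv (dderiv m (0, a)) (0, b) (s, z)"
        by (rule dderiv_eq) (auto intro!: derivative_eq_intros dderiv_pair smooth_on_differentiable[OF
            smooth_on_dderiv[OF sm] zS[OF z]])
      finally show ?thesis .
    qed
    have v1Z: "smooth_on Z v1" by (rule smooth_on_subset[OF v1(1) Zb])
    have g: "grad (\<lambda>z. v1 z + ?w z) z = grad v1 z + \<delta> *\<^sub>R gm (s, z)"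
      unfolding lap_add(4)[OF Z z v1Z w] by (simp add: grad_def[of ?w] gm_def d1[OF z] vec_eq_iff)
    have h: "hess (\<lambda>z. v1 z + ?w z) z = hess v1 z + \<delta> *\<^sub>R hm (s, z)"
      by (simp add: hess_def lap_add(2)[OF Z z v1Z w] hm_def d2 vec_eq_iff)
    show ?thesis
      using ein_op_form[OF Z z smooth_on_add[OF Z v1Z w], of k q v] unfolding g h .
  qed
  \<comment> \<open>The parameters s and \<delta> are decoupled, because s^(1/q) need not be smooth
    at s = 0; at (0,0) the form is that of \<open>v1\<close> alone.\<close>
  define P where "P = {0..\<sigma>\<^sup>2/16} \<times> {0..1::real}"
  define Y where "Y = {z :: real ^ 'n. \<sigma>/4 \<le> norm z \<and> norm z \<le> \<sigma>/2} \<times> sphere (0 :: real ^ 'n) 1"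
  define \<Phi> where "\<Phi> = (\<lambda>p. ein_form k q (v1 (fst (snd p)) + snd (fst p) * m (fst (fst p), fst (snd p)))
     (grad v1 (fst (snd p)) + snd (fst p) *\<^sub>R gm (fst (fst p), fst (snd p)))
     (hess v1 (fst (snd p)) + snd (fst p) *\<^sub>R hm (fst (fst p), fst (snd p))) (snd (snd p)))"
  have P: "compact P" unfolding P_def by (intro compact_Times) auto
  have "{z :: real ^ 'n. \<sigma>/4 \<le> norm z \<and> norm z \<le> \<sigma>/2} = cball 0 (\<sigma>/2) - ball 0 (\<sigma>/4)" by auto
  then have Y: "compact Y" unfolding Y_def by (auto intro!: compact_Times compact_diff)
  have s16: "s \<in> {0..\<sigma>\<^sup>2/16} \<Longrightarrow> \<bar>s\<bar> < \<sigma>\<^sup>2/8" for s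
  proof -
    assume "s \<in> {0..\<sigma>\<^sup>2/16}"
    moreover have "\<sigma>\<^sup>2/16 < \<sigma>\<^sup>2/8" using \<sigma> by simp
    ultimately show "\<bar>s\<bar> < \<sigma>\<^sup>2/8" unfolding atLeastAtMost_iff by linarith
  qed
  have mpos: "m p \<ge> 0" for p using \<eta>(2) by (simp add: m_def)
  have inPY: "(fst (fst p), fst (snd p)) \<in> S" "fst (snd p) \<in> ball 0 \<sigma>" "snd (fst p) \<ge> 0" if "p \<in> P \<times> Y" for p
    using that s16 \<sigma> by (auto simp: P_def Y_def S_def)
  have "continuous_on (P \<times> Y) \<Phi>"
  proof -
    have a: "continuous_on (P \<times> Y) (\<lambda>p. F (fst (snd p)))" if "smooth_on (ball 0 \<sigma>) F" for F ::
        "real ^ 'n \<Rightarrow> 'x::real_normed_vector"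
      by (rule continuous_on_compose2[OF smooth_on_continuous[OF that]])
          (use inPY in \<open>auto intro!: continuous_intros\<close>)
    have b: "continuous_on (P \<times> Y) (\<lambda>p. F (fst (fst p), fst (snd p)))" if "smooth_on S F" for F ::
        "real \<times> (real ^ 'n) \<Rightarrow> 'x::real_normed_vector"
      by (rule continuous_on_compose2[OF smooth_on_continuous[OF that]])
          (use inPY in \<open>auto intro!: continuous_intros\<close>)
    have g: "smooth_on (ball 0 \<sigma>) (grad v1)" "smooth_on (ball 0 \<sigma>) (hess v1)"
      unfolding grad_def[abs_def] hess_def[abs_def] by (intro smooth_on_vec_lambda smooth_on_dderiv v1
          open_ball)+
    have pos: "v1 z + \<delta> * m p \<noteq> 0" if "\<delta> \<ge> 0" for z \<delta> p
      using v1(2)[of z] mpos[of p] that by (metis add_pos_nonneg less_irrefl mult_nonneg_nonneg)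
    show ?thesis unfolding \<Phi>_def
      by (intro continuous_on_ein_form continuous_intros a b v1 g sm sgm) (use pos inPY in auto)
  qed
  moreover have "(0, 0) \<in> P" by (simp add: P_def)
  moreover have "\<Phi> ((0, 0), y) > 0" if "y \<in> Y" for y
  proof -
    obtain z v where zv: "y = (z, v)" by (cases y)
    then have y: "y = (z, v)" "z \<in> ball 0 \<sigma>" "v \<noteq> 0" using that \<sigma> by (auto simp: Y_def)
    have "\<Phi> ((0, 0), y) = ein_op k q v1 z v"
      unfolding \<Phi>_def y using ein_op_form[OF open_ball y(2) v1(1)] by simp
    moreover have "ein_op k q v1 z v > 0"
      using f1pos[OF y(2)] y(3) unfolding ein_pos_conf_exp[OF open_ball y(2) f1 q] v1_def[abs_def] by blast
    ultimately show ?thesis by simp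
  qed
  ultimately obtain e where e: "e > 0" "\<And>p y. p \<in> P \<Longrightarrow> dist p (0, 0) < e \<Longrightarrow> y \<in> Y \<Longrightarrow> \<Phi> (p, y) > 0"
    using compact_parameter_pos[OF _ P Y, of \<Phi> "(0, 0)"] by blast
  define e' where "e' = min 1 (e / 2)"
  \<comment> \<open>The last bound is the q-th power of e', so that \<delta> = s^(1/q) < e';
    together with s < e/2 this puts (s, \<delta>) within e of the origin.\<close>
  define s0 where "s0 = min (min (\<sigma>\<^sup>2/16) (e / 2)) (exp (q * ln e'))"
  have e': "e' > 0" "e' \<le> 1" "e' \<le> e / 2" using e by (auto simp: e'_def)
  have "ein_op k q (\<lambda>z. v1 z + \<eta> z * exp ((f2 (inversion s z) + ln (s / (z \<bullet> z))) / q)) z v > 0"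
    if s: "0 < s" "s < s0" and z: "\<sigma>/4 \<le> norm z" "norm z \<le> \<sigma>/2" and v: "v \<noteq> 0" for s z v
  proof -
    define \<delta> where "\<delta> = exp (ln s / q)"
    have s': "s < \<sigma>\<^sup>2/16" "s < e / 2" "s < exp (q * ln e')" using s(2) by (auto simp: s0_def)
    have "ln s < q * ln e'" using s'(3) s(1) by (metis exp_less_cancel_iff exp_ln)
    then have "ln s / q < ln e'" using q by (simp add: divide_less_eq mult.commute)
    then have \<delta>: "0 < \<delta>" "\<delta> < e'" unfolding \<delta>_def using e'(1) by (auto simp: exp_less_cancel_iff[of _
        "ln e'", symmetric])
    have zZ: "z \<in> Z" using z \<sigma> by (auto simp: Z_def)
    have "ein_op k q (\<lambda>z. v1 z + \<eta> z * exp ((f2 (inversion s z) + ln (s / (z \<bullet> z))) / q)) z v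
      = ein_op k q (\<lambda>z. v1 z + \<delta> * m (s, z)) z v"
    proof -
      have eq: "v1 y + \<eta> y * exp ((f2 (inversion s y) + ln (s / (y \<bullet> y))) / q) = v1 y + \<delta> * m (s, y)" if
          "y \<in> Z" for y
      proof -
        have "y \<bullet> y > 0" using that \<sigma> by (auto simp: Z_def)
        then have "(f2 (inversion s y) + ln (s / (y \<bullet> y))) / q
            = ln s / q + (f2 (inversion s y) - ln (y \<bullet> y)) / q"
          using s(1) by (simp add: ln_div add_divide_distrib diff_divide_distrib)
        then show ?thesis by (simp add: m_def \<delta>_def exp_add)
      qed
      have d1: "dderiv (\<lambda>z. v1 z + \<eta> z * exp ((f2 (inversion s z) + ln (s / (z \<bullet> z))) / q)) a y
          = dderiv (\<lambda>z. v1 z + \<delta> * m (s, z)) a y" if "y \<in> Z" for a y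
        by (rule dderiv_cong[OF Z that eq])
      have d2: "dderiv (dderiv (\<lambda>z. v1 z + \<eta> z * exp ((f2 (inversion s z) + ln (s / (z \<bullet> z))) / q)) a) b
          z = dderiv (dderiv (\<lambda>z. v1 z + \<delta> * m (s, z)) a) b z" for a b
        by (rule dderiv_cong[OF Z zZ d1])
      show ?thesis unfolding ein_op_def lap_def grad_def d2 d1[OF zZ] eq[OF zZ] ..
    qed
    also have "\<dots> = ein_form k q (v1 z + \<delta> * m (s, z)) (grad v1 z + \<delta> *\<^sub>R gm (s, z)) (hess v1 z + \<delta> *\<^sub>R
        hm (s, z)) v"
      by (rule op) (use s s' zZ in auto)
    also have "\<dots> = (norm v)\<^sup>2 * \<Phi> ((s, \<delta>), (z, sgn v))"
      using ein_form_scale[of k q _ _ _ "norm v" "sgn v"] v by (simp add: \<Phi>_def sgn_div_norm)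
    also have "\<dots> > 0"
    proof -
      have "dist (s, \<delta>) (0, 0) \<le> \<bar>s\<bar> + \<bar>\<delta>\<bar>"
        by (simp add: dist_Pair_Pair dist_real_def sqrt_sum_squares_le_sum_abs)
      also have "\<dots> < e" using s' s(1) \<delta> e' by simp
      finally have "\<Phi> ((s, \<delta>), (z, sgn v)) > 0"
        using s s' \<delta> e' z v by (intro e(2)) (auto simp: P_def Y_def norm_sgn)
      then show ?thesis using v by simp
    qed
    finally show ?thesis .
  qed
  moreover have "s0 > 0" using \<sigma> e by (simp add: s0_def)
  ultimately show ?thesis by blast
qed

text \<open>Beyond \<sigma>/2 the metric is \<open>K1\<close>; between \<sigma>/4 and \<sigma>/2 the
  other factor is being cut off; below \<sigma>/4 both factors are present in full. The inner radius
  4 s/\<sigma> is the image of \<sigma>/4 under the inversion, so the zone of pure superposition is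
  symmetric.\<close>

lemma one_side:
  "\<exists>s0>0. \<forall>s. 0 < s \<and> s < s0 \<longrightarrow> (\<exists>A. good_metric k {z. 4 * s / \<sigma> < norm z \<and> norm z < 1} A \<and>
     (\<forall>z. norm z \<ge> \<sigma> \<longrightarrow> A z = K1 z) \<and>
     (\<forall>z. 4 * s / \<sigma> < norm z \<and> norm z < \<sigma>/4 \<longrightarrow>
        A z = conf (\<lambda>z. q * ln (exp (f1 z / q) + exp ((f2 (inversion s z) + ln (s / (z \<bullet> z))) / q))) z))"
proof -
  obtain \<eta> where \<eta>: "smooth_on (UNIV :: (real ^ 'n) set) \<eta>" "\<And>z. 0 \<le> \<eta> z \<and> \<eta> z \<le> (1::real)"
    "\<And>z. norm z \<le> \<sigma>/4 \<Longrightarrow> \<eta> z = 1" "\<And>z. norm z \<ge> \<sigma>/2 \<Longrightarrow> \<eta> z = 0"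
    using smooth_bump[of "\<sigma>/4" "\<sigma>/2", where 'a = "real ^ 'n"] \<sigma> by auto
  obtain s1 where s1: "s1 > 0" "\<And>s z v. 0 < s \<Longrightarrow> s < s1 \<Longrightarrow> \<sigma>/4 \<le> norm z \<Longrightarrow> norm z \<le> \<sigma>/2 \<Longrightarrow> v \<noteq> 0 \<Longrightarrow>
    ein_op k q (\<lambda>z. v1 z + \<eta> z * exp ((f2 (inversion s z) + ln (s / (z \<bullet> z))) / q)) z v > 0"
    using cutoff_uniform[OF \<eta>(1,2)] by blast
  \<comment> \<open>For s < \<sigma>^2/16 one has 4 s/\<sigma> < \<sigma>/4, so the zone of
    superposition is not empty.\<close>
  define s0 where "s0 = min s1 (\<sigma>\<^sup>2 / 16)"
  have "\<exists>A. good_metric k {z. 4 * s / \<sigma> < norm z \<and> norm z < 1} A \<and>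
     (\<forall>z. norm z \<ge> \<sigma> \<longrightarrow> A z = K1 z) \<and>
     (\<forall>z. 4 * s / \<sigma> < norm z \<and> norm z < \<sigma>/4 \<longrightarrow>
        A z = conf (\<lambda>z. q * ln (exp (f1 z / q) + exp ((f2 (inversion s z) + ln (s / (z \<bullet> z))) / q))) z)"
    if s: "0 < s" "s < s0" for s
  proof -
    have ss: "s < s1" "s < \<sigma>\<^sup>2 / 16" using s by (auto simp: s0_def)
    then have small: "4 * s / \<sigma> < \<sigma> / 4" using \<sigma> by (simp add: divide_less_eq power2_eq_square)
    \<comment> \<open>The exponent of the other end after inversion; positivity of its Ein follows
      from invariance under \<open>pull\<close>.\<close>
    define F where "F z = f2 (inversion s z) + ln (s / (z \<bullet> z))" for z
    define Ob where "Ob = {z :: real ^ 'n. 4 * s / \<sigma> < norm z \<and> norm z < \<sigma>}"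
    have Ob: "open Ob" unfolding Ob_def by (intro open_Collect_conj open_Collect_less continuous_intros)
    have p: "4 * s / \<sigma> > 0" using s \<sigma> by simp
    have nz: "z \<noteq> 0" if "z \<in> Ob" for z using that p by (auto simp: Ob_def)
    have Obb: "Ob \<subseteq> ball 0 \<sigma>" by (auto simp: Ob_def)
    have inv: "inversion s z \<in> ball 0 \<sigma>" if "z \<in> Ob" for z
    proof -
      have "s / norm z < s / (4 * s / \<sigma>)" using that p s nz[OF that]
          by (intro divide_strict_left_mono) (auto simp: Ob_def)
      also have "\<dots> = \<sigma> / 4" using s by simp
      also have "\<dots> < \<sigma>" using \<sigma> by simp
      finally show ?thesis using s \<sigma> by (simp add: norm_inversion)
    qed
    have sinv: "smooth_on Ob (inversion s)" by (rule smooth_on_subset[OF smooth_on_inversion]) (use nz in auto)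
    have sF: "smooth_on Ob F" unfolding F_def[abs_def] using s inv nz
      by (intro smooth_on_add smooth_on_compose[OF Ob open_ball _ sinv f2] smooth_on_ln smooth_on_divide
          smooth_on_inner Ob) auto
    have "good_metric k (ball 0 \<sigma>) (conf f2)" by (rule good_metric_conf[OF open_ball f2 f2pos])
    then have "good_metric k Ob (pull (inversion s) (conf f2))"
      by (rule good_metric_pull[OF _ Ob sinv]) (use s nz inv in \<open>auto intro: inj_on_inversion
          invertible_jac_inversion\<close>)
    then have "good_metric k Ob (conf F)"
      by (rule good_metric_cong) (simp add: pull_inversion_conf nz s F_def[abs_def])
    then have Fpos: "ein_pos k (conf F) z" if "z \<in> Ob" for z using that by (simp add: good_metric_def)
    define u where "u z = v1 z + \<eta> z * exp (F z / q)" for z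
    have u: "smooth_on Ob u" unfolding u_def[abs_def] using q
      by (intro smooth_on_add smooth_on_mult smooth_on_exp smooth_on_divide smooth_on_subset[OF v1(1) Obb]
         smooth_on_subset[OF \<eta>(1)] sF Ob smooth_on_const) auto
    have upos: "u z > 0" for z unfolding u_def using v1(2) \<eta>(2) by (simp add: add_pos_nonneg)
    define c where "c z = q * ln (u z)" for z
    have cf1: "c z = f1 z" if "norm z \<ge> \<sigma> / 2" for z
      using \<eta>(4)[OF that] q by (simp add: c_def u_def v1_def)
    have csup: "c z = q * ln (exp (f1 z / q) + exp (F z / q))" if "norm z \<le> \<sigma> / 4" for z
      using \<eta>(3)[OF that] by (simp add: c_def u_def v1_def)
    have cpos: "ein_pos k (conf c) z" if z: "z \<in> Ob" for z
    proof -
      consider "norm z < \<sigma>/4" | "\<sigma>/4 \<le> norm z" "norm z \<le> \<sigma>/2" | "norm z > \<sigma>/2" by linarith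
      then show ?thesis
      proof cases
        case 1
        let ?V = "Ob \<inter> ball 0 (\<sigma>/4)"
        have zV: "z \<in> ?V" using z 1 by simp
        have "ein_pos k (conf (\<lambda>y. q * ln (exp (f1 y / q) + exp (F y / q)))) z"
          by (rule ein_pos_superpose[OF _ zV _ _ q quad f1pos Fpos[OF z]])
            (use Ob Obb z in \<open>auto intro!: smooth_on_subset[OF f1] smooth_on_subset[OF sF]\<close>)
        moreover have "ein_pos k (conf c) z \<longleftrightarrow> ein_pos k (conf (\<lambda>y. q * ln (exp (f1 y / q) + exp (F y / q)))) z"
          by (rule ein_pos_cong[of ?V]) (use Ob zV csup in \<open>auto simp: conf_def\<close>)
        ultimately show ?thesis by simp
      next
        case 2
        show ?thesis unfolding c_def[abs_def] ein_pos_conf_ln[OF Ob z u upos q]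
          using s1(2)[OF s(1) ss(1) 2] unfolding u_def[abs_def] F_def by blast
      next
        case 3
        have "ein_pos k (conf c) z \<longleftrightarrow> ein_pos k (conf f1) z"
          by (rule ein_pos_cong[of "- cball 0 (\<sigma>/2)"]) (use 3 cf1 in \<open>auto simp: conf_def\<close>)
        then show ?thesis using f1pos z Obb by blast
      qed
    qed
    have gc: "good_metric k Ob (conf c)"
      unfolding c_def[abs_def]
      by (rule good_metric_conf[OF Ob]) (use u upos Ob cpos[unfolded c_def[abs_def]] in \<open>auto intro!:
          smooth_on_mult smooth_on_ln\<close>)
    \<comment> \<open>The two formulas agree for \<sigma>/2 < |z| < \<sigma>, where the cutoff
      vanishes.\<close>
    define A where "A z = (if norm z < \<sigma> then conf c z else K1 z)" for z
    have "good_metric k Ob A" by (rule good_metric_cong[OF gc]) (simp add: A_def Ob_def)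
    moreover have "good_metric k (ball 0 1 - cball 0 (\<sigma>/2)) A"
    proof (rule good_metric_cong)
      show "good_metric k (ball 0 1 - cball 0 (\<sigma>/2)) K1" by (rule good_metric_subset[OF K1]) auto
      fix y :: "real ^ 'n" assume "y \<in> ball 0 1 - cball 0 (\<sigma>/2)"
      then show "K1 y = A y" using K1f[of y] cf1[of y] by (simp add: A_def conf_def)
    qed
    ultimately have "good_metric k (Ob \<union> (ball 0 1 - cball 0 (\<sigma>/2))) A" by (rule good_metric_Un)
    moreover have "Ob \<union> (ball 0 1 - cball 0 (\<sigma>/2)) = {z. 4 * s / \<sigma> < norm z \<and> norm z < 1}"
      using small \<sigma> by (auto simp: Ob_def)
    ultimately have "good_metric k {z. 4 * s / \<sigma> < norm z \<and> norm z < 1} A" by simp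
    moreover have "A z = conf (\<lambda>z. q * ln (exp (f1 z / q) + exp (F z / q))) z" if "norm z < \<sigma>/4" for z
      using that csup[of z] \<sigma> by (simp add: A_def conf_def)
    ultimately show ?thesis unfolding F_def by (intro exI[of _ A]) (auto simp: A_def)
  qed
  then show ?thesis using s1(1) \<sigma> by (intro exI[of _ s0]) (auto simp: s0_def)
qed

end

text \<open>The superposed factor treats both ends alike, so the inversion exchanges the metrics
  built from the two ends on 4 s/\<sigma> < |z| < \<sigma>/4, and they can be joined there. The
  equation for \<open>pull (inversion s) K\<close> says that the neck, seen from the other side,
  ends in \<open>K2\<close>. The bound 3/16 serves the radial reparametrisation of the
  gluing.\<close>

lemma neck:
  fixes K1 K2 :: "real ^ 'n::finite \<Rightarrow> real ^ 'n ^ 'n"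
  assumes K1: "good_metric k (ball 0 1) K1" and K2: "good_metric k (ball 0 1) K2"
    and \<sigma>: "0 < \<sigma>" "\<sigma> \<le> 1/2"
    and f1: "smooth_on (ball 0 \<sigma>) f1" "\<And>z. z \<in> ball 0 \<sigma> \<Longrightarrow> K1 z = conf f1 z"
    and f2: "smooth_on (ball 0 \<sigma>) f2" "\<And>z. z \<in> ball 0 \<sigma> \<Longrightarrow> K2 z = conf f2 z"
    and n: "CARD('n) \<ge> 3" "k < real CARD('n) - 1"
  shows "\<exists>s K. 0 < s \<and> s < 3/16 \<and> good_metric k {z. s < norm z \<and> norm z < 1} K \<and>
    (\<forall>z. 1/2 \<le> norm z \<and> norm z < 1 \<longrightarrow> K z = K1 z \<and> pull (inversion s) K z = K2 z)"
proof -
  obtain q where q: "q > 0" "\<And>v a :: real ^ 'n. ein_quad k q v a \<le> 0" using ein_quad_nonpos[OF n] by blast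
  have fpos: "ein_pos k (conf f) z" if "good_metric k (ball 0 1) K" "\<And>z. z \<in> ball 0 \<sigma> \<Longrightarrow> K z = conf f z"
      "z \<in> ball 0 \<sigma>" 
    for K and f :: "real ^ 'n \<Rightarrow> real" and z
  proof -
    have "ein_pos k K z \<longleftrightarrow> ein_pos k (conf f) z" by (rule ein_pos_cong[OF open_ball that(3,2)])
    then show ?thesis using that \<sigma> by (auto simp: good_metric_def)
  qed
  interpret A1: neck_side k q \<sigma> K1 f1 f2
    by unfold_locales (use K1 \<sigma> f1 f2 q fpos[OF K2 f2(2)] in auto)
  interpret A2: neck_side k q \<sigma> K2 f2 f1
    by unfold_locales (use K2 \<sigma> f1 f2 q fpos[OF K1 f1(2)] in auto)
  let ?sup = "\<lambda>f g s z. q * ln (exp (f z / q) + exp ((g (inversion s z) + ln (s / (z \<bullet> z))) / q))"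
  obtain s1 where s1: "s1 > 0" "\<And>s. 0 < s \<Longrightarrow> s < s1 \<Longrightarrow> \<exists>A. good_metric k {z. 4 * s / \<sigma> < norm z \<and> norm z < 1} A \<and>
     (\<forall>z. norm z \<ge> \<sigma> \<longrightarrow> A z = K1 z) \<and> (\<forall>z. 4 * s / \<sigma> < norm z \<and> norm z < \<sigma>/4 \<longrightarrow> A z = conf (?sup f1 f2 s) z)"
    using A1.one_side by blast
  obtain s2 where s2: "s2 > 0" "\<And>s. 0 < s \<Longrightarrow> s < s2 \<Longrightarrow> \<exists>A. good_metric k {z. 4 * s / \<sigma> < norm z \<and> norm z < 1} A \<and>
     (\<forall>z. norm z \<ge> \<sigma> \<longrightarrow> A z = K2 z) \<and> (\<forall>z. 4 * s / \<sigma> < norm z \<and> norm z < \<sigma>/4 \<longrightarrow> A z = conf (?sup f2 f1 s) z)"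
    using A2.one_side by blast
  define s where "s = min (min s1 s2) (\<sigma>\<^sup>2/16) / 2"
  have s: "0 < s" "s < s1" "s < s2" "s < \<sigma>\<^sup>2/16" using s1 s2 \<sigma> by (auto simp: s_def min_def)
  have "\<sigma>\<^sup>2 \<le> (1/2)\<^sup>2" using \<sigma> by (intro power_mono) auto
  then have s316: "s < 1/64" using s(4) by (simp add: power2_eq_square)
  \<comment> \<open>The radius of the sphere fixed by the inversion; it lies in the zone where both
    descriptions agree.\<close>
  define r where "r = sqrt s"
  have r: "r > 0" "r * r = s" using s by (simp_all add: r_def)
  have r4: "r < \<sigma> / 4"
  proof -
    have "r < sqrt ((\<sigma>/4)\<^sup>2)" unfolding r_def using s(4) by (intro real_sqrt_less_mono) (simp add:
        power2_eq_square)
    then show ?thesis using \<sigma> by simp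
  qed
  have r5: "4 * s / \<sigma> < r"
    using r4 r \<sigma> mult_strict_left_mono[OF r4 r(1)] by (simp add: divide_less_eq field_simps)
  have s4: "s < 4 * s / \<sigma>" using s \<sigma> by (simp add: less_divide_eq)
  obtain A where A: "good_metric k {z. 4 * s / \<sigma> < norm z \<and> norm z < 1} A" "\<And>z. norm z \<ge> \<sigma> \<Longrightarrow> A z = K1 z"
     "\<And>z. 4 * s / \<sigma> < norm z \<Longrightarrow> norm z < \<sigma>/4 \<Longrightarrow> A z = conf (?sup f1 f2 s) z"
    using s1(2)[OF s(1,2)] by blast
  obtain B where B: "good_metric k {z. 4 * s / \<sigma> < norm z \<and> norm z < 1} B" "\<And>z. norm z \<ge> \<sigma> \<Longrightarrow> B z = K2 z"
     "\<And>z. 4 * s / \<sigma> < norm z \<Longrightarrow> norm z < \<sigma>/4 \<Longrightarrow> B z = conf (?sup f2 f1 s) z"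
    using s2(2)[OF s(1,3)] by blast
  let ?i = "inversion s :: real ^ 'n \<Rightarrow> _"
  have ni: "norm (?i z) = s / norm z" for z using s by (simp add: norm_inversion)
  have agree: "A z = pull ?i B z" if z: "4 * s / \<sigma> < norm z" "norm z < \<sigma>/4" for z
  proof -
    have "0 < 4 * s / \<sigma>" using s \<sigma> by simp
    then have nz: "z \<noteq> 0" using z(1) by (metis less_asym norm_zero)
    have zz: "z \<bullet> z > 0" using nz by simp
    have "4 * s / \<sigma> < norm (?i z)" "norm (?i z) < \<sigma> / 4"
      using z nz s \<sigma> by (simp_all add: ni field_simps)
    then have "pull ?i B z = pull ?i (conf (?sup f2 f1 s)) z" using B(3) by (simp add: pull_def)
    also have "\<dots> = conf (\<lambda>z. ?sup f2 f1 s (?i z) + ln (s / (z \<bullet> z))) z"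
      by (rule pull_inversion_conf[OF nz s(1)])
    also have "?sup f2 f1 s (?i z) + ln (s / (z \<bullet> z)) = ?sup f1 f2 s z"
    proof -
      \<comment> \<open>The exponent gained by the inversion, which changes sign under it.
        Multiplying the sum of the two powers by exp(L/q) moves L from one summand to the
        other.\<close>
      define L where "L = ln (s / (z \<bullet> z))"
      have "s / (?i z \<bullet> ?i z) = inverse (s / (z \<bullet> z))"
        using s zz by (simp add: inversion_def field_simps)
      then have l: "ln (s / (?i z \<bullet> ?i z)) = - L" unfolding L_def using s zz ln_inverse[of
          "s / (z \<bullet> z)"] by (simp only: divide_pos_pos)
      have "L = q * ln (exp (L / q))" using q by simp
      then have "?sup f2 f1 s (?i z) + L = q * (ln (exp (f2 (?i z) / q) + exp ((f1 z - L) / q)) + ln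
          (exp (L / q)))"
        using s by (simp add: inversion_inversion l distrib_left del: ln_exp)
      also have "\<dots> = q * ln ((exp (f2 (?i z) / q) + exp ((f1 z - L) / q)) * exp (L / q))"
        by (simp add: ln_mult_pos add_pos_pos del: ln_exp)
      also have "(exp (f2 (?i z) / q) + exp ((f1 z - L) / q)) * exp (L / q)
          = exp (f1 z / q) + exp ((f2 (?i z) + L) / q)"
        by (simp add: distrib_right add_divide_distrib diff_divide_distrib flip: exp_add)
      finally show ?thesis unfolding L_def .
    qed
    then have "conf (\<lambda>z. ?sup f2 f1 s (?i z) + ln (s / (z \<bullet> z))) z = conf (?sup f1 f2 s) z"
      by (simp only: conf_def)
    also have "\<dots> = A z" using A(3)[OF z] by simp
    finally show ?thesis by simp
  qed
  define K where "K z = (if norm z \<ge> r then A z else pull ?i B z)" for z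
  let ?U = "{z :: real ^ 'n. 4 * s / \<sigma> < norm z \<and> norm z < 1}" and ?V = "{z :: real ^ 'n. s < norm z
      \<and> norm z < \<sigma>/4}"
  have "good_metric k ?U K"
    by (rule good_metric_cong[OF A(1)]) (use agree r4 in \<open>auto simp: K_def\<close>)
  moreover have "good_metric k ?V K"
  proof (rule good_metric_cong)
    show "good_metric k ?V (pull ?i B)"
    proof (rule good_metric_pull[OF B(1)])
      show "open ?V" by (intro open_Collect_conj open_Collect_less continuous_intros)
      show "smooth_on ?V ?i" by (rule smooth_on_subset[OF smooth_on_inversion]) (use s in auto)
      show "inj_on ?i ?V" using s by (intro inj_on_inversion) auto
      show "invertible (jac ?i y)" if "y \<in> ?V" for y using that s by (intro invertible_jac_inversion) auto
      show "?i ` ?V \<subseteq> {z. 4 * s / \<sigma> < norm z \<and> norm z < 1}"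
        using s \<sigma> by (auto simp: ni divide_less_eq less_divide_eq mult.commute intro: less_trans)
    qed
    fix y assume "y \<in> ?V"
    then show "pull ?i B y = K y" using agree[of y] r5 by (auto simp: K_def)
  qed
  ultimately have "good_metric k (?U \<union> ?V) K" by (rule good_metric_Un)
  moreover have "?U \<union> ?V = {z. s < norm z \<and> norm z < 1}"
    using s4 r4 r5 \<sigma> by auto
  ultimately have "good_metric k {z. s < norm z \<and> norm z < 1} K" by simp
  moreover have "K z = K1 z \<and> pull ?i K z = K2 z" if z: "1/2 \<le> norm z" "norm z < 1" for z
  proof -
    have nz: "z \<noteq> 0" using z by auto
    \<comment> \<open>The inverted point has norm at most 2 s < sqrt s, hence lies in the part of
      \<open>K\<close> defined through \<open>B\<close>, and the two inversions cancel.\<close>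
    have "s / norm z \<le> s / (1/2)" using z s by (intro divide_left_mono) auto
    also have "\<dots> < r"
    proof -
      have "r * (2 * r) < r * 1" using r r4 \<sigma> by (intro mult_strict_left_mono) auto
      then show ?thesis using r(2) by simp
    qed
    finally have "K (?i z) = pull ?i B (?i z)" by (simp add: K_def ni)
    then have "pull ?i K z = pull ?i (pull ?i B) z" by (simp add: pull_def)
    also have "\<dots> = B z" by (rule pull_inversion_inversion[OF nz s(1)])
    also have "\<dots> = K2 z" using z \<sigma> by (intro B(2)) auto
    finally show ?thesis using z \<sigma> r4 A(2)[of z] by (simp add: K_def)
  qed
  ultimately show ?thesis using s s316 by (intro exI[of _ s] exI[of _ K]) auto
qed

section \<open>Charts\<close>

lemma chart_onD:
  assumes "chart_on X c"
  shows "openin X (fst c)" "open (chart_image c)" "inj_on (snd c) (fst c)" "fst c \<subseteq> topspace X"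
    "\<And>W. openin X W \<Longrightarrow> open (snd c ` (fst c \<inter> W))"
    "\<And>O'. open O' \<Longrightarrow> openin X {p \<in> fst c. snd c p \<in> O'}"
proof -
  show o: "openin X (fst c)" and i: "open (chart_image c)" using assms by (auto simp: chart_on_def)
  then show sub: "fst c \<subseteq> topspace X" by (simp add: openin_subset)
  have h: "homeomorphic_map (subtopology X (fst c)) (top_of_set (chart_image c)) (snd c)" using assms
      by (simp add: chart_on_def)
  have top: "topspace (subtopology X (fst c)) = fst c" using sub by auto
  show "inj_on (snd c) (fst c)" using homeomorphic_imp_injective_map[OF h] top by simp
  have om: "open_map (subtopology X (fst c)) (top_of_set (chart_image c)) (snd c)"
    using h homeomorphic_imp_open_map by blast
  show "open (snd c ` (fst c \<inter> W))" if "openin X W" for W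
  proof -
    have "openin (subtopology X (fst c)) (fst c \<inter> W)" using that by (metis inf_commute openin_subtopology)
    then have "openin (top_of_set (chart_image c)) (snd c ` (fst c \<inter> W))" using om by (simp add: open_map_def)
    then show ?thesis using i openin_open_trans by blast
  qed
  have cm: "continuous_map (subtopology X (fst c)) (top_of_set (chart_image c)) (snd c)"
    using h homeomorphic_imp_continuous_map by blast
  show "openin X {p \<in> fst c. snd c p \<in> O'}" if "open O'" for O'
  proof -
    have "openin (top_of_set (chart_image c)) (chart_image c \<inter> O')" using that by auto
    then have "openin (subtopology X (fst c)) {p \<in> topspace (subtopology X (fst c)). snd c p \<in>
        chart_image c \<inter> O'}"
      using cm openin_continuous_map_preimage by blast
    then have "openin X {p \<in> topspace (subtopology X (fst c)). snd c p \<in> chart_image c \<inter> O'}"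
      using o openin_trans_full by blast
    moreover have "{p \<in> topspace (subtopology X (fst c)). snd c p \<in> chart_image c \<inter> O'}
        = {p \<in> fst c. snd c p \<in> O'}"
      unfolding top by blast
    ultimately show ?thesis by (simp only:)
  qed
qed

lemma chart_onI:
  assumes o: "openin X U" and inj: "inj_on \<phi> U"
    and im: "\<And>W. openin X W \<Longrightarrow> open (\<phi> ` (U \<inter> W))"
    and pre: "\<And>O'. open O' \<Longrightarrow> openin X {p \<in> U. \<phi> p \<in> O'}"
  shows "chart_on X (U, \<phi>)"
proof -
  have sub: "U \<subseteq> topspace X" using o openin_subset by blast
  then have top: "topspace (subtopology X U) = U" by auto
  have i: "open (\<phi> ` U)" using im[OF o] by simp
  have "homeomorphic_map (subtopology X U) (top_of_set (\<phi> ` U)) \<phi>"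
  proof (rule bijective_open_imp_homeomorphic_map)
    show "continuous_map (subtopology X U) (top_of_set (\<phi> ` U)) \<phi>"
      unfolding continuous_map_def top
    proof (intro conjI allI impI)
      show "\<phi> \<in> U \<rightarrow> topspace (top_of_set (\<phi> ` U))" by auto
      fix S assume "openin (top_of_set (\<phi> ` U)) S"
      then have "open S" using i openin_open_trans by blast
      then have "openin X {p \<in> U. \<phi> p \<in> S}" by (rule pre)
      then show "openin (subtopology X U) {x \<in> U. \<phi> x \<in> S}"
        by (metis (no_types, lifting) mem_Collect_eq openin_open_subtopology o subsetI)
    qed
    show "open_map (subtopology X U) (top_of_set (\<phi> ` U)) \<phi>"
      unfolding open_map_def
    proof (intro allI impI)
      fix S assume "openin (subtopology X U) S"
      then have S: "openin X S" "S \<subseteq> U" using o by (auto simp: openin_open_subtopology)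
      then have "open (\<phi> ` S)" using im[OF S(1)] by (simp add: Int_absorb1)
      then show "openin (top_of_set (\<phi> ` U)) (\<phi> ` S)" using S(2) by (metis image_mono open_subset)
    qed
  qed (use top inj in auto)
  then show ?thesis using o i by (simp add: chart_on_def)
qed

section \<open>The maximal atlas and its transition maps\<close>

lemma chartsD: "c \<in> charts M \<Longrightarrow> chart_on (mtop M) c" "c \<in> charts M \<Longrightarrow> d \<in> atlas M \<Longrightarrow> compatible c d"
  by (auto simp: charts_def)

lemmas chartD = chart_onD[OF chartsD(1)]

lemma transition_apply: "inj_on (snd c) (fst c) \<Longrightarrow> p \<in> fst c \<Longrightarrow> transition c d (snd c p) = snd d p"
  by (simp add: transition_def)

lemma transition_chart: "c \<in> charts M \<Longrightarrow> p \<in> fst c \<Longrightarrow> transition c d (snd c p) = snd d p"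
  by (rule transition_apply[OF chartD(3)])

locale smooth_mfd =
  fixes M :: "('a, 'n::finite) manifold"
  assumes M: "smooth_manifold M"
begin

lemma atlas_cover: "p \<in> topspace (mtop M) \<Longrightarrow> \<exists>e\<in>atlas M. p \<in> fst e"
  using M unfolding smooth_manifold_def by blast

lemma atlas_charts: "e \<in> atlas M \<Longrightarrow> e \<in> charts M"
  using M unfolding smooth_manifold_def charts_def by blast

lemma open_overlap: "c \<in> charts M \<Longrightarrow> d \<in> charts M \<Longrightarrow> open (snd c ` (fst c \<inter> fst d))"
  by (rule chartD(5)[OF _ chartD(1)])

text \<open>Members of \<open>charts\<close> are by definition compatible only with the atlas, so
  near each point the transition is factored through an atlas chart.\<close>

lemma smooth_transition:
  assumes c: "c \<in> charts M" and d: "d \<in> charts M"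
  shows "smooth_on (snd c ` (fst c \<inter> fst d)) (transition c d)"
proof (rule smooth_on_local)
  fix x assume "x \<in> snd c ` (fst c \<inter> fst d)"
  then obtain p where p: "p \<in> fst c" "p \<in> fst d" "x = snd c p" by auto
  obtain e where e: "e \<in> atlas M" "p \<in> fst e" using atlas_cover chartD(4)[OF c] p(1) by blast
  note ec = atlas_charts[OF e(1)]
  let ?O = "snd c ` (fst c \<inter> (fst d \<inter> fst e))"
  have O: "open ?O" by (rule chartD(5)[OF c]) (intro openin_Int chartD(1) d ec)
  have s1: "smooth_on ?O (transition c e)"
    by (rule smooth_on_subset[of "snd c ` (fst c \<inter> fst e)"]) (use chartsD(2)[OF c e(1)] in \<open>auto simp:
        compatible_def\<close>)
  have s2: "smooth_on (snd e ` (fst d \<inter> fst e)) (transition e d)"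
    using chartsD(2)[OF d e(1)] by (auto simp: compatible_def)
  have "open (snd e ` (fst d \<inter> fst e))" using open_overlap[OF ec d] by (simp add: Int_commute)
  then have "smooth_on ?O (\<lambda>y. transition e d (transition c e y))"
    by (rule smooth_on_compose[OF O _ _ s1 s2]) (auto simp: transition_chart[OF c])
  then have "smooth_on ?O (transition c d)"
    by (rule smooth_on_cong[OF O, rotated]) (auto simp: transition_chart[OF c] transition_chart[OF ec])
  then show "\<exists>T. open T \<and> x \<in> T \<and> smooth_on T (transition c d)" using O p e by (intro exI[of _ ?O]) auto
qed

lemma transition_differentiable:
  "c \<in> charts M \<Longrightarrow> d \<in> charts M \<Longrightarrow> p \<in> fst c \<Longrightarrow> p \<in> fst d \<Longrightarrow> transition c d differentiable (at (snd c p))"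
  by (rule smooth_on_differentiable[OF smooth_transition]) auto

lemma jac_cocycle:
  assumes c: "c \<in> charts M" and d: "d \<in> charts M" and e: "e \<in> charts M" and p: "p \<in> fst c" "p \<in> fst d"
      "p \<in> fst e"
  shows "jac (transition c e) (snd c p) = jac (transition d e) (snd d p) ** jac (transition c d) (snd c p)"
proof -
  let ?O = "snd c ` (fst c \<inter> (fst d \<inter> fst e))"
  have O: "open ?O" by (rule chartD(5)[OF c]) (intro openin_Int chartD(1) d e)
  have "jac (transition c e) (snd c p) = jac (\<lambda>y. transition d e (transition c d y)) (snd c p)"
    by (rule jac_cong[OF O]) (use p in \<open>auto simp: transition_chart[OF c] transition_chart[OF d]\<close>)
  also have "\<dots> = jac (transition d e) (transition c d (snd c p)) ** jac (transition c d) (snd c p)"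
    by (rule jac_compose) (use transition_differentiable c d e p in \<open>auto simp: transition_chart[OF c]\<close>)
  finally show ?thesis by (simp add: transition_chart[OF c] p)
qed

lemma jac_self:
  assumes c: "c \<in> charts M" and p: "p \<in> fst c"
  shows "jac (transition c c) (snd c p) = mat 1"
proof -
  have "jac (transition c c) (snd c p) = jac (\<lambda>y. y) (snd c p)"
    by (rule jac_cong[OF chartD(2)[OF c]]) (use p in \<open>auto simp: transition_chart[OF c]\<close>)
  then show ?thesis by (simp add: jac_ident)
qed

lemma jac_inverse:
  assumes "c \<in> charts M" "d \<in> charts M" "p \<in> fst c" "p \<in> fst d"
  shows "jac (transition d c) (snd d p) ** jac (transition c d) (snd c p) = mat 1"
  using jac_cocycle[of c d c p] jac_self[of c p] assms by simp

lemma invertible_jac_transition: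
  assumes "c \<in> charts M" "d \<in> charts M" "p \<in> fst c" "p \<in> fst d"
  shows "invertible (jac (transition c d) (snd c p))"
  using jac_inverse[OF assms] invertible_left_inverse by blast

text \<open>The chain rule for transitions carries a relation between the expressions in d and e
  over to a third chart. It makes compatibility of local metrics at a point transitive and, with
  \<open>pull_self\<close>, symmetric.\<close>

lemma pull_cocycle:
  assumes c: "c \<in> charts M" and d: "d \<in> charts M" and e: "e \<in> charts M" and p: "p \<in> fst c" "p \<in> fst d"
      "p \<in> fst e"
    and G: "G (snd d p) = pull (transition d e) H (snd d p)"
  shows "pull (transition c d) G (snd c p) = pull (transition c e) H (snd c p)"
  unfolding pull_def jac_cocycle[OF c d e p] transition_chart[OF c p(1)]
  by (simp add: G pull_def transition_chart[OF d p(2)] matrix_transpose_mul matrix_mul_assoc)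

lemma pull_self:
  assumes c: "c \<in> charts M" and p: "p \<in> fst c"
  shows "pull (transition c c) G (snd c p) = G (snd c p)"
  by (simp add: pull_def jac_self[OF c p] transition_chart[OF c p] transpose_mat)

lemma compat_sym:
  assumes c: "c \<in> charts M" and d: "d \<in> charts M" and p: "p \<in> fst c" "p \<in> fst d"
    and G: "G (snd c p) = pull (transition c d) H (snd c p)"
  shows "H (snd d p) = pull (transition d c) G (snd d p)"
  using pull_cocycle[where c=d and d=c and e=d and p=p and G=G and H=H] pull_self[OF d p(2), of H] c d p
      G by simp

lemma transition_inj_on:
  assumes c: "c \<in> charts M" and d: "d \<in> charts M" 
  shows "inj_on (transition c d) (snd c ` (fst c \<inter> fst d))"
  using chartD(3)[OF d] by (auto simp: inj_on_def transition_chart[OF c])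

lemma good_metric_transition:
  assumes c: "c \<in> charts M" and d: "d \<in> charts M" and G: "good_metric k (chart_image d) G"
  shows "good_metric k (snd c ` (fst c \<inter> fst d)) (pull (transition c d) G)"
  by (rule good_metric_pull[OF G open_overlap[OF c d] smooth_transition[OF c d] transition_inj_on[OF c d]])
    (use invertible_jac_transition[OF c d] in \<open>auto simp: transition_chart[OF c]\<close>)

text \<open>The source of special charts: conformal charts and the two charts of the neck arise from
  given ones by composition with an injective local diffeomorphism.\<close>

lemma compose_chart:
  assumes d: "d \<in> charts M" and W: "open W" "W \<subseteq> chart_image d" and \<theta>: "smooth_on W \<theta>" "inj_on \<theta> W"
    "\<And>x. x \<in> W \<Longrightarrow> invertible (jac \<theta> x)"
  shows "({p \<in> fst d. snd d p \<in> W}, \<lambda>p. \<theta> (snd d p)) \<in> charts M"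
proof -
  let ?U = "{p \<in> fst d. snd d p \<in> W}" and ?\<phi> = "\<lambda>p. \<theta> (snd d p)"
  have U: "openin (mtop M) ?U" by (rule chartD(6)[OF d W(1)])
  note inv = smooth_on_inv_into[OF W(1) \<theta>]
  have inj: "inj_on ?\<phi> ?U" using chartD(3)[OF d] \<theta>(2) by (auto simp: inj_on_def)
  have ch: "chart_on (mtop M) (?U, ?\<phi>)"
  proof (rule chart_onI[OF U inj])
    fix O' assume "openin (mtop M) O'"
    then have o: "open (snd d ` (fst d \<inter> (?U \<inter> O')))" by (intro chartD(5)[OF d] openin_Int U)
    have e: "?\<phi> ` (?U \<inter> O') = \<theta> ` (snd d ` (fst d \<inter> (?U \<inter> O')))" by auto
    have sub: "snd d ` (fst d \<inter> (?U \<inter> O')) \<subseteq> W" by auto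
    show "open (?\<phi> ` (?U \<inter> O'))" unfolding e
      by (rule invariance_of_domain[OF continuous_on_subset[OF smooth_on_continuous[OF \<theta>(1)] sub] o
          inj_on_subset[OF \<theta>(2) sub]])
  next
    fix O' :: "(real ^ 'n) set" assume "open O'"
    then have "open (W \<inter> \<theta> -` O')" using smooth_on_continuous[OF \<theta>(1)] W(1)
        by (metis continuous_on_open_vimage inf_commute)
    from chartD(6)[OF d this] show "openin (mtop M) {p \<in> ?U. ?\<phi> p \<in> O'}" by (auto elim: back_subst[of
        "openin (mtop M)"])
  qed
  have "compatible (?U, ?\<phi>) a" if a: "a \<in> atlas M" for a
  proof -
    note ac = atlas_charts[OF a]
    let ?c = "(?U, ?\<phi>)"
    have Oc: "open (snd ?c ` (fst ?c \<inter> fst a))" by (rule chart_onD(5)[OF ch chartD(1)[OF ac]])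
    have Oa: "open (snd a ` (fst a \<inter> ?U))" by (rule chartD(5)[OF ac U])
    have "smooth_on (snd ?c ` (fst ?c \<inter> fst a)) (\<lambda>y. transition d a (inv_into W \<theta> y))"
      by (rule smooth_on_compose[OF Oc open_overlap[OF d ac] _ smooth_on_subset[OF inv(2)]
          smooth_transition[OF d ac]])
        (use \<theta>(2) in auto)
    then have 1: "smooth_on (snd ?c ` (fst ?c \<inter> fst a)) (transition ?c a)"
      by (rule smooth_on_cong[OF Oc, rotated]) (use inj \<theta>(2) in \<open>auto simp: transition_apply[where
          c="?c", simplified] transition_chart[OF d]\<close>)
    have "smooth_on (snd a ` (fst a \<inter> ?U)) (\<lambda>y. \<theta> (transition a d y))"
      by (rule smooth_on_compose[OF Oa W(1) _ smooth_on_subset[OF smooth_transition[OF ac d]] \<theta>(1)])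
        (auto simp: transition_chart[OF ac])
    then have 2: "smooth_on (snd a ` (fst a \<inter> ?U)) (transition a ?c)"
      by (rule smooth_on_cong[OF Oa, rotated]) (auto simp: transition_chart[OF ac])
    show ?thesis unfolding compatible_def using 1 2 by (simp add: Int_commute)
  qed
  then show ?thesis using ch by (simp add: charts_def)
qed

lemma restrict_chart:
  assumes d: "d \<in> charts M" and W: "openin (mtop M) W"
  shows "(fst d \<inter> W, snd d) \<in> charts M"
proof -
  let ?O = "snd d ` (fst d \<inter> W)"
  have O: "open ?O" "?O \<subseteq> chart_image d" using chartD(5)[OF d W] by auto
  have "({p \<in> fst d. snd d p \<in> ?O}, \<lambda>p. snd d p) \<in> charts M"
    by (rule compose_chart[OF d O, of "\<lambda>x. x"])
      (auto simp: jac_ident invertible_right_inverse[of "mat 1 :: real ^ 'n ^ 'n"] intro: exI[of _ "mat 1"])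
  moreover have "{p \<in> fst d. snd d p \<in> ?O} = fst d \<inter> W"
    using chartD(3)[OF d] by (auto simp: inj_on_def)
  ultimately show ?thesis by (simp add: eta_contract_eq)
qed

end

section \<open>Metrics from compatible families\<close>

lemma good_metric_local:
  assumes "\<And>x. x \<in> U \<Longrightarrow> \<exists>W. x \<in> W \<and> good_metric k W K"
  shows "open U \<Longrightarrow> good_metric k U K"
  unfolding good_metric_def
proof (intro conjI ballI)
  show "smooth_on U K" using assms unfolding good_metric_def by (intro smooth_on_local) meson
qed (use assms in \<open>unfold good_metric_def, blast+\<close>)

context smooth_mfd begin

lemma tensor_transform:
  assumes g: "riemannian_manifold M g" and cd: "c \<in> charts M" "d \<in> charts M" "p \<in> fst c" "p \<in> fst d"
  shows "g c (snd c p) = pull (transition c d) (g d) (snd c p)"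
  using assms unfolding riemannian_manifold_def smooth_tensor2_def pull_def jac_def Let_def by blast

text \<open>Conformal flatness at a point is witnessed by the transition map to a conformal chart
  containing it; the other properties are the hypotheses read in the chart c.\<close>

lemma charts_good:
  assumes g: "riemannian_manifold M g" and lcf: "locally_conformally_flat M g"
    and pos: "positive_tensor2 M (Ein k g)" and c: "c \<in> charts M"
  shows "good_metric k (chart_image c) (g c)"
  unfolding good_metric_def
proof (intro conjI ballI)
  show "open (chart_image c)" by (rule chartD(2)[OF c])
  show "smooth_on (chart_image c) (g c)" using g c by (simp add: riemannian_manifold_def smooth_tensor2_def)
  fix x assume x: "x \<in> chart_image c"
  show "transpose (g c x) = g c x" using g c x unfolding riemannian_manifold_def symmetric_tensor2_def by blast
  show "\<forall>v. v \<noteq> 0 \<longrightarrow> v \<bullet> (g c x *v v) > 0" using g c x unfolding riemannian_manifold_def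
      positive_tensor2_def by blast
  show "ein_pos k (g c) x" using pos c x unfolding positive_tensor2_def ein_pos_def Ein_eq_EinM by blast
  obtain p where p: "p \<in> fst c" "x = snd c p" using x by auto
  obtain e f where e: "e \<in> charts M" "p \<in> fst e" "smooth_on (chart_image e) f" "\<And>y. y \<in> chart_image e
      \<Longrightarrow> g e y = conf f y"
    using lcf chartD(4)[OF c] p(1) unfolding locally_conformally_flat_def conf_def by blast
  show "conf_flat_at (g c) x" unfolding conf_flat_at_def
  proof (intro exI conjI ballI)
    show "open (snd c ` (fst c \<inter> fst e))" "x \<in> snd c ` (fst c \<inter> fst e)"
        using open_overlap[OF c e(1)] p e(2) by auto
    show "smooth_on (snd c ` (fst c \<inter> fst e)) (transition c e)" by (rule smooth_transition[OF c e(1)])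
    show "inj_on (transition c e) (snd c ` (fst c \<inter> fst e))" by (rule transition_inj_on[OF c e(1)])
    show "smooth_on (transition c e ` snd c ` (fst c \<inter> fst e)) f"
      by (rule smooth_on_subset[OF e(3)]) (auto simp: transition_chart[OF c])
    fix y assume "y \<in> snd c ` (fst c \<inter> fst e)"
    then obtain r where r: "r \<in> fst c" "r \<in> fst e" "y = snd c r" by auto
    show "invertible (jac (transition c e) y)" using invertible_jac_transition[OF c e(1)] r by simp
    have "g c y = pull (transition c e) (g e) y"
      unfolding r(3) by (rule tensor_transform[OF g c e(1) r(1,2)])
    then show "g c y = pull (transition c e) (conf f) y"
      using e(4) r by (simp add: pull_def transition_chart[OF c])
  qed
qed

text \<open>A tensor has to be given on every chart of the maximal atlas. At each point some member
  of the family is chosen and pulled back; compatibility makes the value independent of the choice,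
  and this yields smoothness and the transformation law.\<close>

lemma metric_from_family:
  fixes P :: "(('a, 'n) chart \<times> (real ^ 'n \<Rightarrow> real ^ 'n ^ 'n)) set"
  assumes P: "\<And>d G. (d, G) \<in> P \<Longrightarrow> d \<in> charts M \<and> good_metric k (chart_image d) G"
    and cover: "\<And>p. p \<in> topspace (mtop M) \<Longrightarrow> \<exists>(d, G)\<in>P. p \<in> fst d"
    and compat: "\<And>d G d' G' p. (d, G) \<in> P \<Longrightarrow> (d', G') \<in> P \<Longrightarrow> p \<in> fst d \<Longrightarrow> p \<in> fst d' \<Longrightarrow>
       G (snd d p) = pull (transition d d') G' (snd d p)"
  shows "\<exists>g. riemannian_manifold M g \<and> locally_conformally_flat M g \<and> positive_tensor2 M (Ein k g)"
proof -
  \<comment> \<open>The choice varies with the point without any continuity; the fact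
    \<open>g\<close> below replaces it by a fixed member near each point.\<close>
  define g where "g c x = (let p = inv_into (fst c) (snd c) x; r = (SOME r. r \<in> P \<and> p \<in> fst (fst r))
     in pull (transition c (fst r)) (snd r) x)" for c x
  have g: "g c (snd c p) = pull (transition c d) G (snd c p)"
    if c: "c \<in> charts M" and p: "p \<in> fst c" "p \<in> fst d" and dG: "(d, G) \<in> P" for c p d G
  proof -
    define r where "r = (SOME r. r \<in> P \<and> p \<in> fst (fst r))"
    have "r \<in> P \<and> p \<in> fst (fst r)" unfolding r_def by (rule someI[of _ "(d, G)"]) (use dG p in simp)
    then have r: "(fst r, snd r) \<in> P" "p \<in> fst (fst r)" by simp_all
    have "g c (snd c p) = pull (transition c (fst r)) (snd r) (snd c p)"
      unfolding g_def Let_def inv_into_f_f[OF chartD(3)[OF c] p(1)] r_def ..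
    also have "\<dots> = pull (transition c d) G (snd c p)"
      by (rule pull_cocycle[where p=p and G="snd r" and H=G])
          (use c p r(2) P[OF dG] P[OF r(1)] compat[OF r(1) dG r(2) p(2)] in auto)
    finally show ?thesis .
  qed
  have good: "good_metric k (chart_image c) (g c)" if c: "c \<in> charts M" for c
  proof (rule good_metric_local[OF _ chartD(2)[OF c]])
    fix x assume "x \<in> chart_image c"
    then obtain p where p: "p \<in> fst c" "x = snd c p" by auto
    then obtain d G where d: "(d, G) \<in> P" "p \<in> fst d" using cover chartD(4)[OF c] by blast
    have "good_metric k (snd c ` (fst c \<inter> fst d)) (g c)"
    proof (rule good_metric_cong)
      show "good_metric k (snd c ` (fst c \<inter> fst d)) (pull (transition c d) G)"
        using P[OF d(1)] by (intro good_metric_transition[OF c]) auto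
      fix y assume "y \<in> snd c ` (fst c \<inter> fst d)"
      then obtain r where r: "r \<in> fst c" "r \<in> fst d" "y = snd c r" by blast
      show "pull (transition c d) G y = g c y" unfolding r(3) by (rule g[OF c r(1,2) d(1), symmetric])
    qed
    moreover have "x \<in> snd c ` (fst c \<inter> fst d)" unfolding p(2) by (intro imageI IntI p(1) d(2))
    ultimately show "\<exists>W. x \<in> W \<and> good_metric k W (g c)" by (intro exI conjI)
  qed
  have trans: "g c (snd c p) = pull (transition c c') (g c') (snd c p)"
    if c: "c \<in> charts M" and c': "c' \<in> charts M" and p: "p \<in> fst c" "p \<in> fst c'" for c c' p
  proof -
    obtain d G where d: "(d, G) \<in> P" "p \<in> fst d" using cover chartD(4)[OF c] p by blast
    have dc: "d \<in> charts M" using P d by blast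
    show ?thesis
      using pull_cocycle[where c=c and d=c' and e=d and p=p and G="g c'" and H=G] g[OF c p(1) d(2,1)]
          g[OF c' p(2) d(2,1)]
        c c' dc p d(2) by simp
  qed
  have "riemannian_manifold M g"
    unfolding riemannian_manifold_def smooth_tensor2_def symmetric_tensor2_def positive_tensor2_def
    using M good trans unfolding good_metric_def pull_def jac_def by (auto simp: Let_def)
  moreover have "positive_tensor2 M (Ein k g)"
    using good unfolding positive_tensor2_def good_metric_def ein_pos_def Ein_eq_EinM by blast
  moreover have "locally_conformally_flat M g" unfolding locally_conformally_flat_def
  proof
    fix p assume "p \<in> topspace (mtop M)"
    then obtain d where d: "d \<in> charts M" "p \<in> fst d" using atlas_cover atlas_charts by blast
    then have "conf_flat_at (g d) (snd d p)" using good[OF d(1)] by (simp add: good_metric_def)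
    then obtain W \<theta> f where W: "open W" "snd d p \<in> W" "smooth_on W \<theta>" "inj_on \<theta> W" "\<And>x. x\<in>W
        \<Longrightarrow> invertible (jac \<theta> x)"
     "smooth_on (\<theta> ` W) f" "\<And>x. x\<in>W \<Longrightarrow> g d x = pull \<theta> (conf f) x"
      unfolding conf_flat_at_def by blast
    \<comment> \<open>Composing d with the conformal coordinates \<theta> gives a chart e of the
      maximal atlas. The expression of the metric in e is found by cancelling the Jacobian of
      \<theta> from the transformation law.\<close>
    define W' where "W' = W \<inter> chart_image d"
    have W': "open W'" "W' \<subseteq> chart_image d" "W' \<subseteq> W" using W(1) chartD(2)[OF d(1)] by (auto simp: W'_def)
    define e where "e = ({p \<in> fst d. snd d p \<in> W'}, \<lambda>p. \<theta> (snd d p))"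
    have e: "e \<in> charts M" unfolding e_def
      by (rule compose_chart[OF d(1) W'(1,2) smooth_on_subset[OF W(3) W'(3)] inj_on_subset[OF W(4)
          W'(3)]]) (use W(5) W'(3) in auto)
    have pe: "p \<in> fst e" using d W by (auto simp: e_def W'_def)
    have im: "chart_image e = \<theta> ` W'" using W'(2) by (auto simp: e_def)
    have "g e y = exp (2 * f y) *\<^sub>R mat 1" if y_im: "y \<in> chart_image e" for y
    proof -
      obtain r where re: "r \<in> fst e" "y = snd e r" using y_im by blast
      then have r: "r \<in> fst d" "snd d r \<in> W'" "y = \<theta> (snd d r)" "r \<in> fst e" by (simp_all add: e_def)
      have y: "y = snd e r" using r by (simp add: e_def)
      have j: "jac (transition d e) (snd d r) = jac \<theta> (snd d r)"
        by (rule jac_cong[OF W'(1) r(2)]) (use W'(2) in \<open>auto simp: transition_chart[OF d(1)] e_def\<close>)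
      have t: "transition d e (snd d r) = y" using transition_chart[OF d(1) r(1)] y by simp
      let ?J = "jac \<theta> (snd d r)"
      have "pull (transition d e) (g e) (snd d r) = pull \<theta> (conf f) (snd d r)"
        using trans[OF d(1) e r(1,4)] W(7)[of "snd d r"] W'(3) r(2) by auto
      then have eq: "transpose ?J ** g e y ** ?J = transpose ?J ** conf f y ** ?J"
        unfolding pull_def j t r(3)[symmetric] .
      have J: "?J ** matrix_inv ?J = mat 1" "matrix_inv (transpose ?J) ** transpose ?J = mat 1"
        using W(5)[of "snd d r"] W'(3) r(2) matrix_inv_invertible transpose_invertible by blast+
      have "matrix_inv (transpose ?J) ** (transpose ?J ** g e y ** ?J) ** matrix_inv ?J
          = matrix_inv (transpose ?J) ** (transpose ?J ** conf f y ** ?J) ** matrix_inv ?J" by (simp only: eq)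
      moreover have "matrix_inv (transpose ?J) ** (transpose ?J ** X ** ?J) ** matrix_inv ?J = X" for X
        by (metis J matrix_mul_assoc matrix_mul_lid matrix_mul_rid)
      ultimately show ?thesis by (simp add: conf_def)
    qed
    moreover have "smooth_on (chart_image e) f" unfolding im by (rule smooth_on_subset[OF W(6)])
        (use W'(3) in auto)
    ultimately show "\<exists>c\<in>charts M. p \<in> fst c \<and> (\<exists>f. smooth_on (chart_image c) f
        \<and> (\<forall>x\<in>chart_image c. g c x = exp (2 * f x) *\<^sub>R mat 1))"
      using e pe by blast
  qed
  ultimately show ?thesis by blast
qed

end

section \<open>Discs\<close>

locale disc = smooth_mfd M for M :: "('a, 'n::finite) manifold" +
  fixes h :: "real ^ 'n \<Rightarrow> 'a" and V :: "(real ^ 'n) set"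
  assumes V: "open V" "cball 0 1 \<subseteq> V" and inj_h: "inj_on h V" and hc: "(h ` V, inv_into V h) \<in> charts M"
begin

definition hchart :: "('a, 'n) chart" where "hchart = (h ` V, inv_into V h)"

lemma hchart: "hchart \<in> charts M" using hc by (simp add: hchart_def)

lemma hchart_h: "w \<in> V \<Longrightarrow> snd hchart (h w) = w" using inj_h by (simp add: hchart_def)

lemma fst_hchart: "fst hchart = h ` V" by (simp add: hchart_def)

lemma hchart_image: "chart_image hchart = V" using hchart_h by (force simp: fst_hchart)

lemma h_open: "open O' \<Longrightarrow> O' \<subseteq> V \<Longrightarrow> openin (mtop M) (h ` O')"
proof -
  assume O': "open O'" "O' \<subseteq> V"
  have "{p \<in> fst hchart. snd hchart p \<in> O'} = h ` O'"
    using O'(2) hchart_h by (force simp: fst_hchart)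
  then show ?thesis using chartD(6)[OF hchart O'(1)] by simp
qed

lemma h_preimage_open: "openin (mtop M) W \<Longrightarrow> open {w \<in> V. h w \<in> W}"
proof -
  assume W: "openin (mtop M) W"
  have "snd hchart ` (fst hchart \<inter> W) = {w \<in> V. h w \<in> W}"
    using hchart_h by (force simp: fst_hchart)
  then show ?thesis using chartD(5)[OF hchart W] by simp
qed

lemma h_cont: "continuous_map (top_of_set V) (mtop M) h"
  unfolding continuous_map_def
proof (intro conjI allI impI)
  show "h \<in> topspace (top_of_set V) \<rightarrow> topspace (mtop M)"
    using chartD(4)[OF hchart] by (auto simp: fst_hchart)
  show "openin (top_of_set V) {x \<in> topspace (top_of_set V). h x \<in> U}" if "openin (mtop M) U" for U
    using h_preimage_open[OF that] by (auto intro: open_subset)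
qed

text \<open>A compact set in a Hausdorff space. For r = 0 it is the puncture; for r = 1/2 and r =
  3/4 its complement supplies the open sets used in gluing.\<close>

lemma closed_disc: "closedin (mtop M) (h ` cball 0 r)" if "r \<le> 1"
proof -
  have "compactin (top_of_set V) (cball 0 r)"
    using order_trans[OF subset_cball[OF that] V(2)] by (simp add: compactin_subtopology)
  then have "compactin (mtop M) (h ` cball 0 r)" using h_cont by (rule image_compactin)
  then show ?thesis using M by (intro compactin_imp_closedin) (auto simp: smooth_manifold_def)
qed

text \<open>\<open>K\<close> is the given metric in disc coordinates, pulled back by the
  straightening G. Near the centre G is the passage from a conformal chart to disc coordinates after
  a rigid motion, so \<open>K\<close> is conformal there; beyond radius 1/2 it is the
  identity.\<close>

lemma straightened_metric:
  assumes g: "riemannian_manifold M g" "locally_conformally_flat M g" "positive_tensor2 M (Ein k g)"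
  shows "\<exists>K \<sigma> f. good_metric k (ball 0 1) K \<and> 0 < \<sigma> \<and> \<sigma> \<le> 1/2 \<and> smooth_on (ball 0 \<sigma>) f \<and>
    (\<forall>z\<in>ball 0 \<sigma>. K z = conf f z) \<and> (\<forall>z. 1/2 < norm z \<and> norm z < 1 \<longrightarrow> K z = g hchart z)"
proof -
  have 0: "0 \<in> V" using V(2) by auto
  have h0: "h 0 \<in> fst hchart" using 0 by (simp add: fst_hchart)
  obtain c f where c: "c \<in> charts M" "h 0 \<in> fst c" "smooth_on (chart_image c) f" "\<And>y. y \<in> chart_image c
      \<Longrightarrow> g c y = conf f y"
    using g(2) chartD(4)[OF hchart] h0 unfolding locally_conformally_flat_def conf_def by blast
  let ?\<tau> = "transition c hchart" and ?O = "snd c ` (fst c \<inter> fst hchart)"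
  define y0 where "y0 = snd c (h 0)"
  have O: "open ?O" "y0 \<in> ?O" using open_overlap[OF c(1) hchart] c(2) h0 by (auto simp: y0_def)
  then obtain r where r: "r > 0" "ball y0 r \<subseteq> ?O" using open_contains_ball by blast
  have L: "invertible (jac ?\<tau> y0)" unfolding y0_def by (rule invertible_jac_transition[OF c(1) hchart c(2) h0])
  obtain R where R: "orthogonal_matrix R" "\<And>v. v \<noteq> 0 \<Longrightarrow> v \<bullet> ((jac ?\<tau> y0 ** R) *v v) > 0"
    using orthogonal_positive[OF L] by blast
  \<comment> \<open>A rigid motion taking 0 to the disc centre in the conformal chart. It keeps the
    metric conformal, while R makes the derivative of \<phi> at 0 positive.\<close>
  define a where "a z = y0 + R *v z" for z
  have RR: "transpose R ** R = mat 1" using R(1) by (simp add: orthogonal_matrix_def)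
  have nR: "norm (R *v z) = norm z" for z
  proof -
    have "(R *v z) \<bullet> (R *v z) = z \<bullet> z" using dot_transpose_mult[of z R "mat 1" z] RR by simp
    then show ?thesis by (simp add: norm_eq_sqrt_inner)
  qed
  have sa: "smooth_on UNIV a" unfolding a_def[abs_def]
    by (intro smooth_on_add smooth_on_matrix_vector_mult smooth_on_const smooth_on_id) auto
  have da: "(a has_derivative (\<lambda>v. R *v v)) (at z)" for z
    unfolding a_def[abs_def] by (rule has_derivative_eq_rhs[OF has_derivative_add[OF has_derivative_const
          bounded_linear_imp_has_derivative[OF matrix_vector_mul_bounded_linear]]]) simp
  have ja: "jac a z = R" for z using jac_eq[OF da] by simp
  have aO: "a z \<in> ?O" if "z \<in> ball 0 r" for z
  proof -
    have "a z \<in> ball y0 r" using that by (simp add: a_def dist_norm nR)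
    then show ?thesis using r(2) by blast
  qed
  define \<phi> where "\<phi> z = ?\<tau> (a z)" for z
  have s\<phi>: "smooth_on (ball 0 r) \<phi>" unfolding \<phi>_def[abs_def]
    by (rule smooth_on_compose[OF open_ball O(1) _ smooth_on_subset[OF sa] smooth_transition[OF c(1)
        hchart]]) (use aO in auto)
  have j\<phi>: "jac \<phi> z = jac ?\<tau> (a z) ** R" if "z \<in> ball 0 r" for z
  proof -
    have "jac \<phi> z = jac ?\<tau> (a z) ** jac a z" unfolding \<phi>_def[abs_def]
      by (rule jac_compose[OF smooth_on_differentiable[OF sa] smooth_on_differentiable[OF
          smooth_transition[OF c(1) hchart] aO[OF that]]]) simp
    then show ?thesis by (simp only: ja)
  qed
  have a0: "a 0 = y0" by (simp add: a_def)
  have \<phi>0: "\<phi> 0 = 0" unfolding \<phi>_def a0 y0_def using transition_chart[OF c(1,2)] hchart_h[OF 0] by simp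
  have A: "v \<bullet> (jac \<phi> 0 *v v) > 0" if "v \<noteq> 0" for v
    using j\<phi>[of 0] r(1) R(2)[OF that] by (simp add: a0)
  obtain G \<sigma> where G: "0 < \<sigma>" "\<sigma> < r" "\<sigma> < 1/2" "smooth_on UNIV G" "\<And>z. norm z < \<sigma> \<Longrightarrow> G z = \<phi> z"
    "\<And>z. norm z \<ge> 1/2 \<Longrightarrow> G z = z" "\<And>z. norm z < 1 \<Longrightarrow> norm (G z) < 1" "\<And>z v. v \<noteq> 0 \<Longrightarrow> v \<bullet> dderiv G v z > 0"
    using straighten[OF r(1) s\<phi> \<phi>0 A] by blast
  have goodH: "good_metric k V (g hchart)" using charts_good[OF g hchart] by (simp add: hchart_image)
  let ?K = "pull G (g hchart)"
  have "good_metric k (ball 0 1) ?K"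
  proof (rule good_metric_pull[OF goodH open_ball])
    show "smooth_on (ball 0 1) G" by (rule smooth_on_subset[OF G(4)]) simp
    show "inj_on G (ball 0 1)" using monotone_inj(1)[OF G(4,8)] by (rule inj_on_subset) simp_all
    show "invertible (jac G y)" for y by (rule monotone_inj(2)[OF G(4,8)])
    show "G ` ball 0 1 \<subseteq> V" using G(7) V(2) by (auto simp: subset_eq less_imp_le)
  qed
  moreover have "?K z = conf (\<lambda>z. f (a z)) z" if z: "z \<in> ball 0 \<sigma>" for z
  proof -
    have zr: "z \<in> ball 0 r" using z G(2) by simp
    have "jac G z = jac \<phi> z" by (rule jac_cong[OF open_ball z]) (use G(5) in auto)
    then have "?K z = transpose R ** pull ?\<tau> (g hchart) (a z) ** R"
      using G(5)[of z] z j\<phi>[OF zr] by (simp add: pull_def \<phi>_def matrix_transpose_mul matrix_mul_assoc)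
    also have "pull ?\<tau> (g hchart) (a z) = g c (a z)"
    proof -
      obtain p where p: "p \<in> fst c" "p \<in> fst hchart" "a z = snd c p" using aO[OF zr] by auto
      show ?thesis unfolding p(3) by (rule tensor_transform[OF g(1) c(1) hchart p(1,2), symmetric])
    qed
    also have "g c (a z) = conf f (a z)" using c(4) aO[OF zr] by blast
    finally show ?thesis by (simp add: conf_def scaleR_matrix_mult RR)
  qed
  moreover have "smooth_on (ball 0 \<sigma>) (\<lambda>z. f (a z))"
    by (rule smooth_on_compose[OF open_ball O(1) _ smooth_on_subset[OF sa] smooth_on_subset[OF c(3)]])
        (use aO G(2) in auto)
  moreover have "?K z = g hchart z" if "1/2 < norm z" for z
  proof -
    have "jac G z = jac (\<lambda>z. z) z" by (rule jac_cong[of "- cball 0 (1/2)"]) (use that G(6) in auto)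
    then show ?thesis using G(6)[of z] that by (simp add: pull_def jac_ident transpose_mat)
  qed
  ultimately show ?thesis using G(1,3) by (intro exI[of _ ?K] exI[of _ \<sigma>] exI[of _ "\<lambda>z. f (a z)"]) auto
qed

end

section \<open>Gluing along punctured discs\<close>

text \<open>The gluing t u -> (1 - t) u of the connected sum, without polar coordinates.\<close>

definition reflect :: "real ^ 'n::finite \<Rightarrow> real ^ 'n" where
  "reflect w = ((1 - norm w) / norm w) *\<^sub>R w"

lemma reflect:
  assumes "w \<noteq> 0" "norm w < 1"
  shows "norm (reflect w) = 1 - norm w" "reflect w \<noteq> 0" "reflect (reflect w) = w"
proof -
  show n: "norm (reflect w) = 1 - norm w" using assms by (simp add: reflect_def)
  then show "reflect w \<noteq> 0" using assms by auto
  have "reflect (reflect w) = (norm w / (1 - norm w)) *\<^sub>R reflect w" unfolding reflect_def[of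
      "reflect w"] n by simp
  then show "reflect (reflect w) = w" using assms by (simp add: reflect_def)
qed

definition pball :: "(real ^ 'n::finite) set" where "pball = ball 0 1 - {0}"

lemma open_pball: "open pball" by (simp add: pball_def open_delete)

lemma reflect_pball: "w \<in> pball \<Longrightarrow> reflect w \<in> pball" "w \<in> pball \<Longrightarrow> reflect (reflect w) = w"
  using reflect[of w] by (auto simp: pball_def)

lemma smooth_on_reflect: "smooth_on pball reflect"
  unfolding reflect_def[abs_def]
  by (intro smooth_on_scaleR smooth_on_divide smooth_on_diff smooth_on_norm smooth_on_const smooth_on_id
      open_pball)
    (auto simp: pball_def)

text \<open>The chart c of a summand, punctured at p and transported by the embedding i, in the form
  in which it enters the atlas of \<open>connected_sum\<close>.\<close>

definition push :: "('a \<Rightarrow> 'c) \<Rightarrow> ('c \<Rightarrow> 'a) \<Rightarrow> 'a \<Rightarrow> ('a, 'n::finite) chart \<Rightarrow> ('c, 'n) chart" where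
  "push i j p c = (i ` (fst c - {p}), \<lambda>q. snd c (j q))"

text \<open>Here \<open>j\<close> and \<open>j'\<close> are left inverses of the embeddings \<open>i\<close> and \<open>i'\<close> of the punctured summands into
  \<open>N\<close>. The assumptions are symmetric, so that every statement holds with the two summands exchanged.\<close>

locale glued = A: disc A h V + B: disc B h' V'
  for A :: "('a, 'n::finite) manifold" and h V and B :: "('b, 'n) manifold" and h' V' +
  fixes N :: "('c, 'n) manifold" and i j i' j'
  assumes j: "\<And>x. x \<in> topspace (mtop A) - {h 0} \<Longrightarrow> j (i x) = x"
    and j': "\<And>y. y \<in> topspace (mtop B) - {h' 0} \<Longrightarrow> j' (i' y) = y"
    and open_N: "\<And>W. openin (mtop N) W \<longleftrightarrow> W \<subseteq> i ` (topspace (mtop A) - {h 0}) \<union> i' ` (topspace (mtop B) -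
        {h' 0}) \<and>
        openin (mtop A) {x \<in> topspace (mtop A) - {h 0}. i x \<in> W}
            \<and> openin (mtop B) {y \<in> topspace (mtop B) - {h' 0}. i' y \<in> W}"
    and glue: "\<And>x y. x \<in> topspace (mtop A) - {h 0} \<Longrightarrow> y \<in> topspace (mtop B) - {h' 0} \<Longrightarrow>
        i x = i' y \<longleftrightarrow> (\<exists>w\<in>pball. x = h w \<and> y = h' (reflect w))"
    and atlas_N: "atlas N = push i j (h 0) ` atlas A \<union> push i' j' (h' 0) ` atlas B"
begin

text \<open>The gluing condition is symmetric because \<open>reflect\<close> is an involution.
  Interpreting this fact as \<open>S\<close> provides for B each statement proved for A.\<close>

lemma swap: "glued B h' V' A h V N i' j' i j"
proof unfold_locales
  show "i' y = i x \<longleftrightarrow> (\<exists>w\<in>pball. y = h' w \<and> x = h (reflect w))"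
    if "y \<in> topspace (mtop B) - {h' 0}" "x \<in> topspace (mtop A) - {h 0}" for x y
    using glue[OF that(2,1)] reflect_pball by metis
qed (use j j' open_N atlas_N in \<open>auto simp: Un_commute\<close>)

definition "PA = topspace (mtop A) - {h 0}"
definition "PB = topspace (mtop B) - {h' 0}"

lemma j_i: "x \<in> PA \<Longrightarrow> j (i x) = x" using j by (simp add: PA_def)

lemma inj_i: "inj_on i PA"
  by (rule inj_on_inverseI[of _ j]) (rule j_i)

lemma image_i_Int: "i ` (X \<inter> PA) \<inter> i ` (Y \<inter> PA) = i ` (X \<inter> (Y \<inter> PA))"
  using inj_on_image_Int[OF inj_i, of "X \<inter> PA" "Y \<inter> PA"] by (simp add: Int_ac)

lemma glue_iff: "x \<in> PA \<Longrightarrow> y \<in> PB \<Longrightarrow> i x = i' y \<longleftrightarrow> (\<exists>w\<in>pball. x = h w \<and> y = h' (reflect w))"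
  using glue by (simp add: PA_def PB_def)

lemma open_iff: "openin (mtop N) W \<longleftrightarrow> W \<subseteq> i ` PA \<union> i' ` PB \<and> openin (mtop A) {x \<in> PA. i x \<in> W}
    \<and> openin (mtop B) {y \<in> PB. i' y \<in> W}"
  using open_N by (simp add: PA_def PB_def)

lemma open_PA: "openin (mtop A) PA"
proof -
  have "closedin (mtop A) (h ` cball 0 0)" by (rule A.closed_disc) simp
  then show ?thesis by (simp add: PA_def openin_diff)
qed

lemma h_pball: "w \<in> pball \<Longrightarrow> h w \<in> PA" "w \<in> pball \<Longrightarrow> w \<in> V"
proof -
  assume w: "w \<in> pball"
  then show wV: "w \<in> V" using A.V(2) by (auto simp: pball_def)
  have "0 \<in> V" using A.V(2) by auto
  then have "h w \<noteq> h 0" using inj_onD[OF A.inj_h _ wV, of 0] w by (auto simp: pball_def)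
  moreover have "h w \<in> topspace (mtop A)" using chartD(4)[OF A.hchart] wV by (auto simp: A.fst_hchart)
  ultimately show "h w \<in> PA" by (simp add: PA_def)
qed

lemma pull_open: "openin (mtop N) W \<Longrightarrow> openin (mtop A) {x \<in> PA. i x \<in> W}"
  using open_iff by blast

lemma h'_pball: "w \<in> pball \<Longrightarrow> h' w \<in> PB" "w \<in> pball \<Longrightarrow> w \<in> V'"
proof -
  interpret S: glued B h' V' A h V N i' j' i j by (rule swap)
  show "w \<in> pball \<Longrightarrow> h' w \<in> PB" "w \<in> pball \<Longrightarrow> w \<in> V'"
    using S.h_pball by (auto simp: S.PA_def PB_def)
qed

lemma i_h: "w \<in> pball \<Longrightarrow> i (h w) = i' (h' (reflect w))"
  using glue_iff[OF h_pball(1) h'_pball(1)[OF reflect_pball(1)]] by blast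

text \<open>Openness in the glued space is also tested in the other summand. There the points
  identified with points of W form the image under h' of the reflected part of W in the disc, and
  \<open>reflect\<close> is continuous.\<close>

lemma push_open:
  assumes W: "openin (mtop A) W" "W \<subseteq> PA"
  shows "openin (mtop N) (i ` W)"
  unfolding open_iff
proof (intro conjI)
  show "i ` W \<subseteq> i ` PA \<union> i' ` PB" using W by auto
  have "{x \<in> PA. i x \<in> i ` W} = W" using W(2) j_i by (auto simp: subset_eq) (metis)
  then show "openin (mtop A) {x \<in> PA. i x \<in> i ` W}" using W by simp
  let ?S = "{w \<in> pball. h (reflect w) \<in> W}"
  have "open {w \<in> V. h w \<in> W}" by (rule A.h_preimage_open[OF W(1)])
  then have "open (reflect -` {w \<in> V. h w \<in> W} \<inter> pball)"
    using continuous_on_open_vimage[OF open_pball, of reflect] smooth_on_continuous[OF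
        smooth_on_reflect] by blast
  moreover have "reflect -` {w \<in> V. h w \<in> W} \<inter> pball = ?S" using h_pball(2)[OF reflect_pball(1)] by auto
  ultimately have "open ?S" by simp
  moreover have "?S \<subseteq> V'" using h'_pball(2) by auto
  ultimately have "openin (mtop B) (h' ` ?S)" by (rule B.h_open)
  moreover have "{y \<in> PB. i' y \<in> i ` W} = h' ` ?S"
  proof (intro equalityI subsetI)
    fix y assume y: "y \<in> {y \<in> PB. i' y \<in> i ` W}"
    then obtain x where x: "x \<in> W" "i x = i' y" by auto
    then obtain w where w: "w \<in> pball" "x = h w" "y = h' (reflect w)" using glue_iff[of x y] y W(2) by blast
    then show "y \<in> h' ` ?S" using x reflect_pball[OF w(1)] by auto
  next
    fix y assume "y \<in> h' ` ?S"
    then obtain w where w: "w \<in> pball" "h (reflect w) \<in> W" "y = h' w" by auto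
    have "i (h (reflect w)) = i' y" using i_h[OF reflect_pball(1)[OF w(1)]] reflect_pball(2)[OF w(1)]
        w(3) by simp
    then have "i' y \<in> i ` W" by (rule image_eqI[OF sym]) (rule w(2))
    then show "y \<in> {y \<in> PB. i' y \<in> i ` W}" using w h'_pball(1)[OF w(1)] by simp
  qed
  ultimately show "openin (mtop B) {y \<in> PB. i' y \<in> i ` W}" by simp
qed

lemma topspace_N: "topspace (mtop N) = i ` PA \<union> i' ` PB"
proof
  show "topspace (mtop N) \<subseteq> i ` PA \<union> i' ` PB" using open_iff openin_topspace by blast
  interpret S: glued B h' V' A h V N i' j' i j by (rule swap)
  have "openin (mtop N) (i ` PA)" by (rule push_open[OF open_PA]) simp
  moreover have "openin (mtop N) (i' ` PB)" using S.push_open[OF S.open_PA] by (simp add: S.PA_def PB_def)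
  ultimately show "i ` PA \<union> i' ` PB \<subseteq> topspace (mtop N)" using openin_subset by blast
qed

section \<open>Charts of the glued space\<close>

abbreviation "pushA \<equiv> push i j (h 0)"
abbreviation "pushB \<equiv> push i' j' (h' 0)"

lemma chart_PA: "c \<in> charts A \<Longrightarrow> fst c - {h 0} = fst c \<inter> PA"
  using chartD(4)[of c A] by (auto simp: PA_def)

lemma pushA_fst: "c \<in> charts A \<Longrightarrow> fst (pushA c) = i ` (fst c \<inter> PA)"
  by (simp add: push_def chart_PA)

lemma pushA_snd: "x \<in> PA \<Longrightarrow> snd (pushA c) (i x) = snd c x"
  by (simp add: push_def j_i)

lemma pushA_snd_image: "S \<subseteq> PA \<Longrightarrow> snd (pushA c) ` i ` S = snd c ` S"
  unfolding image_image by (rule image_cong) (auto simp: pushA_snd)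

lemma pushA_in: "c \<in> charts A \<Longrightarrow> x \<in> fst c \<Longrightarrow> x \<in> PA \<Longrightarrow> i x \<in> fst (pushA c)"
  by (auto simp: pushA_fst)

lemma pushA_chart_on:
  assumes c: "c \<in> charts A" shows "chart_on (mtop N) (pushA c)"
proof -
  let ?U = "i ` (fst c \<inter> PA)"
  have U: "openin (mtop N) ?U" by (intro push_open openin_Int chartD(1)[OF c] open_PA) auto
  have "chart_on (mtop N) (?U, snd (pushA c))"
  proof (rule chart_onI[OF U])
    show "inj_on (snd (pushA c)) ?U"
      using chartD(3)[OF c] by (auto simp: inj_on_def pushA_snd)
    fix W assume W: "openin (mtop N) W"
    have "?U \<inter> W = i ` (fst c \<inter> {x \<in> PA. i x \<in> W})" by auto
    then have "snd (pushA c) ` (?U \<inter> W) = snd (pushA c) ` i ` (fst c \<inter> {x \<in> PA. i x \<in> W})" by simp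
    also have "\<dots> = snd c ` (fst c \<inter> {x \<in> PA. i x \<in> W})" by (rule pushA_snd_image) auto
    finally have "snd (pushA c) ` (?U \<inter> W) = snd c ` (fst c \<inter> {x \<in> PA. i x \<in> W})" .
    then show "open (snd (pushA c) ` (?U \<inter> W))" using chartD(5)[OF c pull_open[OF W]] by simp
  next
    fix O' :: "(real ^ 'n) set" assume O': "open O'"
    have "{p \<in> ?U. snd (pushA c) p \<in> O'} = i ` ({x \<in> fst c. snd c x \<in> O'} \<inter> PA)" by (auto simp: pushA_snd)
    moreover have "openin (mtop N) (i ` ({x \<in> fst c. snd c x \<in> O'} \<inter> PA))"
      by (intro push_open openin_Int chartD(6)[OF c O'] open_PA) auto
    ultimately show "openin (mtop N) {p \<in> ?U. snd (pushA c) p \<in> O'}" by simp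
  qed
  then show ?thesis by (simp add: push_def chart_PA[OF c])
qed

lemma pushA_overlap:
  assumes "c \<in> charts A" "d \<in> charts A"
  shows "snd (pushA c) ` (fst (pushA c) \<inter> fst (pushA d)) = snd c ` (fst c \<inter> (fst d \<inter> PA))"
proof -
  have "fst (pushA c) \<inter> fst (pushA d) = i ` (fst c \<inter> (fst d \<inter> PA))"
    by (simp add: pushA_fst assms image_i_Int)
  then have "snd (pushA c) ` (fst (pushA c) \<inter> fst (pushA d)) = snd (pushA c) ` i ` (fst c \<inter> (fst d \<inter>
      PA))" by simp
  also have "\<dots> = snd c ` (fst c \<inter> (fst d \<inter> PA))" by (rule pushA_snd_image) auto
  finally show ?thesis .
qed

lemma pushA_transition:
  assumes c: "c \<in> charts A" and x: "x \<in> fst c" "x \<in> PA"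
  shows "transition (pushA c) D (snd c x) = snd D (i x)"
  using transition_apply[OF chart_onD(3)[OF pushA_chart_on[OF c]] pushA_in[OF c x], of D] x
      by (simp add: pushA_snd)

lemma pushA_transition_smooth:
  assumes c: "c \<in> charts A" and d: "d \<in> charts A"
  shows "smooth_on (snd (pushA c) ` (fst (pushA c) \<inter> fst (pushA d))) (transition (pushA c) (pushA d))"
  unfolding pushA_overlap[OF c d]
proof (rule smooth_on_cong)
  show "open (snd c ` (fst c \<inter> (fst d \<inter> PA)))" by (intro chartD(5)[OF c] openin_Int chartD(1)[OF d] open_PA)
  show "smooth_on (snd c ` (fst c \<inter> (fst d \<inter> PA))) (transition c d)"
    by (rule smooth_on_subset[OF A.smooth_transition[OF c d]]) auto
qed (auto simp: pushA_transition[OF c] transition_chart[OF c] pushA_snd)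


lemma pushB_chart_on: "c \<in> charts B \<Longrightarrow> chart_on (mtop N) (pushB c)"
proof -
  interpret S: glued B h' V' A h V N i' j' i j by (rule swap)
  show "c \<in> charts B \<Longrightarrow> chart_on (mtop N) (pushB c)" by (rule S.pushA_chart_on)
qed

text \<open>The overlap lies in the glued annulus, so the transition leads from c to the disc
  coordinates of A, then through \<open>reflect\<close>, then from the disc coordinates of B to
  d.\<close>

lemma cross_transition_smooth:
  assumes c: "c \<in> charts A" and d: "d \<in> charts B"
  shows "smooth_on (snd (pushA c) ` (fst (pushA c) \<inter> fst (pushB d))) (transition (pushA c) (pushB d))"
proof -
  interpret S: glued B h' V' A h V N i' j' i j by (rule swap)
  have PB: "S.PA = PB" by (simp add: S.PA_def PB_def)
  let ?O = "snd (pushA c) ` (fst (pushA c) \<inter> fst (pushB d))"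
  have O: "open ?O" by (rule chart_onD(5)[OF pushA_chart_on[OF c] chart_onD(1)[OF pushB_chart_on[OF d]]])
  have pt: "\<exists>w\<in>pball. h w \<in> fst c \<and> h' (reflect w) \<in> fst d \<and> y = snd c (h w)" if yO: "y \<in> ?O" for y
  proof -
    obtain q where q: "q \<in> fst (pushA c)" "q \<in> fst (pushB d)" "y = snd (pushA c) q" using yO by blast
    obtain x where x: "x \<in> fst c" "x \<in> PA" "q = i x" using q(1) by (auto simp: pushA_fst[OF c])
    obtain z where z: "z \<in> fst d" "z \<in> PB" "q = i' z" using q(2) by (auto simp: S.pushA_fst[OF d] PB)
    obtain w where "w \<in> pball" "x = h w" "z = h' (reflect w)" using glue_iff[OF x(2) z(2)] x(3) z(3) by auto
    then show ?thesis using x z q(3) by (auto simp: pushA_snd)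
  qed
  let ?a = "transition c A.hchart" and ?b = "transition B.hchart d"
  have a: "?a (snd c (h w)) = w" if "w \<in> pball" "h w \<in> fst c" for w
    using transition_chart[OF c that(2)] A.hchart_h h_pball(2)[OF that(1)] by simp
  have b: "?b w = snd d (h' w)" "w \<in> snd B.hchart ` (fst B.hchart \<inter> fst d)" if "w \<in> pball" "h' w \<in> fst d" for w
  proof -
    have f: "h' w \<in> fst B.hchart" "snd B.hchart (h' w) = w" using B.hchart_h h'_pball(2)[OF that(1)]
        by (auto simp: B.fst_hchart)
    show "?b w = snd d (h' w)" using transition_chart[OF B.hchart f(1), of d] f(2) by simp
    show "w \<in> snd B.hchart ` (fst B.hchart \<inter> fst d)" using f that(2) by (metis IntI image_eqI)
  qed
  have s1: "smooth_on ?O ?a"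
  proof (rule smooth_on_subset[OF A.smooth_transition[OF c A.hchart]])
    show "?O \<subseteq> snd c ` (fst c \<inter> fst A.hchart)"
      using pt h_pball(2) by (fastforce simp: A.fst_hchart)
  qed
  have im: "?a ` ?O \<subseteq> pball" using pt a by fastforce
  have s2: "smooth_on ?O (\<lambda>y. reflect (?a y))"
    by (rule smooth_on_compose[OF O open_pball im s1 smooth_on_reflect])
  have "smooth_on ?O (\<lambda>y. ?b (reflect (?a y)))"
  proof (rule smooth_on_compose[OF O B.open_overlap[OF B.hchart d] _ s2 B.smooth_transition[OF B.hchart d]])
    show "(\<lambda>y. reflect (?a y)) ` ?O \<subseteq> snd B.hchart ` (fst B.hchart \<inter> fst d)"
    proof (rule image_subsetI)
      fix y assume "y \<in> ?O"
      then obtain w where w: "w \<in> pball" "h w \<in> fst c" "h' (reflect w) \<in> fst d" "y = snd c (h w)"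
          using pt by blast
      then show "reflect (?a y) \<in> snd B.hchart ` (fst B.hchart \<inter> fst d)"
        using a[OF w(1,2)] b(2)[OF reflect_pball(1)[OF w(1)] w(3)] by simp
    qed
  qed
  then show ?thesis
  proof (rule smooth_on_cong[OF O, rotated])
    fix y assume "y \<in> ?O"
    then obtain w where w: "w \<in> pball" "h w \<in> fst c" "h' (reflect w) \<in> fst d" "y = snd c (h w)" using pt
        by blast
    have "transition (pushA c) (pushB d) y = snd (pushB d) (i (h w))"
      unfolding w(4) by (rule pushA_transition[OF c w(2) h_pball(1)[OF w(1)]])
    also have "\<dots> = snd d (h' (reflect w))"
      unfolding i_h[OF w(1)] by (rule S.pushA_snd) (use h'_pball(1)[OF reflect_pball(1)[OF w(1)]] PB in simp)
    finally show "?b (reflect (?a y)) = transition (pushA c) (pushB d) y"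
      using a[OF w(1,2)] b(1)[OF reflect_pball(1)[OF w(1)] w(3)] w(4) by simp
  qed
qed

lemma cross_compatible:
  assumes c: "c \<in> charts A" and d: "d \<in> charts B"
  shows "compatible (pushA c) (pushB d)"
proof -
  interpret S: glued B h' V' A h V N i' j' i j by (rule swap)
  show ?thesis unfolding compatible_def
    using cross_transition_smooth[OF c d] S.cross_transition_smooth[OF d c] by (simp add: Int_commute)
qed

lemma pushA_compatible: "c \<in> charts A \<Longrightarrow> d \<in> charts A \<Longrightarrow> compatible (pushA c) (pushA d)"
  unfolding compatible_def using pushA_transition_smooth[of c d] pushA_transition_smooth[of d c]
      by (simp add: Int_commute)

lemma pushA_charts:
  assumes c: "c \<in> charts A" shows "pushA c \<in> charts N"
proof -
  have "compatible (pushA c) d" if d: "d \<in> atlas N" for d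
  proof -
    consider e where "e \<in> atlas A" "d = pushA e" | e where "e \<in> atlas B" "d = pushB e"
      using d unfolding atlas_N by blast
    then show ?thesis
      by cases (simp_all add: pushA_compatible[OF c A.atlas_charts] cross_compatible[OF c B.atlas_charts])
  qed
  then show ?thesis using pushA_chart_on[OF c] by (simp add: charts_def)
qed

text \<open>Two points of one summand are separated there, as the embeddings are open. The remaining
  pairs avoid the glued annulus altogether; the complements of the half discs separate them, because
  \<open>reflect\<close> exchanges radii below and above 1/2.\<close>

lemma Hausdorff_N: "Hausdorff_space (mtop N)"
proof -
  interpret S: glued B h' V' A h V N i' j' i j by (rule swap)
  have PB: "S.PA = PB" "S.PB = PA" by (simp_all add: S.PA_def S.PB_def PA_def PB_def)
  have HA: "Hausdorff_space (mtop A)" "Hausdorff_space (mtop B)" using A.M B.M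
      by (auto simp: smooth_manifold_def)
  have sep: "\<exists>U W. openin (mtop N) U \<and> openin (mtop N) W \<and> i x \<in> U \<and> i y \<in> W \<and> disjnt U W"
    if xy: "x \<in> PA" "y \<in> PA" "x \<noteq> y" for x y
  proof -
    have "\<exists>U W. openin (mtop A) U \<and> openin (mtop A) W \<and> x \<in> U \<and> y \<in> W \<and> disjnt U W"
      using HA(1) xy unfolding Hausdorff_space_def PA_def by simp
    then obtain U W where UW: "openin (mtop A) U" "openin (mtop A) W" "x \<in> U" "y \<in> W" "disjnt U W"
      by (elim exE conjE)
    have "openin (mtop N) (i ` (U \<inter> PA))" "openin (mtop N) (i ` (W \<inter> PA))"
      by (intro push_open openin_Int UW open_PA; auto)+
    moreover have "disjnt (i ` (U \<inter> PA)) (i ` (W \<inter> PA))"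
      using UW(5) unfolding disjnt_def image_i_Int by auto
    ultimately show ?thesis using UW xy by (intro exI[of _ "i ` (U \<inter> PA)"] exI[of _ "i ` (W \<inter> PA)"]) auto
  qed
  have sep': "\<exists>U W. openin (mtop N) U \<and> openin (mtop N) W \<and> i' x \<in> U \<and> i' y \<in> W \<and> disjnt U W"
    if xy: "x \<in> PB" "y \<in> PB" "x \<noteq> y" for x y
  proof -
    have "\<exists>U W. openin (mtop B) U \<and> openin (mtop B) W \<and> x \<in> U \<and> y \<in> W \<and> disjnt U W"
      using HA(2) xy unfolding Hausdorff_space_def PB_def by simp
    then obtain U W where UW: "openin (mtop B) U" "openin (mtop B) W" "x \<in> U" "y \<in> W" "disjnt U W"
      by (elim exE conjE)
    have "openin (mtop N) (i' ` (U \<inter> PB))" "openin (mtop N) (i' ` (W \<inter> PB))"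
      using S.push_open[of "U \<inter> PB"] S.push_open[of "W \<inter> PB"] UW S.open_PA unfolding PB by auto
    moreover have "disjnt (i' ` (U \<inter> PB)) (i' ` (W \<inter> PB))"
      using UW(5) S.image_i_Int[of U W] unfolding disjnt_def PB by auto
    ultimately show ?thesis using UW xy by (intro exI[of _ "i' ` (U \<inter> PB)"] exI[of _ "i' ` (W \<inter> PB)"]) auto
  qed
  let ?U = "PA - h ` cball 0 (1/2)" and ?W = "PB - h' ` cball 0 (1/2)"
  have oU: "openin (mtop N) (i ` ?U)" by (intro push_open openin_diff open_PA A.closed_disc) auto
  have oW: "openin (mtop N) (i' ` ?W)"
    using S.push_open[of ?W] openin_diff[OF S.open_PA B.closed_disc[of "1/2"]] unfolding PB by auto
  have dis: "disjnt (i ` ?U) (i' ` ?W)"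
  proof -
    have False if xy: "x \<in> ?U" "y \<in> ?W" "i x = i' y" for x y
    proof -
      obtain w where w: "w \<in> pball" "x = h w" "y = h' (reflect w)" using glue_iff[of x y] xy by auto
      have "norm w > 1/2" using xy(1) w(2) by (metis DiffD2 image_eqI mem_cball_0 not_le)
      moreover have "norm (reflect w) > 1/2" using xy(2) w(3) by (metis DiffD2 image_eqI mem_cball_0 not_le)
      ultimately show False using reflect(1)[of w] w(1) by (auto simp: pball_def)
    qed
    then show ?thesis unfolding disjnt_iff by blast
  qed
  have cross: "\<exists>U W. openin (mtop N) U \<and> openin (mtop N) W \<and> i x \<in> U \<and> i' y \<in> W \<and> disjnt U W"
    if x: "x \<in> PA" and y: "y \<in> PB" and xy: "i x \<noteq> i' y" for x y
  proof -
    consider w where "w \<in> pball" "x = h w" | w where "w \<in> pball" "y = h' w" | "x \<notin> h ` pball"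
        "y \<notin> h' ` pball" by blast
    then show ?thesis
    proof cases
      case 1
      then have "i x = i' (h' (reflect w))" "h' (reflect w) \<in> PB"
          using i_h h'_pball(1)[OF reflect_pball(1)] by auto
      then show ?thesis using sep'[of "h' (reflect w)" y] y xy by auto
    next
      case 2
      have "i (h (reflect w)) = i' y" using i_h[OF reflect_pball(1)[OF 2(1)]] reflect_pball(2)[OF 2(1)]
          2(2) by simp
      moreover have "h (reflect w) \<in> PA" using h_pball(1)[OF reflect_pball(1)[OF 2(1)]] .
      ultimately show ?thesis using sep[of x "h (reflect w)"] x xy by metis
    next
      case 3
      have "x \<in> ?U"
      proof -
        have nx: "x \<noteq> h w" if "norm w \<le> 1/2" for w using 3(1) x that by (cases "w
            = 0") (auto simp: pball_def PA_def)
        show ?thesis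
        proof (intro DiffI x notI)
          assume "x \<in> h ` cball 0 (1/2)"
          then obtain w where "norm w \<le> 1/2" "x = h w" by auto
          then show False using nx by blast
        qed
      qed
      moreover have "y \<in> ?W"
      proof -
        have ny: "y \<noteq> h' w" if "norm w \<le> 1/2" for w using 3(2) y that by (cases "w
            = 0") (auto simp: pball_def PB_def)
        show ?thesis
        proof (intro DiffI y notI)
          assume "y \<in> h' ` cball 0 (1/2)"
          then obtain w where "norm w \<le> 1/2" "y = h' w" by auto
          then show False using ny by blast
        qed
      qed
      ultimately show ?thesis using oU oW dis by blast
    qed
  qed
  show ?thesis unfolding Hausdorff_space_def topspace_N
  proof (intro allI impI)
    fix p q assume pq: "p \<in> i ` PA \<union> i' ` PB \<and> q \<in> i ` PA \<union> i' ` PB \<and> p \<noteq> q"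
    then consider x y where "p = i x" "q = i y" "x \<in> PA" "y \<in> PA" | x y where "p = i' x" "q = i' y"
        "x \<in> PB" "y \<in> PB"
      | x y where "p = i x" "q = i' y" "x \<in> PA" "y \<in> PB" | x y where "p = i' x" "q = i y" "x \<in> PB"
          "y \<in> PA" by blast
    then show "\<exists>U W. openin (mtop N) U \<and> openin (mtop N) W \<and> p \<in> U \<and> q \<in> W \<and> disjnt U W"
    proof cases
      case 1
      then have "x \<noteq> y" using pq by auto
      from sep[OF 1(3,4) this] show ?thesis by (simp only: 1)
    next
      case 2
      then have "x \<noteq> y" using pq by auto
      from sep'[OF 2(3,4) this] show ?thesis by (simp only: 2)
    next
      case 3
      then have "i x \<noteq> i' y" using pq by auto
      from cross[OF 3(3,4) this] show ?thesis by (simp only: 3)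
    next
      case 4
      then have "i y \<noteq> i' x" using pq by auto
      from cross[OF 4(4,3) this] obtain U W where
        "openin (mtop N) U \<and> openin (mtop N) W \<and> i y \<in> U \<and> i' x \<in> W \<and> disjnt U W" by (elim exE)
      then show ?thesis unfolding 4(1,2) by (intro exI[of _ W] exI[of _ U]) (simp add: disjnt_sym)
    qed
  qed
qed

text \<open>The images of two countable bases under the open embeddings form a countable
  base.\<close>

lemma second_countable_N: "second_countable (mtop N)"
proof -
  interpret S: glued B h' V' A h V N i' j' i j by (rule swap)
  have PB: "S.PA = PB" by (simp add: S.PA_def PB_def)
  have "second_countable (mtop A)" using A.M by (simp add: smooth_manifold_def)
  then obtain BA where "countable BA \<and> (\<forall>W\<in>BA. openin (mtop A) W) \<and>
      (\<forall>U x. openin (mtop A) U \<and> x \<in> U \<longrightarrow> (\<exists>W\<in>BA. x \<in> W \<and> W \<subseteq> U))"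
    unfolding second_countable_def by (elim exE)
  then have BA: "countable BA" "\<And>W. W \<in> BA \<Longrightarrow> openin (mtop A) W"
    "\<And>U x. openin (mtop A) U \<Longrightarrow> x \<in> U \<Longrightarrow> \<exists>W\<in>BA. x \<in> W \<and> W \<subseteq> U" by blast+
  have "second_countable (mtop B)" using B.M by (simp add: smooth_manifold_def)
  then obtain BB where "countable BB \<and> (\<forall>W\<in>BB. openin (mtop B) W) \<and>
      (\<forall>U x. openin (mtop B) U \<and> x \<in> U \<longrightarrow> (\<exists>W\<in>BB. x \<in> W \<and> W \<subseteq> U))"
    unfolding second_countable_def by (elim exE)
  then have BB: "countable BB" "\<And>W. W \<in> BB \<Longrightarrow> openin (mtop B) W"
    "\<And>U x. openin (mtop B) U \<Longrightarrow> x \<in> U \<Longrightarrow> \<exists>W\<in>BB. x \<in> W \<and> W \<subseteq> U" by blast+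
  let ?B = "(\<lambda>W. i ` (W \<inter> PA)) ` BA \<union> (\<lambda>W. i' ` (W \<inter> PB)) ` BB"
  show ?thesis unfolding second_countable_def
  proof (intro exI[of _ ?B] conjI ballI allI impI)
    show "countable ?B" using BA(1) BB(1) by simp
    fix W assume "W \<in> ?B"
    moreover have "openin (mtop N) (i ` (W \<inter> PA))" if "W \<in> BA" for W
      by (rule push_open[OF openin_Int[OF BA(2)[OF that] open_PA]]) simp
    moreover have "openin (mtop N) (i' ` (W \<inter> PB))" if "W \<in> BB" for W
      using S.push_open[OF openin_Int[OF BB(2)[OF that] S.open_PA]] by (simp add: PB)
    ultimately show "openin (mtop N) W" by blast
  next
    fix U q assume Uq: "openin (mtop N) U \<and> q \<in> U"
    then consider x where "x \<in> PA" "q = i x" | y where "y \<in> PB" "q = i' y"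
        using topspace_N openin_subset by blast
    then show "\<exists>W\<in>?B. q \<in> W \<and> W \<subseteq> U"
    proof cases
      case 1
      then obtain W where "W \<in> BA" "x \<in> W" "W \<subseteq> {x \<in> PA. i x \<in> U}" using BA(3)[OF pull_open, of U x] Uq by auto
      then show ?thesis using 1 by (intro bexI[of _ "i ` (W \<inter> PA)"]) auto
    next
      case 2
      then obtain W where "W \<in> BB" "y \<in> W" "W \<subseteq> {y \<in> PB. i' y \<in> U}"
          using BB(3)[OF S.pull_open, of U y] Uq PB by auto
      then show ?thesis using 2 by (intro bexI[of _ "i' ` (W \<inter> PB)"]) auto
    qed
  qed
qed

lemma smooth_manifold_N: "smooth_manifold N"
proof -
  interpret S: glued B h' V' A h V N i' j' i j by (rule swap)
  have PB: "S.PA = PB" by (simp add: S.PA_def PB_def)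
  have ch: "e \<in> charts N" if "e \<in> atlas N" for e
    using that pushA_charts S.pushA_charts A.atlas_charts B.atlas_charts unfolding atlas_N by blast
  have "(\<Union>e\<in>atlas N. fst e) = topspace (mtop N)"
  proof
    show "(\<Union>e\<in>atlas N. fst e) \<subseteq> topspace (mtop N)" using ch chartD(4) by blast
    show "topspace (mtop N) \<subseteq> (\<Union>e\<in>atlas N. fst e)"
    proof
      fix q assume "q \<in> topspace (mtop N)"
      then consider x where "x \<in> PA" "q = i x" | y where "y \<in> PB" "q = i' y" using topspace_N by blast
      then show "q \<in> (\<Union>e\<in>atlas N. fst e)"
      proof cases
        case 1
        then obtain e where "e \<in> atlas A" "x \<in> fst e" using A.atlas_cover[of x] unfolding PA_def by blast
        then show ?thesis using pushA_in[OF A.atlas_charts _ 1(1)] 1(2) unfolding atlas_N by blast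
      next
        case 2
        then obtain e where "e \<in> atlas B" "y \<in> fst e" using B.atlas_cover[of y] unfolding PB_def by blast
        then show ?thesis using S.pushA_in[OF B.atlas_charts] 2 PB unfolding atlas_N by blast
      qed
    qed
  qed
  then show ?thesis unfolding smooth_manifold_def
    using Hausdorff_N second_countable_N ch unfolding charts_def by blast
qed

end

section \<open>The connected sum\<close>

text \<open>T is radial with profile \<open>l\<close>. Near the centre l = s/(1 - t), so inverting T
  w gives norm 1 - t, which is the gluing; near the boundary l = t and T is the identity. It carries
  the punctured ball into the annulus on which the neck metric lives.\<close>

lemma radial_diffeo:
  assumes s: "0 < s" "s < 3/16"
  shows "\<exists>T :: real ^ 'n::finite \<Rightarrow> real ^ 'n. smooth_on pball T \<and> inj_on T pball
      \<and> (\<forall>w\<in>pball. invertible (jac T w)) \<and>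
    (\<forall>w\<in>pball. s < norm (T w) \<and> norm (T w) < 1) \<and> (\<forall>w\<in>pball. norm w > 3/4 \<longrightarrow> T w = w) \<and>
    (\<forall>w\<in>pball. norm w < 1/4 \<longrightarrow> inversion s (T w) = reflect w)"
proof -
  define \<beta> where "\<beta> t = step (2 * t - 1/2)" for t
  \<comment> \<open>The weight \<beta> passes from 0 at t = 1/4 to 1 at t = 3/4. Both profiles
    increase; the derivative of \<beta> enters multiplied by t - s/(1 - t), which therefore has to
    be positive on this interval.\<close>
  define l where "l t = (1 - \<beta> t) * (s / (1 - t)) + \<beta> t * t" for t
  have \<beta>: "0 \<le> \<beta> t" "\<beta> t \<le> 1" "t \<le> 1/4 \<Longrightarrow> \<beta> t = 0" "t \<ge> 3/4 \<Longrightarrow> \<beta> t = 1" for t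
    using step_ge step_le step_0 step_1 by (auto simp: \<beta>_def)
  \<comment> \<open>On [1/4, 3/4] the product t (1 - t) is at least 3/16; this is the origin of the
    bound on s.\<close>
  have gap: "s / (1 - t) < t" if "1/4 \<le> t" "t \<le> 3/4" for t
  proof -
    have "0 \<le> (t - 1/4) * (3/4 - t)" using that by simp
    moreover have "(t - 1/4) * (3/4 - t) = t * (1 - t) - 3/16" by (simp add: field_simps)
    ultimately have "s < t * (1 - t)" using s by linarith
    then show ?thesis using that by (simp add: divide_less_eq)
  qed
  have s\<beta>: "smooth_on {0<..<1} \<beta>" unfolding \<beta>_def[abs_def]
    by (intro smooth_on_step_compose smooth_on_diff smooth_on_mult smooth_on_const smooth_on_id) auto
  have sl: "smooth_on {0<..<1} l" unfolding l_def[abs_def]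
    by (intro smooth_on_add smooth_on_mult smooth_on_diff smooth_on_divide s\<beta> smooth_on_const smooth_on_id) auto
  have dl: "\<exists>d>0. (l has_real_derivative d) (at t)" if t: "0 < t" "t < 1" for t
  proof -
    obtain b where b: "b \<ge> 0" "(step has_real_derivative b) (at (2 * t - 1/2))" using step_deriv by blast
    have d\<beta>: "(\<beta> has_real_derivative b * 2) (at t)"
      unfolding \<beta>_def[abs_def] by (rule DERIV_chain2[of step b
          "\<lambda>t. 2 * t - 1/2" t 2 UNIV, OF b(2)]) (auto intro!: derivative_eq_intros)
    have "(l has_real_derivative (1 - \<beta> t) * (s / ((1 - t) * (1 - t))) + \<beta> t + b * 2 * (t - s / (1 -
        t))) (at t)"
    proof -
      have ds: "((\<lambda>t. s / (1 - t)) has_real_derivative s / ((1 - t) * (1 - t))) (at t)"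
        using t by (auto intro!: derivative_eq_intros)
      define D where "D = s / ((1 - t) * (1 - t))"
      define E where "E = s / (1 - t)"
      show ?thesis unfolding l_def[abs_def]
        by (rule DERIV_cong[OF DERIV_add[OF DERIV_mult[OF DERIV_diff[OF DERIV_const d\<beta>] ds]
            DERIV_mult[OF d\<beta> DERIV_ident]]])
          (simp add: D_def[symmetric] E_def[symmetric] algebra_simps)
    qed
    moreover have "b * 2 * (t - s / (1 - t)) \<ge> 0"
    proof (cases "1/4 \<le> t \<and> t \<le> 3/4")
      case True
      then show ?thesis using gap[of t] b(1) by simp
    next
      case False
      then consider "t < 1/4" | "t > 3/4" by linarith
      then have d0: "(\<beta> has_real_derivative 0) (at t)"
      proof cases
        case 1
        have "((\<lambda>t. 0) has_real_derivative 0) (at t)" by simp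
        then show ?thesis by (rule has_field_derivative_transform_within_open[of _ _ _ "{..<1/4}"])
            (use 1 \<beta>(3) in auto)
      next
        case 2
        have "((\<lambda>t. 1) has_real_derivative 0) (at t)" by simp
        then show ?thesis by (rule has_field_derivative_transform_within_open[of _ _ _ "{3/4<..}"])
            (use 2 \<beta>(4) in auto)
      qed
      \<comment> \<open>Outside [1/4, 3/4] the weight is locally constant, so the term whose sign is
        not controlled there vanishes.\<close>
      have "b * 2 = 0" by (rule DERIV_unique[OF d\<beta> d0])
      then show ?thesis by simp
    qed
    moreover have "(1 - \<beta> t) * (s / ((1 - t) * (1 - t))) + \<beta> t > 0"
    proof (cases "\<beta> t = 0")
      case False
      then have "\<beta> t > 0" using \<beta>(1)[of t] by simp
      moreover have "(1 - \<beta> t) * (s / ((1 - t) * (1 - t))) \<ge> 0" using \<beta>(2)[of t] s t by simp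
      ultimately show ?thesis by simp
    qed (use s t in simp)
    ultimately show ?thesis using add_pos_nonneg by blast
  qed
  have l_bounds: "s < l t" "l t < 1" if t: "0 < t" "t < 1" for t
  proof -
    have convex: "(1 - \<beta> t) * a + \<beta> t * b < (1 - \<beta> t) * c + \<beta> t * d" if "\<beta> t \<noteq> 1 \<Longrightarrow> a < c" "\<beta> t \<noteq> 0
        \<Longrightarrow> b < d" for a b c d
    proof -
      consider "\<beta> t = 0" | "\<beta> t = 1" | "0 < \<beta> t" "\<beta> t < 1" using \<beta>(1,2)[of t] by linarith
      then show ?thesis
      proof cases
        case 3
        then have "(1 - \<beta> t) * a < (1 - \<beta> t) * c" "\<beta> t * b < \<beta> t * d"
          using that by (auto intro!: mult_strict_left_mono)
        then show ?thesis by linarith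
      qed (use that in simp_all)
    qed
    have "s < s / (1 - t)" using s t by (simp add: less_divide_eq)
    moreover have "s < t" if "\<beta> t \<noteq> 0" using \<beta>(3)[of t] that s by (cases "t \<le> 1/4") auto
    ultimately have "(1 - \<beta> t) * s + \<beta> t * s < l t"
      unfolding l_def by (intro convex)
    then show "s < l t" by (simp add: algebra_simps)
    have "s / (1 - t) < 1" if "\<beta> t \<noteq> 1" using \<beta>(4)[of t] that s t by (cases
        "t \<ge> 3/4") (auto simp: divide_less_eq)
    then have "l t < (1 - \<beta> t) * 1 + \<beta> t * 1"
      unfolding l_def using t by (intro convex)
    then show "l t < 1" by simp
  qed
  have l_mono: "l a < l b" if "0 < a" "a < b" "b < 1" for a b
  proof (rule DERIV_pos_imp_increasing[OF that(2)])
    fix x assume "a \<le> x" "x \<le> b"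
    then show "\<exists>y. (l has_real_derivative y) (at x) \<and> 0 < y" using dl[of x] that by auto
  qed
  define T :: "real ^ 'n \<Rightarrow> real ^ 'n" where "T w = (l (norm w) / norm w) *\<^sub>R w" for w
  have pb: "w \<noteq> 0" "0 < norm w" "norm w < 1" if "w \<in> pball" for w :: "real ^ 'n" using that
      by (auto simp: pball_def)
  have nT: "norm (T w) = l (norm w)" if "w \<in> pball" for w
    using l_bounds(1)[of "norm w"] pb[OF that] s by (simp add: T_def)
  have "smooth_on pball (\<lambda>w :: real ^ 'n. norm w)"
    by (rule smooth_on_norm[OF open_pball smooth_on_id pb(1)])
  then have sT: "smooth_on pball T" unfolding T_def[abs_def] using pb
    by (intro smooth_on_scaleR smooth_on_divide smooth_on_compose[OF open_pball _ _ _ sl] open_pball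
        smooth_on_id) auto
  have "inj_on T pball"
  proof (rule inj_onI)
    fix a b assume ab: "a \<in> pball" "b \<in> pball" "T a = T b"
    then have l: "l (norm a) = l (norm b)" using nT by metis
    then have n: "norm a = norm b" using l_mono[of "norm a" "norm b"] l_mono[of "norm b"
        "norm a"] pb[OF ab(1)] pb[OF ab(2)]
      by (cases "norm a" "norm b" rule: linorder_cases) auto
    have "l (norm a) / norm a \<noteq> 0" using l_bounds(1)[of "norm a"] pb[OF ab(1)] s by auto
    then show "a = b" using ab(3) n unfolding T_def by simp
  qed
  moreover have "invertible (jac T w)" if w: "w \<in> pball" for w
  proof (rule invertible_ker)
    fix v assume "jac T w *v v = 0"
    then have v0: "dderiv T v w = 0" using jac_works[OF smooth_on_differentiable[OF sT w]] by simp
    define t where "t = norm w"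
    have t: "0 < t" "t < 1" using pb[OF w] by (auto simp: t_def)
    obtain d where d: "d > 0" "(l has_real_derivative d) (at t)" using dl[OF t] by blast
    \<comment> \<open>The derivative of l(t)/t. A kernel vector of the Jacobian has to be radial, v
      = c w, and on radial vectors the Jacobian acts by the factor d > 0; hence c = 0.\<close>
    define \<alpha> where "\<alpha> = (d * t - l t) / (t * t)"
    have "((\<lambda>t. l t / t) has_real_derivative \<alpha>) (at t)"
      unfolding \<alpha>_def using t by (auto intro!: derivative_eq_intros d simp: field_simps)
    then have "((\<lambda>w. l (norm w) / norm w) has_derivative (\<lambda>v. \<alpha> * (v \<bullet> sgn w))) (at w)"
      using has_derivative_compose[OF has_derivative_norm[OF pb(1)[OF w]], of "\<lambda>t. l t / t" "(*) \<alpha>"]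
      unfolding has_field_derivative_def t_def by simp
    from has_derivative_scaleR[OF this has_derivative_ident]
    have "dderiv T v w = (l t / t) *\<^sub>R v + (\<alpha> * (v \<bullet> sgn w)) *\<^sub>R w"
      unfolding T_def[abs_def] t_def by (rule dderiv_eq)
    then have e: "(l t / t) *\<^sub>R v = - (\<alpha> * (v \<bullet> sgn w)) *\<^sub>R w" using v0 by (simp add: eq_neg_iff_add_eq_0)
    have lt: "l t / t > 0" using l_bounds(1)[OF t] s t by simp
    define L where "L = l t / t"
    define c where "c = - (\<alpha> * (v \<bullet> sgn w)) / L"
    have Lc: "L * c = - (\<alpha> * (v \<bullet> sgn w))" using lt by (simp add: c_def L_def[symmetric])
    have "L *\<^sub>R v = L *\<^sub>R (c *\<^sub>R w)" using e[folded L_def] by (simp add: Lc)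
    moreover have "L \<noteq> 0" using lt unfolding L_def by linarith
    ultimately have vc: "v = c *\<^sub>R w" by (rule scaleR_left_imp_eq[rotated])
    have "w \<bullet> sgn w = t" using pb(1)[OF w] by (simp add: sgn_div_norm t_def dot_square_norm power2_eq_square)
    then have "v \<bullet> sgn w = c * t" unfolding vc by simp
    then have "c * (L + \<alpha> * t) = 0" using Lc by (simp add: algebra_simps)
    moreover have "L + \<alpha> * t = d" unfolding \<alpha>_def L_def using t by (simp add: field_simps)
    ultimately show "v = 0" using d(1) vc by simp
  qed
  moreover have "T w = w" if "w \<in> pball" "norm w > 3/4" for w
    using \<beta>(4)[of "norm w"] pb[OF that(1)] that(2) by (simp add: T_def l_def)
  moreover have "inversion s (T w) = reflect w" if "w \<in> pball" "norm w < 1/4" for w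
  proof -
    have "l (norm w) = s / (1 - norm w)" using \<beta>(3)[of "norm w"] that by (simp add: l_def)
    then show ?thesis
      using pb[OF that(1)] s nT[OF that(1)]
      by (simp add: inversion_def dot_square_norm reflect_def) (simp add: T_def power2_eq_square)
  qed
  ultimately show ?thesis using sT nT l_bounds pb by (intro exI[of _ T]) auto
qed

section \<open>Compatible local metrics on the glued space\<close>

context glued begin

text \<open>The region outside radius 3/4, where the metric of A is kept. After gluing it does not
  meet the corresponding region of B, since glued radii sum to 1.\<close>

definition "OA = PA - h ` cball 0 (3/4)"

lemma open_OA: "openin (mtop A) OA"
  unfolding OA_def by (intro openin_diff open_PA A.closed_disc) auto

definition "cutA c = (fst c \<inter> OA, snd c)" for c :: "('a, 'n) chart"

lemma cutA: "c \<in> charts A \<Longrightarrow> cutA c \<in> charts A"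
  unfolding cutA_def by (rule A.restrict_chart[OF _ open_OA])

lemma h_OA: "w \<in> pball \<Longrightarrow> h w \<in> OA \<longleftrightarrow> norm w > 3/4"
proof -
  assume w: "w \<in> pball"
  have "h w \<in> h ` cball 0 (3/4) \<longleftrightarrow> norm w \<le> 3/4"
  proof -
    have "cball 0 (3/4) \<subseteq> V" using A.V(2) by auto
    then show ?thesis using inj_on_image_mem_iff[OF A.inj_h h_pball(2)[OF w], of "cball 0 (3/4)"] by simp
  qed
  then show ?thesis using h_pball(1)[OF w] by (auto simp: OA_def)
qed

lemma cutA_fst: "c \<in> charts A \<Longrightarrow> fst (pushA (cutA c)) = i ` (fst c \<inter> OA)"
  unfolding pushA_fst[OF cutA] by (auto simp: cutA_def OA_def)

lemma cutA_transition:
  assumes c: "c \<in> charts A" and x: "x \<in> fst c" "x \<in> OA"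
  shows "transition (pushA (cutA c)) D (snd c x) = snd D (i x)"
  using pushA_transition[OF cutA[OF c], of x D] x by (simp add: cutA_def OA_def)

text \<open>Near the point the transition between the two pushed charts coincides with the
  transition inside A, so the tensor law of the given metric applies.\<close>

lemma cutA_compat:
  assumes g: "riemannian_manifold A g" and c: "c \<in> charts A" and d: "d \<in> charts A"
    and p: "p \<in> fst (pushA (cutA c))" "p \<in> fst (pushA (cutA d))"
  shows "g c (snd (pushA (cutA c)) p) = pull (transition (pushA (cutA c)) (pushA (cutA d))) (g d) (snd
      (pushA (cutA c)) p)"
proof -
  obtain x where x: "x \<in> fst c" "x \<in> OA" "p = i x" using p(1) by (auto simp: cutA_fst[OF c])
  obtain y where y: "y \<in> fst d" "y \<in> OA" "p = i y" using p(2) by (auto simp: cutA_fst[OF d])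
  have PA: "x \<in> PA" "y \<in> PA" using x y by (auto simp: OA_def)
  then have "y = x" using x(3) y(3) inj_i by (auto simp: inj_on_def)
  let ?O = "snd c ` (fst c \<inter> (fst d \<inter> OA))"
  have O: "open ?O" by (intro chartD(5)[OF c] openin_Int chartD(1)[OF d] open_OA)
  have sx: "snd (pushA (cutA c)) p = snd c x" unfolding x(3) pushA_snd[OF PA(1)] by (simp add: cutA_def)
  have eq: "transition (pushA (cutA c)) (pushA (cutA d)) z = transition c d z" if zO: "z \<in> ?O" for z
  proof -
    obtain u where u: "u \<in> fst c" "u \<in> fst d" "u \<in> OA" "z = snd c u" using zO by blast
    then have uPA: "u \<in> PA" by (auto simp: OA_def)
    show ?thesis unfolding u(4) cutA_transition[OF c u(1,3)] transition_chart[OF c u(1)] pushA_snd[OF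
        uPA] by (simp add: cutA_def)
  qed
  have xO: "snd c x \<in> ?O" using x y \<open>y = x\<close> by auto
  have "jac (transition (pushA (cutA c)) (pushA (cutA d))) (snd c x) = jac (transition c d) (snd c x)"
    by (rule jac_cong[OF O xO eq])
  then show ?thesis
    using A.tensor_transform[OF g c d x(1)] y(1) \<open>y = x\<close> unfolding sx pull_def eq[OF xO] by simp
qed

text \<open>At radii above 3/4 the neck chart D is the disc chart and K the given metric, so near
  the point the transition to D is the one to \<open>hchart\<close>. D and K stay general because
  the two ends use different neck charts.\<close>

lemma cutA_neck_compat:
  assumes g: "riemannian_manifold A g" and c: "c \<in> charts A"
    and D: "fst D = i ` h ` pball" "\<And>w. w \<in> pball \<Longrightarrow> norm w > 3/4 \<Longrightarrow> snd D (i (h w)) = w"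
    and K: "\<And>w. w \<in> pball \<Longrightarrow> norm w > 3/4 \<Longrightarrow> K w = g A.hchart w"
    and p: "p \<in> fst (pushA (cutA c))" "p \<in> fst D"
  shows "g c (snd (pushA (cutA c)) p) = pull (transition (pushA (cutA c)) D) K (snd (pushA (cutA c)) p)"
proof -
  obtain x where x: "x \<in> fst c" "x \<in> OA" "p = i x" using p(1) by (auto simp: cutA_fst[OF c])
  obtain w where w: "w \<in> pball" "p = i (h w)" using p(2) by (auto simp: D(1))
  have PA: "x \<in> PA" using x by (auto simp: OA_def)
  then have xw: "x = h w" using x(3) w(2) inj_onD[OF inj_i _ PA h_pball(1)[OF w(1)]] by simp
  have nw: "norm w > 3/4" using h_OA[OF w(1)] x(2) xw by simp
  let ?R = "ball 0 1 - cball (0 :: real ^ 'n) (3/4)"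
  have R: "u \<in> ?R \<longleftrightarrow> u \<in> pball \<and> norm u > 3/4" for u by (auto simp: pball_def)
  let ?O = "snd c ` (fst c \<inter> h ` ?R)"
  have "openin (mtop A) (h ` ?R)" by (rule A.h_open) (use A.V(2) in \<open>auto simp: subset_eq\<close>)
  then have O: "open ?O" by (rule chartD(5)[OF c])
  have sx: "snd (pushA (cutA c)) p = snd c x" unfolding x(3) pushA_snd[OF PA] by (simp add: cutA_def)
  have hf: "h u \<in> fst A.hchart" "snd A.hchart (h u) = u" if "u \<in> pball" for u
    using h_pball(2)[OF that] A.hchart_h by (auto simp: A.fst_hchart)
  have val: "transition (pushA (cutA c)) D (snd c (h u)) = u" "transition c A.hchart (snd c (h u)) = u"
    if u: "h u \<in> fst c" "u \<in> pball" "norm u > 3/4" for u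
  proof -
    have "h u \<in> OA" using h_OA u by simp
    then show "transition (pushA (cutA c)) D (snd c (h u)) = u"
      using cutA_transition[OF c u(1)] D(2)[OF u(2,3)] by simp
    show "transition c A.hchart (snd c (h u)) = u" using transition_chart[OF c u(1)] hf[OF u(2)] by simp
  qed
  have eq: "transition (pushA (cutA c)) D z = transition c A.hchart z" if zO: "z \<in> ?O" for z
  proof -
    obtain u where "h u \<in> fst c" "u \<in> ?R" "z = snd c (h u)" using zO by blast
    then show ?thesis using val[of u] R by simp
  qed
  have xO: "snd c x \<in> ?O" using x(1) xw w(1) nw R by blast
  have "jac (transition (pushA (cutA c)) D) (snd c x) = jac (transition c A.hchart) (snd c x)"
    by (rule jac_cong[OF O xO eq])
  then show ?thesis
    using A.tensor_transform[OF g c A.hchart x(1)] hf[OF w(1)] K[OF w(1) nw] val(1)[of w] val(2)[of w]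
        x(1) xw w(1) nw
    unfolding sx pull_def by simp
qed

lemma neck_domain: "i ` h ` pball = i' ` h' ` pball"
proof -
  have "i ` h ` pball = (\<lambda>w. i' (h' (reflect w))) ` pball"
    unfolding image_image by (rule image_cong) (auto simp: i_h)
  also have "\<dots> = i' ` h' ` pball"
    using reflect_pball by (force simp: image_image)
  finally show ?thesis .
qed

lemma cover_A: "x \<in> PA \<Longrightarrow> x \<in> OA \<or> x \<in> h ` pball"
  by (auto simp: OA_def PA_def pball_def)

text \<open>The compatible family consists of the charts of A and B outside radius 3/4 with the
  given metrics, and of two charts \<open>D1\<close> and \<open>D2\<close> of the neck. These have
  the same domain and differ by the inversion; each coincides with the disc coordinates near its own
  end.\<close>

theorem glued_metric:
  assumes gA: "riemannian_manifold A gA" "locally_conformally_flat A gA" "positive_tensor2 A (Ein k gA)"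
    and gB: "riemannian_manifold B gB" "locally_conformally_flat B gB" "positive_tensor2 B (Ein k gB)"
    and n: "CARD('n) \<ge> 3" "k < real CARD('n) - 1"
  shows "\<exists>g. riemannian_manifold N g \<and> locally_conformally_flat N g \<and> positive_tensor2 N (Ein k g)"
proof -
  interpret S: glued B h' V' A h V N i' j' i j by (rule swap)
  interpret N: smooth_mfd N by (unfold_locales) (rule smooth_manifold_N)
  have PB: "S.PA = PB" by (simp add: S.PA_def PB_def)
  obtain K1 \<sigma>1 f1 where K1: "good_metric k (ball 0 1) K1" "0 < \<sigma>1" "\<sigma>1 \<le> 1/2" "smooth_on (ball 0 \<sigma>1) f1"
    "\<And>z. z \<in> ball 0 \<sigma>1 \<Longrightarrow> K1 z = conf f1 z" "\<And>z. 1/2 < norm z \<Longrightarrow> norm z < 1 \<Longrightarrow> K1 z = gA A.hchart z"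
    using A.straightened_metric[OF gA] by blast
  obtain K2 \<sigma>2 f2 where K2: "good_metric k (ball 0 1) K2" "0 < \<sigma>2" "\<sigma>2 \<le> 1/2" "smooth_on (ball 0 \<sigma>2) f2"
    "\<And>z. z \<in> ball 0 \<sigma>2 \<Longrightarrow> K2 z = conf f2 z" "\<And>z. 1/2 < norm z \<Longrightarrow> norm z < 1 \<Longrightarrow> K2 z = gB B.hchart z"
    using B.straightened_metric[OF gB] by blast
  let ?\<sigma> = "min \<sigma>1 \<sigma>2"
  have "smooth_on (ball 0 ?\<sigma>) f1" "smooth_on (ball 0 ?\<sigma>) f2"
    by (auto intro: smooth_on_subset[OF K1(4)] smooth_on_subset[OF K2(4)])
  then have "\<exists>s K. 0 < s \<and> s < 3/16 \<and> good_metric k {z. s < norm z \<and> norm z < 1} K \<and>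
    (\<forall>z. 1/2 \<le> norm z \<and> norm z < 1 \<longrightarrow> K z = K1 z \<and> pull (inversion s) K z = K2 z)"
    by (intro neck[OF K1(1) K2(1), of ?\<sigma> f1 f2] n) (use K1(2,3,5) K2(2,3,5) in auto)
  then obtain s K where s: "0 < s" "s < 3/16" and K: "good_metric k {z. s < norm z \<and> norm z < 1} K"
    "\<And>z. 1/2 \<le> norm z \<Longrightarrow> norm z < 1 \<Longrightarrow> K z = K1 z \<and> pull (inversion s) K z = K2 z"
    by blast
  obtain T :: "real ^ 'n \<Rightarrow> real ^ 'n" where T: "smooth_on pball T" "inj_on T pball" "\<And>w. w \<in> pball
      \<Longrightarrow> invertible (jac T w)"
    "\<And>w. w \<in> pball \<Longrightarrow> s < norm (T w) \<and> norm (T w) < 1" "\<And>w. w \<in> pball \<Longrightarrow> norm w > 3/4 \<Longrightarrow> T w = w"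
    "\<And>w. w \<in> pball \<Longrightarrow> norm w < 1/4 \<Longrightarrow> inversion s (T w) = reflect w"
    using radial_diffeo[OF s] by blast
  let ?i = "inversion s :: real ^ 'n \<Rightarrow> _" and ?K' = "pull (inversion s) K"
  let ?h = "pushA A.hchart"
  have hN: "?h \<in> charts N" by (rule pushA_charts[OF A.hchart])
  have hval: "snd ?h (i (h w)) = w" "i (h w) \<in> fst ?h" if "w \<in> pball" for w
  proof -
    have f: "h w \<in> fst A.hchart" "snd A.hchart (h w) = w" using h_pball(2)[OF that] A.hchart_h
        by (auto simp: A.fst_hchart)
    show "snd ?h (i (h w)) = w" unfolding pushA_snd[OF h_pball(1)[OF that]] by (rule f(2))
    show "i (h w) \<in> fst ?h" by (rule pushA_in[OF A.hchart f(1) h_pball(1)[OF that]])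
  qed
  \<comment> \<open>Disc coordinates of A reparametrised by T, so that near the end belonging to B
    the gluing becomes the inversion.\<close>
  define D1 where "D1 = ({p \<in> fst ?h. snd ?h p \<in> pball}, \<lambda>p. T (snd ?h p))"
  have D1: "D1 \<in> charts N" unfolding D1_def
  proof (rule N.compose_chart[OF hN open_pball _ T(1-3)])
    show "pball \<subseteq> chart_image ?h" using hval by (metis image_eqI subsetI)
  qed
  have D1_dom: "fst D1 = i ` h ` pball"
  proof
    show "i ` h ` pball \<subseteq> fst D1" using hval by (auto simp: D1_def)
    show "fst D1 \<subseteq> i ` h ` pball"
    proof
      fix p assume "p \<in> fst D1"
      then have p: "p \<in> fst ?h" "snd ?h p \<in> pball" by (auto simp: D1_def)
      then obtain x where x: "x \<in> fst A.hchart" "x \<in> PA" "p = i x" by (auto simp: pushA_fst[OF A.hchart])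
      then obtain w where w: "w \<in> V" "x = h w" by (auto simp: A.fst_hchart)
      have "w \<in> pball" using p(2) pushA_snd[OF x(2), of A.hchart] x(3) w A.hchart_h by simp
      then show "p \<in> i ` h ` pball" using x w by blast
    qed
  qed
  have D1_val: "snd D1 (i (h w)) = T w" if "w \<in> pball" for w using hval[OF that] by (simp add: D1_def)
  have D1_im: "chart_image D1 = T ` pball" unfolding D1_dom image_image using D1_val by (intro image_cong) auto
  have D1_ann: "chart_image D1 \<subseteq> {z. s < norm z \<and> norm z < 1}" unfolding D1_im using T(4) by auto
  have nz: "z \<noteq> 0" if "z \<in> chart_image D1" for z using D1_ann that s by auto
  have D1_open: "open (chart_image D1)" by (rule chartD(2)[OF D1])
  have si: "smooth_on (chart_image D1) ?i" by (rule smooth_on_subset[OF smooth_on_inversion]) (use nz in auto)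
  have ii: "inj_on ?i (chart_image D1)" using s by (intro inj_on_inversion) auto
  have ji: "invertible (jac ?i z)" if "z \<in> chart_image D1" for z using nz[OF that] s
      by (intro invertible_jac_inversion) auto
  define D2 where "D2 = ({p \<in> fst D1. snd D1 p \<in> chart_image D1}, \<lambda>p. ?i (snd D1 p))"
  have D2: "D2 \<in> charts N" unfolding D2_def
    by (rule N.compose_chart[OF D1 D1_open _ si ii ji]) auto
  have D2_dom: "fst D2 = fst D1" by (auto simp: D2_def)
  have D2_im: "chart_image D2 = ?i ` chart_image D1" unfolding D2_dom by (auto simp: D2_def)
  have goodK: "good_metric k (chart_image D1) K" by (rule good_metric_subset[OF K(1) D1_open D1_ann])
  have goodK': "good_metric k (chart_image D2) ?K'"
  proof (rule good_metric_pull[OF goodK chartD(2)[OF D2]])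
    have nz2: "z \<noteq> 0" if "z \<in> chart_image D2" for z using that nz s unfolding D2_im
        by (auto simp: inversion_def)
    show "smooth_on (chart_image D2) ?i" by (rule smooth_on_subset[OF smooth_on_inversion]) (use nz2 in auto)
    show "inj_on ?i (chart_image D2)" using s by (intro inj_on_inversion) auto
    show "invertible (jac ?i y)" if "y \<in> chart_image D2" for y using nz2[OF that] s
        by (intro invertible_jac_inversion) auto
    show "?i ` chart_image D2 \<subseteq> chart_image D1" unfolding D2_im using s by (auto simp: inversion_inversion)
  qed
  have D1_id: "snd D1 (i (h w)) = w" "K w = gA A.hchart w" if "w \<in> pball" "norm w > 3/4" for w
    using D1_val[OF that(1)] T(5)[OF that] K(2)[of w] K1(6)[of w] that by (auto simp: pball_def)
  \<comment> \<open>Radius above 3/4 in B is radius below 1/4 in A, where T followed by the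
    inversion is \<open>reflect\<close>.\<close>
  have D2_id: "snd D2 (i' (h' w)) = w" "?K' w = gB B.hchart w" if w: "w \<in> pball" "norm w > 3/4" for w
  proof -
    have r: "reflect w \<in> pball" "reflect (reflect w) = w" using reflect_pball[OF w(1)] by auto
    have nr: "norm (reflect w) < 1/4" using reflect(1)[of w] w by (auto simp: pball_def)
    have "snd D2 (i' (h' w)) = ?i (snd D1 (i (h (reflect w))))" using i_h[OF r(1)] r(2) by (simp add: D2_def)
    then show "snd D2 (i' (h' w)) = w" using D1_val[OF r(1)] T(6)[OF r(1) nr] r(2) by simp
    show "?K' w = gB B.hchart w" using K(2)[of w] K2(6)[of w] w by (auto simp: pball_def)
  qed
  have D2_domB: "fst D2 = i' ` h' ` pball" using D2_dom D1_dom neck_domain by simp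
  \<comment> \<open>Compatibility of two local metrics. Symmetry, and transitivity when the last
    domain lies in the middle one, reduce the sixteen ordered pairs of kinds to a few
    computations.\<close>
  define C where "C d G d' G' \<longleftrightarrow> (\<forall>p. p \<in> fst d \<longrightarrow> p \<in> fst d' \<longrightarrow> G (snd d p)
      = pull (transition d d') G' (snd d p))"
    for d d' :: "('c, 'n) chart" and G G' :: "real ^ 'n \<Rightarrow> real ^ 'n ^ 'n"
  have C_sym: "C d' G' d G" if "C d G d' G'" "d \<in> charts N" "d' \<in> charts N" for d G d' G'
    using that N.compat_sym[of d d' _ G G'] unfolding C_def by blast
  have C_trans: "C d G d'' G''" if "C d G d' G'" "C d' G' d'' G''" "d \<in> charts N" "d' \<in> charts N"
      "d'' \<in> charts N" "fst d'' \<subseteq> fst d'" for d G d' G' d'' G''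
    unfolding C_def
  proof (intro allI impI)
    fix p assume p: "p \<in> fst d" "p \<in> fst d''"
    then have p': "p \<in> fst d'" using that(6) by blast
    have "G (snd d p) = pull (transition d d') G' (snd d p)" using that(1) p p' unfolding C_def by blast
    also have "\<dots> = pull (transition d d'') G'' (snd d p)"
      using N.pull_cocycle[where c=d and d=d' and e=d'' and p=p and G=G' and H=G''] that(2-5) p p'
          unfolding C_def by blast
    finally show "G (snd d p) = pull (transition d d'') G'' (snd d p)" .
  qed
  have cA: "pushA (cutA c) \<in> charts N" if "c \<in> charts A" for c by (intro pushA_charts cutA that)
  have cB: "pushB (S.cutA c) \<in> charts N" if "c \<in> charts B" for c by (intro S.pushA_charts S.cutA that)
  have CAA: "C (pushA (cutA c)) (gA c) (pushA (cutA d)) (gA d)" if "c \<in> charts A" "d \<in> charts A" for c d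
    unfolding C_def using cutA_compat[OF gA(1) that] by blast
  have CBB: "C (pushB (S.cutA c)) (gB c) (pushB (S.cutA d)) (gB d)" if "c \<in> charts B" "d \<in> charts B" for c d
    unfolding C_def using S.cutA_compat[OF gB(1) that] by blast
  have CA1: "C (pushA (cutA c)) (gA c) D1 K" if "c \<in> charts A" for c
    unfolding C_def using cutA_neck_compat[OF gA(1) that D1_dom D1_id] by blast
  have CB2: "C (pushB (S.cutA c)) (gB c) D2 ?K'" if "c \<in> charts B" for c
    unfolding C_def using S.cutA_neck_compat[OF gB(1) that D2_domB D2_id] by blast
  have C11: "C D1 K D1 K" unfolding C_def using N.pull_self[OF D1] by simp
  have C22: "C D2 ?K' D2 ?K'" unfolding C_def using N.pull_self[OF D2] by simp
  have C12: "C D1 K D2 ?K'" unfolding C_def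
  proof (intro allI impI)
    fix p assume p: "p \<in> fst D1" "p \<in> fst D2"
    let ?z = "snd D1 p"
    have z: "?z \<in> chart_image D1" using p(1) by blast
    have eq: "transition D1 D2 y = ?i y" if yD: "y \<in> chart_image D1" for y
    proof -
      obtain r where r: "r \<in> fst D1" "y = snd D1 r" using yD by blast
      then show ?thesis using transition_chart[OF D1 r(1), of D2] by (simp add: D2_def)
    qed
    have "jac (transition D1 D2) ?z = jac ?i ?z" by (rule jac_cong[OF D1_open z eq])
    then have "pull (transition D1 D2) ?K' ?z = pull ?i ?K' ?z" unfolding pull_def eq[OF z] by simp
    also have "\<dots> = K ?z" by (rule pull_inversion_inversion[OF nz[OF z] s(1)])
    finally show "K ?z = pull (transition D1 D2) ?K' ?z" by simp
  qed
  have C21: "C D2 ?K' D1 K" by (rule C_sym[OF C12 D1 D2])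
  have C1A: "C D1 K (pushA (cutA c)) (gA c)" if "c \<in> charts A" for c
      by (rule C_sym[OF CA1[OF that] cA[OF that] D1])
  have C2B: "C D2 ?K' (pushB (S.cutA c)) (gB c)" if "c \<in> charts B" for c
      by (rule C_sym[OF CB2[OF that] cB[OF that] D2])
  have CA2: "C (pushA (cutA c)) (gA c) D2 ?K'" if "c \<in> charts A" for c
    by (rule C_trans[OF CA1[OF that] C12 cA[OF that] D1 D2]) (simp add: D2_dom)
  have CB1: "C (pushB (S.cutA c)) (gB c) D1 K" if "c \<in> charts B" for c
    by (rule C_trans[OF CB2[OF that] C21 cB[OF that] D2 D1]) (simp add: D2_dom)
  have C2A: "C D2 ?K' (pushA (cutA c)) (gA c)" if "c \<in> charts A" for c
      by (rule C_sym[OF CA2[OF that] cA[OF that] D2])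
  have C1B: "C D1 K (pushB (S.cutA c)) (gB c)" if "c \<in> charts B" for c
      by (rule C_sym[OF CB1[OF that] cB[OF that] D1])
  \<comment> \<open>A common point would have disc radius above 3/4 on both sides, while the two
    radii sum to 1.\<close>
  have disj: "fst (pushA (cutA c)) \<inter> fst (pushB (S.cutA d)) = {}" if cd: "c \<in> charts A" "d \<in> charts B" for c d
  proof (rule ccontr)
    assume "\<not> ?thesis"
    then obtain p where p: "p \<in> fst (pushA (cutA c))" "p \<in> fst (pushB (S.cutA d))" by blast
    obtain x where x: "x \<in> OA" "p = i x" using p(1) by (auto simp: cutA_fst[OF cd(1)])
    obtain y where y: "y \<in> S.OA" "p = i' y" using p(2) by (auto simp: S.cutA_fst[OF cd(2)])
    have xy: "x \<in> OA" "y \<in> S.OA" "i x = i' y" using x y by simp_all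
    have "x \<in> PA" "y \<in> PB" using xy PB by (auto simp: OA_def S.OA_def)
    then obtain w where w: "w \<in> pball" "x = h w" "y = h' (reflect w)" using glue_iff xy(3) by blast
    have "norm w > 3/4" using h_OA[OF w(1)] xy(1) w(2) by simp
    moreover have "norm (reflect w) > 3/4" using S.h_OA[OF reflect_pball(1)[OF w(1)]] xy(2) w(3) by simp
    ultimately show False using reflect(1)[of w] w(1) by (auto simp: pball_def)
  qed
  have CAB: "C (pushA (cutA c)) (gA c) (pushB (S.cutA d)) (gB d)"
      "C (pushB (S.cutA d)) (gB d) (pushA (cutA c)) (gA c)"
    if "c \<in> charts A" "d \<in> charts B" for c d
    unfolding C_def using disj[OF that] by blast+
  let ?P = "(\<lambda>c. (pushA (cutA c), gA c)) ` charts A \<union> (\<lambda>c. (pushB (S.cutA c), gB c)) ` charts B \<union> {(D1,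
      K), (D2, ?K')}"
  have goodA: "good_metric k (chart_image (pushA (cutA c))) (gA c)" if c: "c \<in> charts A" for c
  proof (rule good_metric_subset[OF A.charts_good[OF gA c] chartD(2)[OF cA[OF c]]])
    show "chart_image (pushA (cutA c)) \<subseteq> chart_image c"
      unfolding cutA_fst[OF c] by (auto simp: OA_def pushA_snd) (simp add: cutA_def)
  qed
  have goodB: "good_metric k (chart_image (pushB (S.cutA c))) (gB c)" if c: "c \<in> charts B" for c
  proof (rule good_metric_subset[OF B.charts_good[OF gB c] chartD(2)[OF cB[OF c]]])
    show "chart_image (pushB (S.cutA c)) \<subseteq> chart_image c"
      unfolding S.cutA_fst[OF c] by (auto simp: S.OA_def S.pushA_snd) (simp add: S.cutA_def)
  qed
  show ?thesis
  proof (rule N.metric_from_family[of ?P k])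
    show "d \<in> charts N \<and> good_metric k (chart_image d) G" if "(d, G) \<in> ?P" for d G
      using that cA cB D1 D2 goodA goodB goodK goodK' by blast
    show "\<exists>(d, G)\<in>?P. p \<in> fst d" if p: "p \<in> topspace (mtop N)" for p
    proof -
      consider x where "x \<in> OA" "p = i x" | y where "y \<in> S.OA" "p = i' y" | "p \<in> fst D1"
        using p cover_A S.cover_A PB neck_domain D1_dom unfolding topspace_N by blast
      then show ?thesis
      proof cases
        case 1
        then obtain e where e: "e \<in> charts A" "x \<in> fst e" using A.atlas_cover[of x] A.atlas_charts
            by (auto simp: OA_def PA_def)
        then have "p \<in> fst (pushA (cutA e))" using 1 by (auto simp: cutA_fst)
        then show ?thesis using e(1) by blast
      next
        case 2
        then obtain e where e: "e \<in> charts B" "y \<in> fst e" using B.atlas_cover[of y] B.atlas_charts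
            by (auto simp: S.OA_def S.PA_def)
        then have "p \<in> fst (pushB (S.cutA e))" using 2 by (auto simp: S.cutA_fst)
        then show ?thesis using e(1) by blast
      qed blast
    qed
    fix d G d' G' p
    assume dG: "(d, G) \<in> ?P" "(d', G') \<in> ?P" and p: "p \<in> fst d" "p \<in> fst d'"
    have "C d G d' G'"
      using dG
    proof (elim UnE imageE insertE emptyE Pair_inject; simp only:; (elim Pair_inject)?)
    qed (use CAA CBB CA1 CB2 C11 C22 C12 C21 C1A C2B CA2 CB1 C2A C1B CAB in \<open>simp_all (no_asm_simp)\<close>)
    then show "G (snd d p) = pull (transition d d') G' (snd d p)" using p unfolding C_def by blast
  qed
qed

end

section \<open>The connected sum as an instance of gluing\<close>

lemma pball_polar: "(\<exists>w\<in>pball. P w (reflect w)) \<longleftrightarrow> (\<exists>t u. 0 < t \<and> t < 1 \<and> norm u = 1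
    \<and> P (t *\<^sub>R u) ((1 - t) *\<^sub>R u))"
proof
  assume "\<exists>w\<in>pball. P w (reflect w)"
  then obtain w where w: "w \<in> pball" "P w (reflect w)" by blast
  then have nz: "norm w > 0" "norm w < 1" by (auto simp: pball_def)
  have "norm w *\<^sub>R sgn w = w" "(1 - norm w) *\<^sub>R sgn w = reflect w"
    using nz by (auto simp: sgn_div_norm reflect_def divide_inverse)
  then show "\<exists>t u. 0 < t \<and> t < 1 \<and> norm u = 1 \<and> P (t *\<^sub>R u) ((1 - t) *\<^sub>R u)"
    using nz w(2) by (intro exI[of _ "norm w"] exI[of _ "sgn w"]) (auto simp: norm_sgn)
next
  assume "\<exists>t u. 0 < t \<and> t < 1 \<and> norm u = 1 \<and> P (t *\<^sub>R u) ((1 - t) *\<^sub>R u)"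
  then obtain t u where tu: "0 < t" "t < 1" "norm u = 1" "P (t *\<^sub>R u) ((1 - t) *\<^sub>R u)" by blast
  have "t *\<^sub>R u \<in> pball" using tu by (auto simp: pball_def)
  moreover have "reflect (t *\<^sub>R u) = (1 - t) *\<^sub>R u" using tu by (simp add: reflect_def)
  ultimately show "\<exists>w\<in>pball. P w (reflect w)" using tu(4) by metis
qed

text \<open>The class of a point of a summand contains exactly one element from that summand, so
  \<open>THE\<close> inverts the embedding. Points of different summands are identified by
  \<open>glue_pairs\<close> alone, which \<open>pball_polar\<close> rewrites through
  \<open>reflect\<close>.\<close>

lemma glued_connected_sum:
  fixes M :: "('a, 'n::finite) manifold" and N :: "('b, 'n) manifold"
  assumes A: "disc M h V" and B: "disc N k W" and dM: "disc_embedding M h" and dN: "disc_embedding N k"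
  shows "glued M h V N k W (connected_sum M N h k) (glue_inl M N h k) (\<lambda>q. THE x. Inl x \<in> q)
    (glue_inr M N h k) (\<lambda>q. THE y. Inr y \<in> q)"
proof -
  interpret A: disc M h V by (rule A)
  interpret B: disc N k W by (rule B)
  let ?A = "topspace (mtop M) - {h 0}" and ?B = "topspace (mtop N) - {k 0}"
  let ?i = "glue_inl M N h k" and ?i' = "glue_inr M N h k" and ?R = "glue_rel M N h k" and ?S =
      "punctured_sum M N h k"
  have eq: "equiv ?S ?R" by (rule equiv_glue_rel[OF dM dN])
  have S: "Inl x \<in> ?S \<longleftrightarrow> x \<in> ?A" "Inr y \<in> ?S \<longleftrightarrow> y \<in> ?B" for x y by (auto simp: punctured_sum_def)
  have inl: "Inl x' \<in> ?i x \<longleftrightarrow> x' = x \<and> x \<in> ?A" for x x'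
    by (auto simp: glue_inl_def glue_rel_def glue_pairs_def S)
  have inr: "Inr y' \<in> ?i' y \<longleftrightarrow> y' = y \<and> y \<in> ?B" for y y'
    by (auto simp: glue_inr_def glue_rel_def glue_pairs_def S)
  have cross: "(Inl x, Inr y) \<in> ?R \<longleftrightarrow> (\<exists>w\<in>pball. x = h w \<and> y = k (reflect w))" for x y
    unfolding pball_polar[of "\<lambda>w w'. x = h w \<and> y = k w'"]
    by (auto simp: glue_rel_def glue_pairs_def)
  have top: "openin (mtop (connected_sum M N h k)) = csum_open M N h k"
    by (simp add: connected_sum_def topology_inverse'[OF istopology_csum_open])
  have quot: "?S // ?R = ?i ` ?A \<union> ?i' ` ?B"
    by (auto simp: quotient_def punctured_sum_def glue_inl_def glue_inr_def)
  \<comment> \<open>\<open>csum_open\<close> measures openness in the punctured summands; as these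
    are open, it is the same as openness in the summands.\<close>
  have sub: "openin (subtopology X (- {p})) T \<longleftrightarrow> openin X T"
    if "openin X (topspace X - {p})" "T \<subseteq> topspace X - {p}" for X :: "'z topology" and p T
  proof -
    have "subtopology X (- {p}) = subtopology X (topspace X - {p})"
    proof -
      have "topspace X \<inter> - {p} = topspace X - {p}" by auto
      then show ?thesis using subtopology_restrict[of X "- {p}"] by simp
    qed
    then show ?thesis using openin_open_subtopology[OF that(1), of T] that(2) by simp
  qed
  have pM: "openin (mtop M) ?A" using A.closed_disc[of 0] by (simp add: openin_diff)
  have pN: "openin (mtop N) ?B" using B.closed_disc[of 0] by (simp add: openin_diff)
  show ?thesis
  proof (unfold_locales)
    show "(THE x'. Inl x' \<in> ?i x) = x" if "x \<in> ?A" for x using that by (simp add: inl)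
    show "(THE y'. Inr y' \<in> ?i' y) = y" if "y \<in> ?B" for y using that by (simp add: inr)
    show "openin (mtop (connected_sum M N h k)) U \<longleftrightarrow> U \<subseteq> ?i ` ?A \<union> ?i' ` ?B \<and>
        openin (mtop M) {x \<in> ?A. ?i x \<in> U} \<and> openin (mtop N) {y \<in> ?B. ?i' y \<in> U}" for U
      unfolding top csum_open_def quot
      using sub[OF pM, of "{x \<in> ?A. ?i x \<in> U}"] sub[OF pN, of "{y \<in> ?B. ?i' y \<in> U}"] by auto
    show "?i x = ?i' y \<longleftrightarrow> (\<exists>w\<in>pball. x = h w \<and> y = k (reflect w))" if "x \<in> ?A" "y \<in> ?B" for x y
      unfolding cross[symmetric] glue_inl_def glue_inr_def
      using eq_equiv_class_iff[OF eq, of "Inl x" "Inr y"] that by (simp add: S)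
    show "atlas (connected_sum M N h k) = push ?i (\<lambda>q. THE x. Inl x \<in> q) (h 0) ` atlas M
       \<union> push ?i' (\<lambda>q. THE y. Inr y \<in> q) (k 0) ` atlas N"
    proof -
      have c: "{(f ` (U - {p}), \<lambda>q. \<phi> (j q)) | U \<phi>. (U, \<phi>) \<in> X} = push f j p ` X"
        for f :: "'x \<Rightarrow> 'y" and j p and X :: "('x, 'n) chart set"
      proof (intro equalityI subsetI)
        fix q assume "q \<in> {(f ` (U - {p}), \<lambda>q. \<phi> (j q)) | U \<phi>. (U, \<phi>) \<in> X}"
        then obtain U \<phi> where "(U, \<phi>) \<in> X" "q = push f j p (U, \<phi>)" by (auto simp: push_def)
        then show "q \<in> push f j p ` X" by blast
      next
        fix q assume "q \<in> push f j p ` X"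
        then obtain c where "c \<in> X" "q = push f j p c" by blast
        then show "q \<in> {(f ` (U - {p}), \<lambda>q. \<phi> (j q)) | U \<phi>. (U, \<phi>) \<in> X}"
          by (cases c) (auto simp: push_def)
      qed
      show ?thesis by (simp add: connected_sum_def c)
    qed
  qed
qed

theorem theoremC:
  fixes M\<^sub>1 :: "('a, 'n::finite) manifold" and M\<^sub>2 :: "('b, 'n) manifold"
    and g\<^sub>1 :: "('a, 'n) tensor2" and g\<^sub>2 :: "('b, 'n) tensor2"
    and h\<^sub>1 :: "real ^ 'n \<Rightarrow> 'a" and h\<^sub>2 :: "real ^ 'n \<Rightarrow> 'b"
    and k :: real
  assumes "riemannian_manifold M\<^sub>1 g\<^sub>1" and "riemannian_manifold M\<^sub>2 g\<^sub>2"
    and "compact_space (mtop M\<^sub>1)" and "compact_space (mtop M\<^sub>2)"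
    and "connected_space (mtop M\<^sub>1)" and "connected_space (mtop M\<^sub>2)"
    and "locally_conformally_flat M\<^sub>1 g\<^sub>1" and "locally_conformally_flat M\<^sub>2 g\<^sub>2"
    and "positive_tensor2 M\<^sub>1 (Ein k g\<^sub>1)" and "positive_tensor2 M\<^sub>2 (Ein k g\<^sub>2)"
    and "disc_embedding M\<^sub>1 h\<^sub>1" and "disc_embedding M\<^sub>2 h\<^sub>2"
  shows "(k < 2 \<and> CARD('n) \<ge> 3 \<longrightarrow>
           (\<exists>g. riemannian_manifold (connected_sum M\<^sub>1 M\<^sub>2 h\<^sub>1 h\<^sub>2) g \<and>
                locally_conformally_flat (connected_sum M\<^sub>1 M\<^sub>2 h\<^sub>1 h\<^sub>2) g \<and>
                positive_tensor2 (connected_sum M\<^sub>1 M\<^sub>2 h\<^sub>1 h\<^sub>2) (Ein k g))) \<and>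
         (k \<ge> 2 \<and> real CARD('n) > k + 1 \<longrightarrow>
           (\<exists>g. riemannian_manifold (connected_sum M\<^sub>1 M\<^sub>2 h\<^sub>1 h\<^sub>2) g \<and>
                locally_conformally_flat (connected_sum M\<^sub>1 M\<^sub>2 h\<^sub>1 h\<^sub>2) g \<and>
                positive_tensor2 (connected_sum M\<^sub>1 M\<^sub>2 h\<^sub>1 h\<^sub>2) (Ein k g)))"
proof -
  obtain V\<^sub>1 where V1: "open V\<^sub>1" "cball 0 1 \<subseteq> V\<^sub>1" "inj_on h\<^sub>1 V\<^sub>1"
      "(h\<^sub>1 ` V\<^sub>1, inv_into V\<^sub>1 h\<^sub>1) \<in> charts M\<^sub>1"
    using assms(11) unfolding disc_embedding_def by blast
  obtain V\<^sub>2 where V2: "open V\<^sub>2" "cball 0 1 \<subseteq> V\<^sub>2" "inj_on h\<^sub>2 V\<^sub>2"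
      "(h\<^sub>2 ` V\<^sub>2, inv_into V\<^sub>2 h\<^sub>2) \<in> charts M\<^sub>2"
    using assms(12) unfolding disc_embedding_def by blast
  have "disc M\<^sub>1 h\<^sub>1 V\<^sub>1" "disc M\<^sub>2 h\<^sub>2 V\<^sub>2"
    by (unfold_locales) (use V1 V2 assms(1,2) in \<open>auto simp: riemannian_manifold_def\<close>)
  then interpret glued M\<^sub>1 h\<^sub>1 V\<^sub>1 M\<^sub>2 h\<^sub>2 V\<^sub>2 "connected_sum M\<^sub>1 M\<^sub>2 h\<^sub>1 h\<^sub>2"
      "glue_inl M\<^sub>1 M\<^sub>2 h\<^sub>1 h\<^sub>2" "\<lambda>q. THE x. Inl x \<in> q"
    "glue_inr M\<^sub>1 M\<^sub>2 h\<^sub>1 h\<^sub>2" "\<lambda>q. THE y. Inr y \<in> q"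
    by (rule glued_connected_sum[OF _ _ assms(11,12)])
  \<comment> \<open>Both ranges lead here: k < 2 <= n - 1 in the first, and n > k + 1 >= 3 in the
    second.\<close>
  have *: "\<exists>g. riemannian_manifold (connected_sum M\<^sub>1 M\<^sub>2 h\<^sub>1 h\<^sub>2) g \<and>
                locally_conformally_flat (connected_sum M\<^sub>1 M\<^sub>2 h\<^sub>1 h\<^sub>2) g \<and>
                positive_tensor2 (connected_sum M\<^sub>1 M\<^sub>2 h\<^sub>1 h\<^sub>2) (Ein k g)"
    if "CARD('n) \<ge> 3" "k < real CARD('n) - 1"
    by (rule glued_metric[OF assms(1,7,9) assms(2,8,10) that])
  show ?thesis
  proof (intro conjI impI)
    assume "k < 2 \<and> CARD('n) \<ge> 3"
    then show "\<exists>g. riemannian_manifold (connected_sum M\<^sub>1 M\<^sub>2 h\<^sub>1 h\<^sub>2) g \<and>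
                locally_conformally_flat (connected_sum M\<^sub>1 M\<^sub>2 h\<^sub>1 h\<^sub>2) g \<and>
                positive_tensor2 (connected_sum M\<^sub>1 M\<^sub>2 h\<^sub>1 h\<^sub>2) (Ein k g)"
      by (intro *) linarith+
  next
    assume "k \<ge> 2 \<and> real CARD('n) > k + 1"
    then show "\<exists>g. riemannian_manifold (connected_sum M\<^sub>1 M\<^sub>2 h\<^sub>1 h\<^sub>2) g \<and>
                locally_conformally_flat (connected_sum M\<^sub>1 M\<^sub>2 h\<^sub>1 h\<^sub>2) g \<and>
                positive_tensor2 (connected_sum M\<^sub>1 M\<^sub>2 h\<^sub>1 h\<^sub>2) (Ein k g)"
      by (intro *) linarith+
  qed
qed

end
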